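(* Let $\mathcal{P}_d$ be the set of all pairs $(a,b)$, with $a=(a_1,\ldots,a_s)$, $b=(b_1,\ldots,b_s)$ in $\mathbb{N}^s$, such that $a\neq b$, $d=\sum_{i=1}^s a_i=\sum_{i=1}^s b_i$, $0\leq a_i,b_i\leq d_i-1$ for $i=1,\ldots,n$, where $n:=s-1$, and $a_i\neq 0$ and $b_j\neq 0$ for some $1\leq i,j\leq n$. If $\mathbb{X}=[A_1\times\cdots\times A_n\times\{1\}]\subset\mathbb{P}^n$, with $A_i\subset\mathbb{F}_q$, $d_i=|A_i|$, and $2\leq d_1\leq\cdots\leq d_n$, then $$\mathrm{fp}_{I(\mathbb{X})}(d,2)=\delta_\mathbb{X}(d,2)=\min\{P(a,b) : (a,b)\in\mathcal{P}_d\}\quad\mbox{for } d\leq\sum_{i=1}^n(d_i-1),$$ where $P(a,b)=\prod_{i=1}^n(d_i-a_i)+\prod_{i=1}^n(d_i-b_i)-\prod_{i=1}^n\min\{d_i-a_i,d_i-b_i\}$.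
   Context: Here $d\geq 1$ is an integer and $\mathbb{N}=\{0,1,2,\ldots\}$. $\mathbb{F}_q$ is a finite field, $K=\mathbb{F}_q$, $\mathbb{P}^{n}=\mathbb{P}^{s-1}$ is the projective space over $K$, and $[A_1\times\cdots\times A_n\times\{1\}]$ is the set of classes $[(x_1,\ldots,x_n,1)]$ with $x_i\in A_i$. $S=K[t_1,\ldots,t_s]=\bigoplus_{d\geq 0}S_d$ has the standard grading, and $I(\mathbb{X})$ is the ideal of $S$ generated by the homogeneous polynomials vanishing at all points of $\mathbb{X}$. Write $\mathbb{X}=\{[P_1],\ldots,[P_m]\}$, $m=|\mathbb{X}|$, with representatives whose last entry is $1$. $C_\mathbb{X}(d)$ is the image of the linear map $S_d\to K^m$, $f\mapsto(f(P_1),\ldots,f(P_m))$. For a linear subspace $D\subset K^m$, $\chi(D)=\{i : \exists (c_1,\ldots,c_m)\in D,\ c_i\neq 0\}$. The second generalized Hamming weight of $C_\mathbb{X}(d)$ is $\delta_\mathbb{X}(d,2)=\min\{|\chi(D)| : D\subset C_\mathbb{X}(d)\mbox{ a linear subspace},\ \dim_K D=2\}$. Fix a monomial order $\prec$ on $S$. For a graded ideal $I\neq(0)$ of $S$ with initial ideal $\mathrm{in}_\prec(I)$, $\Delta_\prec(I)_d$ is the set of monomials of degree $d$ not in $\mathrm{in}_\prec(I)$, and $\mathcal{M}_{\prec,d,r}$ is the set of all subsets $M\subset\Delta_\prec(I)_d$ with $r$ distinct elements such that $(\mathrm{in}_\prec(I)\colon(M))\neq\mathrm{in}_\prec(I)$,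 where $(J\colon(M))=\{g\in S : gf\in J\ \forall f\in M\}$. The generalized footprint function of $I$ is $\mathrm{fp}_I(d,r)=\deg(S/I)-\max\{\deg(S/(\mathrm{in}_\prec(I),M)) : M\in\mathcal{M}_{\prec,d,r}\}$ if $\mathcal{M}_{\prec,d,r}\neq\emptyset$, and $\mathrm{fp}_I(d,r)=\deg(S/I)$ if $\mathcal{M}_{\prec,d,r}=\emptyset$. Here, for a graded ideal $J$ with $k$ the Krull dimension of $S/J$, $\deg(S/J)=(k-1)!\lim_{e\to\infty}\dim_K (S/J)_e/e^{k-1}$ if $k\geq 1$ and $\deg(S/J)=\dim_K(S/J)$ if $k=0$.
   Formalization: The monomial order is assumed to have t_s smaller than t_1,…,t_n (for an arbitrary order the first equality can fail), and equality with the minimum is claimed only when P_d is nonempty (P_d is empty for n=d=1, where the minimum is undefined). *)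

theory Defs
  imports
    Complex_Main
    "HOL-Library.Poly_Mapping"
    "HOL-Library.Function_Algebras"
    "HOL-Library.FuncSet"
    "HOL-Algebra.Embedded_Algebras"
    "HOL-Algebra.QuotRing"
begin

text \<open>
  The polynomial ring \<open>S = K[t\<^sub>1,\<dots>,t\<^sub>s]\<close> is carved out of the type of all finitely supported
  functions from exponent vectors to \<open>K\<close>: only the variables with indices \<open>1,\<dots>,s\<close> may occur.
\<close>

type_synonym expo = "nat \<Rightarrow>\<^sub>0 nat"
type_synonym 'k mpoly = "expo \<Rightarrow>\<^sub>0 'k"

definition expos :: "nat \<Rightarrow> expo set" where
  "expos s = {a. Poly_Mapping.keys a \<subseteq> {1..s}}"

definition expo_deg :: "expo \<Rightarrow> nat" where
  "expo_deg a = (\<Sum>i\<in>Poly_Mapping.keys a. Poly_Mapping.lookup a i)"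

definition var_expo :: "nat \<Rightarrow> expo" where
  "var_expo i = Poly_Mapping.single i 1"

definition mono_poly :: "expo \<Rightarrow> ('k::comm_ring_1) mpoly" where
  "mono_poly a = Poly_Mapping.single a 1"

definition const_poly :: "'k \<Rightarrow> ('k::comm_ring_1) mpoly" where
  "const_poly c = Poly_Mapping.single 0 c"

definition poly_ring :: "nat \<Rightarrow> ('k::comm_ring_1) mpoly ring" where
  "poly_ring s = \<lparr>carrier = {f. Poly_Mapping.keys f \<subseteq> expos s},
     mult = (*), one = 1, zero = 0, add = (+)\<rparr>"

definition homog_part :: "nat \<Rightarrow> nat \<Rightarrow> ('k::comm_ring_1) mpoly set" where
  "homog_part s d =
     {f \<in> carrier (poly_ring s). \<forall>a\<in>Poly_Mapping.keys f. expo_deg a = d}"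

definition poly_eval :: "('k::comm_ring_1) mpoly \<Rightarrow> (nat \<Rightarrow> 'k) \<Rightarrow> 'k" where
  "poly_eval f x = (\<Sum>a\<in>Poly_Mapping.keys f. Poly_Mapping.lookup f a *
     (\<Prod>i\<in>Poly_Mapping.keys a. x i ^ Poly_Mapping.lookup a i))"

lemma expos_add: "a \<in> expos s \<Longrightarrow> b \<in> expos s \<Longrightarrow> a + b \<in> expos s"
  using Poly_Mapping.keys_add[of a b] by (auto simp: expos_def)

lemma cring_poly_ring: "cring (poly_ring s :: ('k::comm_ring_1) mpoly ring)"
proof -
  let ?C = "{f :: 'k mpoly. Poly_Mapping.keys f \<subseteq> expos s}"
  have add: "f + g \<in> ?C" if "f \<in> ?C" "g \<in> ?C" for f g
    using that Poly_Mapping.keys_add[of f g] by auto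
  have mult: "f * g \<in> ?C" if "f \<in> ?C" "g \<in> ?C" for f g
    using that Poly_Mapping.keys_mult[of f g] expos_add by fastforce
  have one: "(1 :: 'k mpoly) \<in> ?C"
    by (simp add: expos_def flip: single_one)
  show ?thesis
  proof (rule cringI)
    show "abelian_group (poly_ring s :: 'k mpoly ring)"
    proof (rule abelian_groupI)
      fix f :: "'k mpoly"
      assume "f \<in> carrier (poly_ring s)"
      then show "\<exists>g\<in>carrier (poly_ring s). g \<oplus>\<^bsub>poly_ring s\<^esub> f = \<zero>\<^bsub>poly_ring s\<^esub>"
        by (intro bexI[of _ "- f"]) (auto simp: poly_ring_def)
    qed (use add in \<open>auto simp: poly_ring_def add_ac\<close>)
    show "Group.comm_monoid (poly_ring s :: 'k mpoly ring)"
      by (rule comm_monoidI) (use mult one in \<open>auto simp: poly_ring_def mult_ac\<close>)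
  qed (auto simp: poly_ring_def algebra_simps)
qed


section \<open>Krull dimension and degree\<close>

text \<open>The zero ring has no prime ideals and gets the value 0 here.\<close>

definition krull_dim :: "('a, 'b) ring_scheme \<Rightarrow> nat" where
  "krull_dim R = Sup {k. \<exists>P :: nat \<Rightarrow> 'a set.
     (\<forall>i\<le>k. primeideal (P i) R) \<and> (\<forall>i<k. P i \<subset> P (Suc i))}"

text \<open>Dimension over \<open>K\<close> of the image in \<open>S/J\<close> of a subset \<open>E\<close> of \<open>S\<close>.\<close>

definition quot_dim :: "nat \<Rightarrow> ('k::field) mpoly set \<Rightarrow> 'k mpoly set \<Rightarrow> nat" where
  "quot_dim s J E = ring.dim (poly_ring s Quot J)
     (range (\<lambda>c. J +>\<^bsub>poly_ring s\<^esub> const_poly c))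
     ((\<lambda>f. J +>\<^bsub>poly_ring s\<^esub> f) ` E)"

definition quot_degree :: "nat \<Rightarrow> ('k::field) mpoly set \<Rightarrow> real" where
  "quot_degree s J =
     (let k = krull_dim (poly_ring s Quot J) in
      if k = 0 then real (quot_dim s J (carrier (poly_ring s)))
      else fact (k - 1) * lim (\<lambda>e. real (quot_dim s J (homog_part s e)) / real e ^ (k - 1)))"


section \<open>Monomial orders and the generalized footprint function\<close>

definition monomial_order :: "nat \<Rightarrow> (expo \<Rightarrow> expo \<Rightarrow> bool) \<Rightarrow> bool" where
  "monomial_order s lt \<longleftrightarrow>
     irreflp_on (expos s) lt \<and> transp_on (expos s) lt \<and> totalp_on (expos s) lt \<and>
     (\<forall>a\<in>expos s. a \<noteq> 0 \<longrightarrow> lt 0 a) \<and>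
     (\<forall>a\<in>expos s. \<forall>b\<in>expos s. \<forall>c\<in>expos s. lt a b \<longrightarrow> lt (a + c) (b + c))"

definition lead_expo :: "(expo \<Rightarrow> expo \<Rightarrow> bool) \<Rightarrow> ('k::comm_ring_1) mpoly \<Rightarrow> expo" where
  "lead_expo lt f = (THE a. a \<in> Poly_Mapping.keys f \<and>
     (\<forall>b\<in>Poly_Mapping.keys f. b \<noteq> a \<longrightarrow> lt b a))"

definition initial_ideal ::
  "nat \<Rightarrow> (expo \<Rightarrow> expo \<Rightarrow> bool) \<Rightarrow> ('k::comm_ring_1) mpoly set \<Rightarrow> 'k mpoly set" where
  "initial_ideal s lt I =
     genideal (poly_ring s) {mono_poly (lead_expo lt f) | f. f \<in> I \<and> f \<noteq> 0}"

definition colon_ideal ::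
  "nat \<Rightarrow> ('k::comm_ring_1) mpoly set \<Rightarrow> 'k mpoly set \<Rightarrow> 'k mpoly set" where
  "colon_ideal s J M = {g \<in> carrier (poly_ring s). \<forall>f\<in>M. g * f \<in> J}"

definition std_monomials ::
  "nat \<Rightarrow> (expo \<Rightarrow> expo \<Rightarrow> bool) \<Rightarrow> ('k::comm_ring_1) mpoly set \<Rightarrow> nat \<Rightarrow> 'k mpoly set" where
  "std_monomials s lt I d =
     {mono_poly a | a. a \<in> expos s \<and> expo_deg a = d \<and> mono_poly a \<notin> initial_ideal s lt I}"

definition footprint_sets ::
  "nat \<Rightarrow> (expo \<Rightarrow> expo \<Rightarrow> bool) \<Rightarrow> ('k::comm_ring_1) mpoly set \<Rightarrow> nat \<Rightarrow> nat
     \<Rightarrow> 'k mpoly set set" where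
  "footprint_sets s lt I d r =
     {M. M \<subseteq> std_monomials s lt I d \<and> finite M \<and> card M = r \<and>
         colon_ideal s (initial_ideal s lt I) M \<noteq> initial_ideal s lt I}"

definition gen_footprint ::
  "nat \<Rightarrow> (expo \<Rightarrow> expo \<Rightarrow> bool) \<Rightarrow> ('k::field) mpoly set \<Rightarrow> nat \<Rightarrow> nat \<Rightarrow> real" where
  "gen_footprint s lt I d r =
     (if footprint_sets s lt I d r = {} then quot_degree s I
      else quot_degree s I -
        Max ((\<lambda>M. quot_degree s (genideal (poly_ring s) (initial_ideal s lt I \<union> M)))
               ` footprint_sets s lt I d r))"


section \<open>Projective points, vanishing ideals and evaluation codes\<close>

text \<open>Vectors of \<open>K\<^sup>s\<close> are functions that are \<^const>\<open>undefined\<close> outside \<open>{1..s}\<close>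
  (as in \<^const>\<open>PiE\<close>); a projective point is a set of proportional nonzero vectors.\<close>

definition proj_class :: "nat \<Rightarrow> (nat \<Rightarrow> 'k::field) \<Rightarrow> (nat \<Rightarrow> 'k) set" where
  "proj_class s x = {restrict (\<lambda>i. c * x i) {1..s} | c. c \<noteq> 0}"

definition cartesian_points :: "nat \<Rightarrow> (nat \<Rightarrow> 'k::field set) \<Rightarrow> (nat \<Rightarrow> 'k) set set" where
  "cartesian_points n A =
     proj_class (n + 1) ` (\<Pi>\<^sub>E i\<in>{1..n + 1}. if i \<le> n then A i else {1})"

definition vanishing_ideal :: "nat \<Rightarrow> (nat \<Rightarrow> 'k::field) set set \<Rightarrow> 'k mpoly set" where
  "vanishing_ideal s X = genideal (poly_ring s)
     {f. (\<exists>e. f \<in> homog_part s e) \<and> (\<forall>p\<in>X. \<forall>x\<in>p. poly_eval f x = 0)}"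

definition std_rep :: "nat \<Rightarrow> (nat \<Rightarrow> 'k::field) set \<Rightarrow> nat \<Rightarrow> 'k" where
  "std_rep s p = (THE x. x \<in> p \<and> x s = 1)"

text \<open>The coordinates of \<open>K\<^sup>m\<close>, \<open>m = |X|\<close>, are indexed by the points of \<open>X\<close> themselves instead of
  by an enumeration of them: codewords are functions on points that vanish outside \<open>X\<close>.\<close>

definition eval_code ::
  "nat \<Rightarrow> (nat \<Rightarrow> 'k::field) set set \<Rightarrow> nat \<Rightarrow> ((nat \<Rightarrow> 'k) set \<Rightarrow> 'k) set" where
  "eval_code s X d =
     (\<lambda>f p. if p \<in> X then poly_eval f (std_rep s p) else 0) ` homog_part s d"

definition word_scale :: "'k::field \<Rightarrow> ('p \<Rightarrow> 'k) \<Rightarrow> 'p \<Rightarrow> 'k" where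
  "word_scale c v = (\<lambda>p. c * v p)"

lemma vector_space_word_scale: "vector_space (word_scale :: 'k::field \<Rightarrow> ('p \<Rightarrow> 'k) \<Rightarrow> _)"
  by standard (auto simp: word_scale_def fun_eq_iff algebra_simps)

definition word_support :: "('p \<Rightarrow> 'k::field) set \<Rightarrow> 'p set" where
  "word_support D = {p. \<exists>c\<in>D. c p \<noteq> 0}"

definition gen_hamming_weight :: "nat \<Rightarrow> (nat \<Rightarrow> 'k::field) set set \<Rightarrow> nat \<Rightarrow> nat \<Rightarrow> nat" where
  "gen_hamming_weight s X d r =
     Min {card (word_support D) | D. D \<subseteq> eval_code s X d \<and>
       module.subspace word_scale D \<and> vector_space.dim word_scale D = r}"


section \<open>The combinatorial side\<close>

text \<open>Only the first \<open>n = s - 1\<close> entries are bounded by \<open>\<delta>\<^sub>i - 1\<close> (\<open>\<delta>\<close> stands for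
  \<open>d\<^sub>1,\<dots>,d\<^sub>n\<close>); the last entry is only restricted through the sum.\<close>

definition pairs_P :: "nat \<Rightarrow> (nat \<Rightarrow> nat) \<Rightarrow> nat \<Rightarrow> ((nat \<Rightarrow> nat) \<times> (nat \<Rightarrow> nat)) set" where
  "pairs_P n \<delta> d = {(a, b).
     a \<in> {1..n + 1} \<rightarrow>\<^sub>E UNIV \<and> b \<in> {1..n + 1} \<rightarrow>\<^sub>E UNIV \<and> a \<noteq> b \<and>
     d = (\<Sum>i=1..n + 1. a i) \<and> d = (\<Sum>i=1..n + 1. b i) \<and>
     (\<forall>i\<in>{1..n}. int (a i) \<le> int (\<delta> i) - 1 \<and> int (b i) \<le> int (\<delta> i) - 1) \<and>
     (\<exists>i\<in>{1..n}. a i \<noteq> 0) \<and> (\<exists>j\<in>{1..n}. b j \<noteq> 0)}"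

definition P_val :: "nat \<Rightarrow> (nat \<Rightarrow> nat) \<Rightarrow> (nat \<Rightarrow> nat) \<Rightarrow> (nat \<Rightarrow> nat) \<Rightarrow> int" where
  "P_val n \<delta> a b =
     (\<Prod>i=1..n. int (\<delta> i) - int (a i)) + (\<Prod>i=1..n. int (\<delta> i) - int (b i))
     - (\<Prod>i=1..n. min (int (\<delta> i) - int (a i)) (int (\<delta> i) - int (b i)))"

end

theory Submission
  imports Defs "HOL-Computational_Algebra.Polynomial"
begin

text \<open>
  Put \<open>s = n + 1\<close> and let \<open>I\<close> be the vanishing ideal of \<open>X\<close>. The points of \<open>X\<close> correspond to the box
  \<open>{0,\<dots>,\<delta>\<^sub>1-1} \<times> \<dots> \<times> {0,\<dots>,\<delta>\<^sub>n-1}\<close> after an enumeration of each \<open>A\<^sub>i\<close>, and so do the standard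
  monomials of any large degree, since the exponent of \<open>t\<^sub>s\<close> is fixed by the degree. Call the set of
  box elements that lie above \<open>a\<close> in the coordinates \<open>1,\<dots>,n\<close> the shadow of \<open>a\<close>. By inclusion and
  exclusion \<open>P(a,b)\<close> is the size of the union of the shadows of \<open>a\<close> and \<open>b\<close>
  (\<open>card_upper_box_Un\<close>). Both the weight and the footprint turn out to be the least size of such a
  union over pairs of different standard monomials of degree \<open>d\<close>.

  The weight is at least this minimum because of the footprint bound (\<open>footprint_bound\<close>). Let a set
  \<open>G\<close> of forms vanish on a finite set \<open>Z\<close>. Division by \<open>G\<close> inside one degree \<open>e\<close> replaces a form by one
  with the same values on \<open>Z\<close> in which no monomial is divisible by a leading monomial of \<open>G\<close>. If forms
  of degree \<open>e\<close> take arbitrary values on \<open>Z\<close>, then these remaining monomials span \<open>K\<^sup>Z\<close>, so there are at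
  least \<open>|Z|\<close> of them. For a two-dimensional subcode choose two reduced forms with different leading
  monomials \<open>t\<^sup>a\<close> and \<open>t\<^sup>b\<close>; together with the forms \<open>\<Prod>\<^sub>c (t\<^sub>i - c t\<^sub>s)\<close> they show that the points outside
  the support are at most as many as the box elements outside the two shadows
  (\<open>weight_lower_bound\<close>).

  Conversely every pair is attained, not only a minimal one (\<open>weight_attained\<close>): the product of the
  linear forms that belong to the first \<open>a\<^sub>i\<close> elements of each \<open>A\<^sub>i\<close>, times a power of \<open>t\<^sub>s\<close>, is nonzero at
  a point exactly if the point lies in the shadow of \<open>a\<close>. Two such products span a code whose support
  is the union of the two shadows.

  On the side of the footprint, the footprint bound for a single form shows that a nonzero form vanishing
  on \<open>X\<close> never has a standard leading monomial, whence the initial ideal of \<open>I\<close> is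
  \<open>(t\<^sub>1\<^bsup>\<delta>\<^sub>1\<^esup>, \<dots>, t\<^sub>n\<^bsup>\<delta>\<^sub>n\<^esup>)\<close> (\<open>initial_ideal_VI\<close>). The colon condition on \<open>{t\<^sup>a, t\<^sup>b}\<close> says that neither
  monomial is the power \<open>t\<^sub>s\<^sup>d\<close> (\<open>colon_iff\<close>). All quotients that occur have Krull dimension one
  (\<open>krull_dim_one\<close>) and a Hilbert function that is constant in large degrees, so their degrees count
  points or standard monomials: \<open>\<delta>\<^sub>1\<cdots>\<delta>\<^sub>n\<close> for \<open>I\<close>, and this number minus the size of the union of
  the two shadows after \<open>t\<^sup>a\<close> and \<open>t\<^sup>b\<close> are added to the initial ideal.

  The monomial \<open>t\<^sub>s\<^sup>d\<close> takes part in the minimum for the weight but not in the footprint. Its shadow is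
  the whole box, so it matters only if there is no other pair, and then both sides are \<open>|X|\<close>
  (\<open>Min_pair_sizes\<close>).
\<close>

section \<open>Evaluation on a line through the origin\<close>

definition mon_val :: "(nat \<Rightarrow> 'k::comm_ring_1) \<Rightarrow> expo \<Rightarrow> 'k" where
  "mon_val x a = (\<Prod>i\<in>Poly_Mapping.keys a. x i ^ Poly_Mapping.lookup a i)"

text \<open>
  The polynomial \<open>f(x T)\<close> in one variable \<open>T\<close>. Its coefficients are the values at \<open>x\<close> of the homogeneous
  components of \<open>f\<close>, so it keeps track of the grading, which values at the multiples of \<open>x\<close> cannot do
  over a finite field. It is also the coordinate ring homomorphism of the line through \<open>x\<close>, which
  controls the prime ideals in the computation of Krull dimensions.
\<close>

definition line_eval :: "(nat \<Rightarrow> 'k::comm_ring_1) \<Rightarrow> 'k mpoly \<Rightarrow> 'k poly" where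
  "line_eval x f = (\<Sum>a\<in>Poly_Mapping.keys f.
     monom (Poly_Mapping.lookup f a * mon_val x a) (expo_deg a))"

lemma mon_val_superset:
  assumes "finite B" "Poly_Mapping.keys a \<subseteq> B"
  shows "mon_val x a = (\<Prod>i\<in>B. x i ^ Poly_Mapping.lookup a i)"
  unfolding mon_val_def
  by (rule prod.mono_neutral_left) (use assms in \<open>auto simp: in_keys_iff\<close>)

lemma expo_deg_superset:
  assumes "finite B" "Poly_Mapping.keys a \<subseteq> B"
  shows "expo_deg a = (\<Sum>i\<in>B. Poly_Mapping.lookup a i)"
  unfolding expo_deg_def
  by (rule sum.mono_neutral_left) (use assms in \<open>auto simp: in_keys_iff\<close>)

lemma mon_val_add: "mon_val x (a + b) = mon_val x a * mon_val x b"
proof -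
  let ?B = "Poly_Mapping.keys a \<union> Poly_Mapping.keys b"
  have "Poly_Mapping.keys (a + b) \<subseteq> ?B"
    using Poly_Mapping.keys_add[of a b] by auto
  then show ?thesis
    by (simp add: mon_val_superset[of ?B] lookup_add power_add prod.distrib)
qed

lemma expo_deg_add: "expo_deg (a + b) = expo_deg a + expo_deg b"
proof -
  let ?B = "Poly_Mapping.keys a \<union> Poly_Mapping.keys b"
  have "Poly_Mapping.keys (a + b) \<subseteq> ?B"
    using Poly_Mapping.keys_add[of a b] by auto
  then show ?thesis
    by (simp add: expo_deg_superset[of ?B] lookup_add sum.distrib)
qed

lemma mon_val_0 [simp]: "mon_val x 0 = 1" by (simp add: mon_val_def)
lemma expo_deg_0 [simp]: "expo_deg 0 = 0" by (simp add: expo_deg_def)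

lemma mon_val_single [simp]: "mon_val x (Poly_Mapping.single i k) = x i ^ k"
  by (cases "k = 0") (auto simp: mon_val_def)

lemma expo_deg_single [simp]: "expo_deg (Poly_Mapping.single i k) = k"
  by (cases "k = 0") (auto simp: expo_deg_def)

lemma line_eval_superset:
  assumes "finite B" "Poly_Mapping.keys f \<subseteq> B"
  shows "line_eval x f = (\<Sum>a\<in>B. monom (Poly_Mapping.lookup f a * mon_val x a) (expo_deg a))"
  unfolding line_eval_def
  by (rule sum.mono_neutral_left) (use assms in \<open>auto simp: in_keys_iff\<close>)

lemma line_eval_add: "line_eval x (f + g) = line_eval x f + line_eval x g"
proof -
  let ?B = "Poly_Mapping.keys f \<union> Poly_Mapping.keys g"
  have "Poly_Mapping.keys (f + g) \<subseteq> ?B"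
    using Poly_Mapping.keys_add[of f g] by auto
  then show ?thesis
    by (simp add: line_eval_superset[of ?B] lookup_add algebra_simps add_monom sum.distrib
          flip: sum.distrib)
qed

lemma line_eval_0 [simp]: "line_eval x 0 = 0" by (simp add: line_eval_def)

lemma line_eval_sum: "line_eval x (sum f B) = (\<Sum>b\<in>B. line_eval x (f b))"
  by (induction B rule: infinite_finite_induct) (auto simp: line_eval_add)

lemma line_eval_single [simp]:
  "line_eval x (Poly_Mapping.single a c) = monom (c * mon_val x a) (expo_deg a)"
  by (cases "c = 0") (auto simp: line_eval_def)

lemma sum_single_keys:
  "(\<Sum>a\<in>Poly_Mapping.keys f. Poly_Mapping.single a (Poly_Mapping.lookup f a)) = f"
  by (rule poly_mapping_eqI)
     (auto simp: lookup_sum lookup_single when_def in_keys_iff sum.delta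
       intro!: sum.neutral)

lemma line_eval_mult: "line_eval x (f * g) = line_eval x f * line_eval x g"
proof -
  have "f * g = (\<Sum>a\<in>Poly_Mapping.keys f. \<Sum>b\<in>Poly_Mapping.keys g.
      Poly_Mapping.single (a + b) (Poly_Mapping.lookup f a * Poly_Mapping.lookup g b))"
    by (subst (1) sum_single_keys[of f, symmetric], subst (1) sum_single_keys[of g, symmetric])
       (simp add: sum_product mult_single)
  then have "line_eval x (f * g) = (\<Sum>a\<in>Poly_Mapping.keys f. \<Sum>b\<in>Poly_Mapping.keys g.
      monom (Poly_Mapping.lookup f a * mon_val x a) (expo_deg a) *
      monom (Poly_Mapping.lookup g b * mon_val x b) (expo_deg b))"
    by (simp add: line_eval_sum mon_val_add expo_deg_add mult_monom mult_ac)
  also have "\<dots> = line_eval x f * line_eval x g"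
    by (simp add: line_eval_def sum_product)
  finally show ?thesis .
qed

lemma line_eval_1 [simp]: "line_eval x 1 = 1"
  unfolding single_one[symmetric] line_eval_single by simp

lemma line_eval_uminus [simp]: "line_eval x (- f) = - line_eval x f"
  using line_eval_add[of x f "- f"] by (simp add: eq_neg_iff_add_eq_0 add.commute)

lemma line_eval_diff: "line_eval x (f - g) = line_eval x f - line_eval x g"
  using line_eval_add[of x f "- g"] by simp

text \<open>
  All rules for \<^const>\<open>poly_eval\<close> are inherited from the ring homomorphism \<^const>\<open>line_eval\<close> by
  specialising \<open>T\<close>.
\<close>

lemma poly_eval_scale: "poly_eval f (\<lambda>i. c * x i) = poly (line_eval x f) c"
proof -
  have "mon_val (\<lambda>i. c * x i) a = mon_val x a * c ^ expo_deg a" for a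
    by (simp add: mon_val_def expo_deg_def power_mult_distrib prod.distrib mult.commute power_sum)
  then show ?thesis
    unfolding poly_eval_def line_eval_def mon_val_def[symmetric]
    by (simp add: poly_sum poly_monom mult_ac)
qed

lemma poly_eval_line: "poly_eval f x = poly (line_eval x f) 1"
  using poly_eval_scale[of f 1 x] by simp

lemma poly_eval_add: "poly_eval (f + g) x = poly_eval f x + poly_eval g x"
  by (simp add: poly_eval_line line_eval_add)
lemma poly_eval_diff: "poly_eval (f - g) x = poly_eval f x - poly_eval g x"
  by (simp add: poly_eval_line line_eval_diff)
lemma poly_eval_mult: "poly_eval (f * g) x = poly_eval f x * poly_eval g x"
  by (simp add: poly_eval_line line_eval_mult)
lemma poly_eval_0 [simp]: "poly_eval 0 x = 0" by (simp add: poly_eval_line)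
lemma poly_eval_1 [simp]: "poly_eval 1 x = 1" by (simp add: poly_eval_line)
lemma poly_eval_sum: "poly_eval (sum f B) x = (\<Sum>b\<in>B. poly_eval (f b) x)"
  by (simp add: poly_eval_line line_eval_sum poly_sum)
lemma poly_eval_prod: "poly_eval (prod f B) x = (\<Prod>b\<in>B. poly_eval (f b) x)"
  by (induction B rule: infinite_finite_induct) (auto simp: poly_eval_mult)
lemma poly_eval_single [simp]: "poly_eval (Poly_Mapping.single a c) x = c * mon_val x a"
  by (simp add: poly_eval_line poly_monom)

lemma poly_eval_cong:
  assumes "Poly_Mapping.keys f \<subseteq> expos s" "\<And>i. i \<in> {1..s} \<Longrightarrow> x i = y i"
  shows "poly_eval f x = poly_eval f y"
  unfolding poly_eval_def
proof (intro sum.cong refl arg_cong2[of _ _ _ _ "(*)"] prod.cong)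
  fix a i assume "a \<in> Poly_Mapping.keys f" "i \<in> Poly_Mapping.keys a"
  then have "i \<in> {1..s}" using assms(1) unfolding expos_def by blast
  then show "x i ^ Poly_Mapping.lookup a i = y i ^ Poly_Mapping.lookup a i"
    using assms(2) by simp
qed

section \<open>The graded polynomial ring\<close>

lemma carrier_poly_ring: "f \<in> carrier (poly_ring s) \<longleftrightarrow> Poly_Mapping.keys f \<subseteq> expos s"
  by (simp add: poly_ring_def)

lemma poly_ring_ops [simp]:
  "monoid.mult (poly_ring s) = (*)" "\<one>\<^bsub>poly_ring s\<^esub> = 1"
  "\<zero>\<^bsub>poly_ring s\<^esub> = 0" "add (poly_ring s) = (+)"
  by (simp_all add: poly_ring_def)

lemma homog_part_iff:
  "f \<in> homog_part s e \<longleftrightarrow> (\<forall>a\<in>Poly_Mapping.keys f. a \<in> expos s \<and> expo_deg a = e)"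
  by (auto simp: homog_part_def carrier_poly_ring)

lemma homog_carrier: "f \<in> homog_part s e \<Longrightarrow> f \<in> carrier (poly_ring s)"
  by (simp add: homog_part_def)

lemma homog_0 [simp]: "0 \<in> homog_part s e" by (simp add: homog_part_iff)

lemma homog_add: "f \<in> homog_part s e \<Longrightarrow> g \<in> homog_part s e \<Longrightarrow> f + g \<in> homog_part s e"
  using Poly_Mapping.keys_add[of f g] by (fastforce simp: homog_part_iff)

lemma keys_uminus [simp]: "Poly_Mapping.keys (- f :: 'a \<Rightarrow>\<^sub>0 'b::ab_group_add) = Poly_Mapping.keys f"
  by (auto simp: in_keys_iff)

lemma homog_diff: "f \<in> homog_part s e \<Longrightarrow> g \<in> homog_part s e \<Longrightarrow> f - g \<in> homog_part s e"
  using homog_add[of f s e "- g"] by (simp add: homog_part_iff)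

lemma homog_mult: "f \<in> homog_part s e \<Longrightarrow> g \<in> homog_part s e' \<Longrightarrow> f * g \<in> homog_part s (e + e')"
  using Poly_Mapping.keys_mult[of f g]
  by (fastforce simp: homog_part_iff expos_add expo_deg_add)

lemma homog_single: "a \<in> expos s \<Longrightarrow> expo_deg a = e \<Longrightarrow> Poly_Mapping.single a c \<in> homog_part s e"
  by (cases "c = 0") (auto simp: homog_part_iff)

lemma homog_sum: "(\<And>b. b \<in> B \<Longrightarrow> f b \<in> homog_part s e) \<Longrightarrow> sum f B \<in> homog_part s e"
  by (induction B rule: infinite_finite_induct) (auto intro: homog_add)

lemma homog_prod:
  "(\<And>b. b \<in> B \<Longrightarrow> f b \<in> homog_part s (e b)) \<Longrightarrow> prod f B \<in> homog_part s (sum e B)"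
proof (induction B rule: infinite_finite_induct)
  case empty
  then show ?case
    using homog_single[of 0 s 0 1] by (simp add: expos_def)
qed (use homog_single[of 0 s 0 1] in \<open>auto intro: homog_mult simp: expos_def\<close>)

lemma homog_const_mult: "f \<in> homog_part s e \<Longrightarrow> const_poly c * f \<in> homog_part s e"
  using homog_mult[of "const_poly c" s 0 f e] homog_single[of 0 s 0 c]
  by (simp add: const_poly_def expos_def)

lemma lookup_const_mult [simp]:
  "Poly_Mapping.lookup (const_poly c * f) a = c * Poly_Mapping.lookup f a"
  unfolding const_poly_def mult_map_scale_conv_mult[symmetric]
  by (simp add: Poly_Mapping.map.rep_eq when_def)

lemma poly_eval_const [simp]: "poly_eval (const_poly c) x = c"
  by (simp add: const_poly_def)

lemma monom_sum: "monom (sum f B) e = (\<Sum>b\<in>B. monom (f b) e)"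
  by (induction B rule: infinite_finite_induct) (auto simp: add_monom[symmetric])

lemma line_eval_homog:
  assumes "f \<in> homog_part s e"
  shows "line_eval x f = monom (poly_eval f x) e"
proof -
  have "line_eval x f = (\<Sum>a\<in>Poly_Mapping.keys f. monom (Poly_Mapping.lookup f a * mon_val x a) e)"
    unfolding line_eval_def using assms by (intro sum.cong) (auto simp: homog_part_iff)
  then show ?thesis
    by (simp add: poly_eval_def mon_val_def monom_sum)
qed

lemma lookup_single_mult_add:
  "Poly_Mapping.lookup (Poly_Mapping.single c u * f) (c + a :: expo) = u * Poly_Mapping.lookup f a"
proof -
  have "Poly_Mapping.single c u * f =
      (\<Sum>b\<in>Poly_Mapping.keys f. Poly_Mapping.single (c + b) (u * Poly_Mapping.lookup f b))"
    by (subst (1) sum_single_keys[of f, symmetric]) (simp add: sum_distrib_left mult_single)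
  then show ?thesis
    by (simp add: lookup_sum lookup_single when_def in_keys_iff)
qed

lemma keys_single_mult:
  "Poly_Mapping.keys (Poly_Mapping.single c u * f) \<subseteq> (\<lambda>a :: expo. c + a) ` Poly_Mapping.keys f"
  using Poly_Mapping.keys_mult[of "Poly_Mapping.single c u" f] by (auto split: if_splits)

section \<open>Exponents\<close>

text \<open>
  Divisibility of the corresponding monomials.
\<close>

definition expo_le :: "expo \<Rightarrow> expo \<Rightarrow> bool" where
  "expo_le b a \<longleftrightarrow> (\<forall>i. Poly_Mapping.lookup b i \<le> Poly_Mapping.lookup a i)"

lemma expo_le_refl [simp]: "expo_le a a" by (simp add: expo_le_def)

lemma expo_le_trans: "expo_le a b \<Longrightarrow> expo_le b c \<Longrightarrow> expo_le a c"
  by (meson expo_le_def le_trans)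

lemma expo_le_addI [simp]: "expo_le b (b + c)" by (simp add: expo_le_def lookup_add)

lemma expo_le_add_diff: "expo_le b a \<Longrightarrow> b + (a - b) = a"
  by (rule poly_mapping_eqI) (auto simp: expo_le_def lookup_add lookup_minus)

lemma single_expo_le: "expo_le (Poly_Mapping.single i k) m \<longleftrightarrow> k \<le> Poly_Mapping.lookup m i"
  by (auto simp: expo_le_def lookup_single when_def)

lemma expos_diff: "a \<in> expos s \<Longrightarrow> a - b \<in> expos s"
  by (auto simp: expos_def in_keys_iff lookup_minus subset_iff)

lemma zero_in_expos [simp]: "0 \<in> expos s" by (simp add: expos_def)

lemma lookup_outside: "a \<in> expos s \<Longrightarrow> i \<notin> {1..s} \<Longrightarrow> Poly_Mapping.lookup a i = 0"
  unfolding expos_def in_keys_iff[symmetric] by (metis in_keys_iff mem_Collect_eq subsetD)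

lemma expo_eqI:
  assumes "a \<in> expos s" "b \<in> expos s"
    "\<And>i. i \<in> {1..s} \<Longrightarrow> Poly_Mapping.lookup a i = Poly_Mapping.lookup b i"
  shows "a = b"
proof (rule poly_mapping_eqI)
  fix i show "Poly_Mapping.lookup a i = Poly_Mapping.lookup b i"
    using assms(3)[of i] lookup_outside[OF assms(1), of i] lookup_outside[OF assms(2), of i]
    by (cases "i \<in> {1..s}") simp_all
qed

lemma expo_deg_expos: "a \<in> expos s \<Longrightarrow> expo_deg a = (\<Sum>i=1..s. Poly_Mapping.lookup a i)"
  by (rule expo_deg_superset) (auto simp: expos_def)

lemma mon_val_expos: "a \<in> expos s \<Longrightarrow> mon_val x a = (\<Prod>i=1..s. x i ^ Poly_Mapping.lookup a i)"
  by (rule mon_val_superset) (auto simp: expos_def)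

definition deg_expos :: "nat \<Rightarrow> nat \<Rightarrow> expo set" where
  "deg_expos s e = {a \<in> expos s. expo_deg a = e}"

lemma finite_deg_expos [simp]: "finite (deg_expos s e)"
proof (rule inj_on_finite)
  let ?f = "\<lambda>a :: expo. restrict (Poly_Mapping.lookup a) {1..s}"
  show "inj_on ?f (deg_expos s e)"
  proof (rule inj_onI)
    fix a b assume ab: "a \<in> deg_expos s e" "b \<in> deg_expos s e" "?f a = ?f b"
    show "a = b"
    proof (rule expo_eqI[of _ s])
      show "Poly_Mapping.lookup a i = Poly_Mapping.lookup b i" if "i \<in> {1..s}" for i
        using fun_cong[OF ab(3), of i] that by simp
    qed (use ab in \<open>auto simp: deg_expos_def\<close>)
  qed
  show "?f ` deg_expos s e \<subseteq> (\<Pi>\<^sub>E i\<in>{1..s}. {..e})"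
  proof (clarsimp simp: deg_expos_def)
    fix a i assume a: "a \<in> expos s" "Suc 0 \<le> i" "i \<le> s"
    have "Poly_Mapping.lookup a i \<le> (\<Sum>i=1..s. Poly_Mapping.lookup a i)"
      using a by (intro member_le_sum) auto
    then show "Poly_Mapping.lookup a i \<le> expo_deg a" using expo_deg_expos[OF a(1)] by simp
  qed
  show "finite (\<Pi>\<^sub>E i\<in>{1..s}. {..e})" by (intro finite_PiE) auto
qed

lemma homog_part_deg: "f \<in> homog_part s e \<longleftrightarrow> Poly_Mapping.keys f \<subseteq> deg_expos s e"
  by (auto simp: homog_part_iff deg_expos_def)

section \<open>Leading exponents and division\<close>

locale mono_order =
  fixes s :: nat and lt :: "expo \<Rightarrow> expo \<Rightarrow> bool"
  assumes mono_order: "monomial_order s lt"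
begin

lemma lt_irrefl: "a \<in> expos s \<Longrightarrow> \<not> lt a a"
  using mono_order unfolding monomial_order_def irreflp_on_def by blast

lemma lt_trans:
  "a \<in> expos s \<Longrightarrow> b \<in> expos s \<Longrightarrow> c \<in> expos s \<Longrightarrow> lt a b \<Longrightarrow> lt b c \<Longrightarrow> lt a c"
  using mono_order unfolding monomial_order_def transp_on_def by blast

lemma lt_total: "a \<in> expos s \<Longrightarrow> b \<in> expos s \<Longrightarrow> a \<noteq> b \<Longrightarrow> lt a b \<or> lt b a"
  using mono_order unfolding monomial_order_def totalp_on_def by blast

lemma lt_add: "a \<in> expos s \<Longrightarrow> b \<in> expos s \<Longrightarrow> c \<in> expos s \<Longrightarrow> lt a b \<Longrightarrow> lt (a + c) (b + c)"
  using mono_order unfolding monomial_order_def by blast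

lemma finite_max:
  assumes "finite B" "B \<noteq> {}" "B \<subseteq> expos s"
  shows "\<exists>a\<in>B. \<forall>b\<in>B. b \<noteq> a \<longrightarrow> lt b a"
  using assms
proof (induction rule: finite_ne_induct)
  case (insert x F)
  then obtain a where a: "a \<in> F" "\<forall>b\<in>F. b \<noteq> a \<longrightarrow> lt b a" by auto
  have xa: "x \<in> expos s" "a \<in> expos s" "x \<noteq> a" using insert a by auto
  from lt_total[OF xa] show ?case
  proof
    assume "lt x a" then show ?thesis using a by (intro bexI[of _ a]) auto
  next
    assume *: "lt a x"
    have "lt b x" if "b \<in> F" for b
      using that a * insert.prems xa lt_trans[of b a x] by (cases "b = a") auto
    then show ?thesis by (intro bexI[of _ x]) auto
  qed
qed auto

lemma lead_expo_eqI:
  assumes "f \<in> carrier (poly_ring s)" "a \<in> Poly_Mapping.keys f"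
    "\<And>b. b \<in> Poly_Mapping.keys f \<Longrightarrow> b \<noteq> a \<Longrightarrow> lt b a"
  shows "lead_expo lt f = a"
  unfolding lead_expo_def
proof (rule the_equality)
  fix b assume b: "b \<in> Poly_Mapping.keys f \<and> (\<forall>c\<in>Poly_Mapping.keys f. c \<noteq> b \<longrightarrow> lt c b)"
  have e: "a \<in> expos s" "b \<in> expos s" using assms b by (auto simp: carrier_poly_ring)
  show "b = a"
    using b assms(2) assms(3)[of b] lt_irrefl[OF e(1)] lt_trans[OF e(1) e(2) e(1)] by metis
qed (use assms in auto)

lemma lead_expo:
  assumes "f \<in> carrier (poly_ring s)" "f \<noteq> (0 :: 'k::comm_ring_1 mpoly)"
  shows lead_expo_in: "lead_expo lt f \<in> Poly_Mapping.keys f"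
    and lead_expo_greatest:
      "\<And>b. b \<in> Poly_Mapping.keys f \<Longrightarrow> b \<noteq> lead_expo lt f \<Longrightarrow> lt b (lead_expo lt f)"
proof -
  have "Poly_Mapping.keys f \<noteq> {}" "Poly_Mapping.keys f \<subseteq> expos s"
    using assms by (simp_all add: carrier_poly_ring)
  then obtain a where a: "a \<in> Poly_Mapping.keys f" "\<forall>b\<in>Poly_Mapping.keys f. b \<noteq> a \<longrightarrow> lt b a"
    using finite_max[of "Poly_Mapping.keys f"] by auto
  then have "lead_expo lt f = a" using assms by (intro lead_expo_eqI) auto
  then show "lead_expo lt f \<in> Poly_Mapping.keys f"
    "\<And>b. b \<in> Poly_Mapping.keys f \<Longrightarrow> b \<noteq> lead_expo lt f \<Longrightarrow> lt b (lead_expo lt f)"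
    using a by auto
qed

lemma lead_expo_expos:
  "f \<in> carrier (poly_ring s) \<Longrightarrow> f \<noteq> (0 :: 'k::comm_ring_1 mpoly) \<Longrightarrow> lead_expo lt f \<in> expos s"
  using lead_expo_in carrier_poly_ring by blast

text \<open>
  One reduction step: equal leading monomials cancel. It drives both the division algorithm and the
  passage to distinct leading monomials in a two-dimensional space of forms.
\<close>

lemma division_step:
  fixes f g :: "'k::field mpoly"
  assumes f: "f \<in> homog_part s e" "f \<noteq> 0" and g: "g \<in> homog_part s e" "g \<noteq> 0"
    and eq: "lead_expo lt g = lead_expo lt f"
  obtains c where "\<And>k. k \<in> Poly_Mapping.keys (f - const_poly c * g) \<Longrightarrow> lt k (lead_expo lt f)"
proof -
  let ?m = "lead_expo lt f"
  define c where "c = Poly_Mapping.lookup f ?m / Poly_Mapping.lookup g ?m"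
  have gm: "Poly_Mapping.lookup g ?m \<noteq> 0" 
    using lead_expo_in[OF homog_carrier[OF g(1)] g(2)] eq by (simp add: in_keys_iff)
  have "lt k ?m" if k: "k \<in> Poly_Mapping.keys (f - const_poly c * g)" for k
  proof -
    have "k \<noteq> ?m" using k gm by (auto simp: in_keys_iff lookup_minus c_def)
    moreover have "k \<in> Poly_Mapping.keys f \<or> k \<in> Poly_Mapping.keys g"
      using k by (auto simp: in_keys_iff lookup_minus)
    ultimately show ?thesis
      using lead_expo_greatest[OF homog_carrier[OF f(1)] f(2)]
        lead_expo_greatest[OF homog_carrier[OF g(1)] g(2)] eq by auto
  qed
  then show ?thesis using that by blast
qed

lemma lead_expo_single_mult:
  fixes g :: "'k::field mpoly"
  assumes g: "g \<in> carrier (poly_ring s)" "g \<noteq> 0" and c: "c \<in> expos s" "u \<noteq> 0"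
  shows "lead_expo lt (Poly_Mapping.single c u * g) = c + lead_expo lt g"
    "Poly_Mapping.single c u * g \<noteq> 0"
proof -
  let ?h = "Poly_Mapping.single c u * g"
  have in_h: "c + lead_expo lt g \<in> Poly_Mapping.keys ?h"
    using lead_expo_in[OF g] c by (simp add: in_keys_iff lookup_single_mult_add)
  then show "?h \<noteq> 0" by auto
  have sub: "Poly_Mapping.keys ?h \<subseteq> (\<lambda>a. c + a) ` Poly_Mapping.keys g"
    by (rule keys_single_mult)
  have gk: "Poly_Mapping.keys g \<subseteq> expos s" using g by (simp add: carrier_poly_ring)
  show "lead_expo lt ?h = c + lead_expo lt g"
  proof (rule lead_expo_eqI)
    show "?h \<in> carrier (poly_ring s)"
      using sub gk c expos_add by (fastforce simp: carrier_poly_ring)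
    fix b assume "b \<in> Poly_Mapping.keys ?h" "b \<noteq> c + lead_expo lt g"
    then obtain a where a: "a \<in> Poly_Mapping.keys g" "b = c + a" "a \<noteq> lead_expo lt g"
      using sub by auto
    then show "lt b (c + lead_expo lt g)"
      using lt_add[of a "lead_expo lt g" c] lead_expo_greatest[OF g a(1,3)] gk c
        lead_expo_expos[OF g] by (auto simp: add.commute)
  qed (rule in_h)
qed

text \<open>
  Division within a fixed degree \<open>e\<close>. Only finitely many monomials have this degree, and the number of
  those that are at most the leading one drops in each step. Equality of values at the common zeros
  of \<open>G\<close> stands in for congruence modulo the ideal generated by \<open>G\<close>.
\<close>

lemma division:
  fixes f :: "'k::field mpoly"
  assumes G: "\<And>g. g \<in> G \<Longrightarrow> g \<noteq> 0 \<and> (\<exists>e'. g \<in> homog_part s e')"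
    and f: "f \<in> homog_part s e"
  shows "\<exists>r\<in>homog_part s e. (\<forall>m\<in>Poly_Mapping.keys r. \<forall>g\<in>G. \<not> expo_le (lead_expo lt g) m) \<and>
    (\<forall>x. (\<forall>g\<in>G. poly_eval g x = 0) \<longrightarrow> poly_eval f x = poly_eval r x)"
  using f
proof (induction "card {m \<in> deg_expos s e. \<exists>k\<in>Poly_Mapping.keys f. m = k \<or> lt m k}"
    arbitrary: f rule: less_induct)
  case (less f)
  let ?D = "\<lambda>f :: 'k mpoly. {m \<in> deg_expos s e. \<exists>k\<in>Poly_Mapping.keys f. m = k \<or> lt m k}"
  let ?m = "lead_expo lt f"
  show ?case
  proof (cases "f = 0")
    case True
    then show ?thesis by (intro bexI[of _ 0]) auto
  next
    case False
    have fc: "f \<in> carrier (poly_ring s)" using less.prems by (rule homog_carrier)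
    have m: "?m \<in> Poly_Mapping.keys f" by (rule lead_expo_in[OF fc False])
    have mT: "?m \<in> deg_expos s e" using m less.prems by (auto simp: homog_part_deg)
    \<comment> \<open>every exponent below a key of \<open>h\<close> is below \<open>?m\<close>, and \<open>?m\<close> itself is lost\<close>
    have smaller: "card (?D h) < card (?D f)"
      if h: "h \<in> homog_part s e" "\<And>k. k \<in> Poly_Mapping.keys h \<Longrightarrow> lt k ?m" for h
    proof (rule psubset_card_mono)
      have E: "deg_expos s e \<subseteq> expos s" "Poly_Mapping.keys h \<subseteq> expos s"
        using h(1) by (auto simp: deg_expos_def homog_part_iff)
      have mE: "?m \<in> expos s" using E mT by blast
      have below: "lt a ?m" if a: "a \<in> ?D h" for a
      proof -
        from a obtain k where k: "k \<in> Poly_Mapping.keys h" "a = k \<or> lt a k" "a \<in> expos s"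
          using E by blast
        show ?thesis using k(2) h(2)[OF k(1)] lt_trans[of a k ?m] k E mE by auto
      qed
      show "?D h \<subset> ?D f"
      proof
        show "?D h \<subseteq> ?D f" using below m by auto
        have "?m \<in> ?D f" using m mT by auto
        moreover have "?m \<notin> ?D h" using below[of ?m] lt_irrefl[OF mE] by auto
        ultimately show "?D h \<noteq> ?D f" by metis
      qed
    qed simp
    show ?thesis
    proof (cases "\<exists>g\<in>G. expo_le (lead_expo lt g) ?m")
      case True
      then obtain g where g: "g \<in> G" "expo_le (lead_expo lt g) ?m" by blast
      then obtain e' where g0: "g \<noteq> 0" "g \<in> homog_part s e'" using G by blast
      define c where "c = ?m - lead_expo lt g"
      have c: "c + lead_expo lt g = ?m" "c \<in> expos s"
        using expo_le_add_diff[OF g(2)] mT by (auto simp: c_def add.commute deg_expos_def expos_diff)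
      let ?h = "Poly_Mapping.single c 1 * g"
      note gl = lead_expo_single_mult[OF homog_carrier[OF g0(2)] g0(1) c(2) one_neq_zero]
      have deg: "expo_deg c + e' = e"
      proof -
        have "expo_deg (lead_expo lt g) = e'"
          using lead_expo_in[OF homog_carrier[OF g0(2)] g0(1)] g0(2) by (auto simp: homog_part_iff)
        moreover have "expo_deg ?m = e" using mT by (simp add: deg_expos_def)
        ultimately show ?thesis using c(1) expo_deg_add[of c "lead_expo lt g"] by simp
      qed
      have hh: "?h \<in> homog_part s e"
        using homog_mult[OF homog_single[OF c(2) refl] g0(2)] deg by simp
      have eq: "lead_expo lt ?h = ?m" using gl(1) c(1) by simp
      obtain u where u: "\<And>k. k \<in> Poly_Mapping.keys (f - const_poly u * ?h) \<Longrightarrow> lt k ?m"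
        using division_step[OF less.prems False hh gl(2) eq] by metis
      have f': "f - const_poly u * ?h \<in> homog_part s e"
        by (intro homog_diff less.prems homog_const_mult hh)
      have "card (?D (f - const_poly u * ?h)) < card (?D f)" by (rule smaller[OF f']) (rule u)
      from less.hyps[OF this f'] obtain r where r: "r \<in> homog_part s e"
        "\<forall>m\<in>Poly_Mapping.keys r. \<forall>g\<in>G. \<not> expo_le (lead_expo lt g) m"
        "\<forall>x. (\<forall>g\<in>G. poly_eval g x = 0) \<longrightarrow> poly_eval (f - const_poly u * ?h) x = poly_eval r x"
        by (elim bexE conjE) (rule that)
      have "poly_eval f x = poly_eval r x" if "\<forall>g\<in>G. poly_eval g x = 0" for x
        using r(3)[rule_format, of x] that g(1) by (simp add: poly_eval_diff poly_eval_mult)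
      then show ?thesis using r(2) by (intro bexI[OF _ r(1)]) simp
    next
      case nd: False
      let ?h = "Poly_Mapping.single ?m (Poly_Mapping.lookup f ?m)"
      have hh: "?h \<in> homog_part s e" using mT by (intro homog_single) (auto simp: deg_expos_def)
      have f': "f - ?h \<in> homog_part s e" by (intro homog_diff less.prems hh)
      have u: "lt k ?m" if "k \<in> Poly_Mapping.keys (f - ?h)" for k
        using that lead_expo_greatest[OF fc False, of k]
        by (cases "k = ?m") (auto simp: in_keys_iff lookup_minus lookup_single)
      have "card (?D (f - ?h)) < card (?D f)" by (rule smaller[OF f']) (rule u)
      from less.hyps[OF this f'] obtain r where r: "r \<in> homog_part s e"
        "\<forall>m\<in>Poly_Mapping.keys r. \<forall>g\<in>G. \<not> expo_le (lead_expo lt g) m"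
        "\<forall>x. (\<forall>g\<in>G. poly_eval g x = 0) \<longrightarrow> poly_eval (f - ?h) x = poly_eval r x"
        by (elim bexE conjE) (rule that)
      have "\<forall>m\<in>Poly_Mapping.keys (r + ?h). \<forall>g\<in>G. \<not> expo_le (lead_expo lt g) m"
        using r(2) nd Poly_Mapping.keys_add[of r ?h] by (auto split: if_splits)
      moreover have "poly_eval f x = poly_eval (r + ?h) x" if "\<forall>g\<in>G. poly_eval g x = 0" for x
        using r(3)[rule_format, of x] that by (simp add: poly_eval_diff poly_eval_add diff_eq_eq)
      ultimately show ?thesis by (intro bexI[OF _ homog_add[OF r(1) hh]]) simp
    qed
  qed
qed

text \<open>
  The monomials that survive division by \<open>G\<close> span all functions on \<open>Z\<close>. Over a finite field the
  comparison of dimensions is a comparison of cardinalities: \<open>|K|\<^bsup>|Z|\<^esup>\<close> functions arise from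
  \<open>|K|\<^bsup>|B|\<^esup>\<close> coefficient vectors.
\<close>

lemma footprint_bound:
  fixes Z :: "(nat \<Rightarrow> 'k::{field,finite}) set"
  assumes G: "\<And>g. g \<in> G \<Longrightarrow> g \<noteq> 0 \<and> (\<exists>e'. g \<in> homog_part s e')"
    and Z: "finite Z" "\<And>g x. g \<in> G \<Longrightarrow> x \<in> Z \<Longrightarrow> poly_eval g x = 0"
    and interpol: "\<And>v. \<exists>f\<in>homog_part s e. \<forall>x\<in>Z. poly_eval f x = v x"
  shows "card Z \<le> card {m \<in> deg_expos s e. \<forall>g\<in>G. \<not> expo_le (lead_expo lt g) m}"
proof -
  define B where "B = {m \<in> deg_expos s e. \<forall>g\<in>G. \<not> expo_le (lead_expo lt g) m}"
  have finB: "finite B" by (simp add: B_def)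
  let ?c = "\<lambda>c. restrict (\<lambda>x. \<Sum>m\<in>B. c m * mon_val x m) Z"
  have "(\<Pi>\<^sub>E x\<in>Z. (UNIV :: 'k set)) \<subseteq> ?c ` (\<Pi>\<^sub>E m\<in>B. UNIV)"
  proof
    fix v assume v: "v \<in> (\<Pi>\<^sub>E x\<in>Z. (UNIV :: 'k set))"
    obtain f where f: "f \<in> homog_part s e" "\<forall>x\<in>Z. poly_eval f x = v x" using interpol by blast
    obtain r where r: "r \<in> homog_part s e"
        "\<forall>m\<in>Poly_Mapping.keys r. \<forall>g\<in>G. \<not> expo_le (lead_expo lt g) m"
        "\<forall>x. (\<forall>g\<in>G. poly_eval g x = 0) \<longrightarrow> poly_eval f x = poly_eval r x"
      using division[where G = G, OF G f(1)] by blast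
    have sub: "Poly_Mapping.keys r \<subseteq> B" using r by (auto simp: B_def homog_part_deg)
    have "v x = (\<Sum>m\<in>B. Poly_Mapping.lookup r m * mon_val x m)" if "x \<in> Z" for x
    proof -
      have "v x = poly_eval r x" using f(2) that r(3)[rule_format, OF Z(2)[OF _ that]] by simp
      also have "\<dots> = (\<Sum>m\<in>B. Poly_Mapping.lookup r m * mon_val x m)"
        unfolding poly_eval_def mon_val_def[symmetric]
        by (rule sum.mono_neutral_left) (use sub finB in \<open>auto simp: in_keys_iff\<close>)
      finally show ?thesis .
    qed
    then have "v = ?c (restrict (Poly_Mapping.lookup r) B)"
      using v by (auto simp: fun_eq_iff PiE_def extensional_def)
    then show "v \<in> ?c ` (\<Pi>\<^sub>E m\<in>B. UNIV)"
      by (intro image_eqI[of _ _ "restrict (Poly_Mapping.lookup r) B"]) simp_all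
  qed
  then have "card (\<Pi>\<^sub>E x\<in>Z. (UNIV :: 'k set)) \<le> card (\<Pi>\<^sub>E m\<in>B. (UNIV :: 'k set))"
    by (rule surj_card_le[rotated]) (use finB in \<open>auto intro!: finite_PiE\<close>)
  then have "card (UNIV :: 'k set) ^ card Z \<le> card (UNIV :: 'k set) ^ card B"
    using Z(1) finB by (simp add: card_PiE)
  moreover have "1 < card (UNIV :: 'k set)"
  proof -
    have "card {0, 1 :: 'k} \<le> card (UNIV :: 'k set)" by (rule card_mono) auto
    then show ?thesis by simp
  qed
  ultimately show ?thesis by (simp add: B_def)
qed

end

section \<open>Boxes and Cartesian point sets\<close>

definition expo_of :: "nat \<Rightarrow> (nat \<Rightarrow> nat) \<Rightarrow> expo" where
  "expo_of s f = (\<Sum>i=1..s. Poly_Mapping.single i (f i))"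

lemma lookup_expo_of: "Poly_Mapping.lookup (expo_of s f) i = (if i \<in> {1..s} then f i else 0)"
  by (auto simp: expo_of_def lookup_sum lookup_single when_def)

lemma expo_of_expos [simp]: "expo_of s f \<in> expos s"
  by (auto simp: expos_def in_keys_iff lookup_expo_of split: if_splits)

lemma expo_deg_expo_of: "expo_deg (expo_of s f) = (\<Sum>i=1..s. f i)"
  unfolding expo_deg_expos[OF expo_of_expos]
  by (rule sum.cong) (auto simp: lookup_expo_of)

definition box :: "nat \<Rightarrow> (nat \<Rightarrow> nat) \<Rightarrow> (nat \<Rightarrow> nat) set" where
  "box n \<delta> = (\<Pi>\<^sub>E i\<in>{1..n}. {..<\<delta> i})"

text \<open>
  The argument \<open>a\<close> may be any function on the naturals; only its values on \<open>{1..n}\<close> matter, so that an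
  exponent in \<open>n + 1\<close> variables can be used directly.
\<close>

definition upper_box :: "nat \<Rightarrow> (nat \<Rightarrow> nat) \<Rightarrow> (nat \<Rightarrow> nat) \<Rightarrow> (nat \<Rightarrow> nat) set" where
  "upper_box n \<delta> a = {c \<in> box n \<delta>. \<forall>i\<in>{1..n}. a i \<le> c i}"

lemma finite_box [simp]: "finite (box n \<delta>)"
  unfolding box_def by (intro finite_PiE) auto

lemma upper_box_subset: "upper_box n \<delta> a \<subseteq> box n \<delta>" by (auto simp: upper_box_def)

lemma finite_upper_box [simp]: "finite (upper_box n \<delta> a)"
  by (rule finite_subset[OF upper_box_subset]) simp

lemma card_box: "card (box n \<delta>) = (\<Prod>i=1..n. \<delta> i)"
  by (simp add: box_def card_PiE)

lemma upper_box_PiE: "upper_box n \<delta> a = (\<Pi>\<^sub>E i\<in>{1..n}. {a i..<\<delta> i})"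
proof -
  have "c \<in> upper_box n \<delta> a \<longleftrightarrow> c \<in> (\<Pi>\<^sub>E i\<in>{1..n}. {a i..<\<delta> i})" for c
    unfolding upper_box_def box_def PiE_iff mem_Collect_eq atLeastLessThan_iff lessThan_iff by blast
  then show ?thesis by blast
qed

lemma card_upper_box: "card (upper_box n \<delta> a) = (\<Prod>i=1..n. \<delta> i - a i)"
  by (simp add: upper_box_PiE card_PiE)

lemma card_upper_box_Un:
  assumes "\<And>i. i \<in> {1..n} \<Longrightarrow> a i \<le> \<delta> i" "\<And>i. i \<in> {1..n} \<Longrightarrow> b i \<le> \<delta> i"
  shows "int (card (upper_box n \<delta> a \<union> upper_box n \<delta> b)) = P_val n \<delta> a b"
proof -
  have int: "upper_box n \<delta> a \<inter> upper_box n \<delta> b = upper_box n \<delta> (\<lambda>i. max (a i) (b i))"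
    by (auto simp: upper_box_def)
  have "card (upper_box n \<delta> a) + card (upper_box n \<delta> b) =
      card (upper_box n \<delta> a \<union> upper_box n \<delta> b) + card (upper_box n \<delta> a \<inter> upper_box n \<delta> b)"
    by (rule card_Un_Int) auto
  then have "int (card (upper_box n \<delta> a \<union> upper_box n \<delta> b)) =
      int (\<Prod>i=1..n. \<delta> i - a i) + int (\<Prod>i=1..n. \<delta> i - b i) - int (\<Prod>i=1..n. \<delta> i - max (a i) (b i))"
    unfolding int card_upper_box by linarith
  also have "int (\<Prod>i=1..n. \<delta> i - a i) = (\<Prod>i=1..n. int (\<delta> i) - int (a i))"
    unfolding of_nat_prod by (rule prod.cong) (use assms in \<open>auto simp: of_nat_diff\<close>)
  also have "int (\<Prod>i=1..n. \<delta> i - b i) = (\<Prod>i=1..n. int (\<delta> i) - int (b i))"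
    unfolding of_nat_prod by (rule prod.cong) (use assms in \<open>auto simp: of_nat_diff\<close>)
  also have "int (\<Prod>i=1..n. \<delta> i - max (a i) (b i)) =
      (\<Prod>i=1..n. min (int (\<delta> i) - int (a i)) (int (\<delta> i) - int (b i)))"
    unfolding of_nat_prod
  proof (rule prod.cong)
    fix i assume "i \<in> {1..n}"
    from assms(1)[OF this] assms(2)[OF this]
    show "int (\<delta> i - max (a i) (b i)) = min (int (\<delta> i) - int (a i)) (int (\<delta> i) - int (b i))"
      by linarith
  qed simp
  finally show ?thesis by (simp add: P_val_def)
qed

text \<open>
  In degrees \<open>e \<ge> \<Sum>\<^sub>i \<delta>\<^sub>i\<close> dropping the last exponent is a bijection from the monomials of degree \<open>e\<close> with
  exponents below \<open>\<delta>\<close> onto the box: the last exponent fills up the degree.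
\<close>

lemma card_grid_expos:
  assumes "(\<Sum>i=1..n. \<delta> i) \<le> e"
  shows "card {m \<in> deg_expos (n + 1) e. restrict (Poly_Mapping.lookup m) {1..n} \<in> C \<inter> box n \<delta>}
    = card (C \<inter> box n \<delta>)"
proof (rule bij_betw_same_card)
  let ?r = "\<lambda>m :: expo. restrict (Poly_Mapping.lookup m) {1..n}"
  let ?M = "{m \<in> deg_expos (n + 1) e. ?r m \<in> C \<inter> box n \<delta>}"
  let ?g = "\<lambda>c. expo_of (n + 1) (c(n + 1 := e - (\<Sum>i=1..n. c i)))"
  have r: "?r m i = Poly_Mapping.lookup m i" if "i \<in> {1..n}" for m i using that by simp
  show "bij_betw ?r ?M (C \<inter> box n \<delta>)"
  proof (rule bij_betwI[where g = ?g])
    show "?r \<in> ?M \<rightarrow> C \<inter> box n \<delta>" by auto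
    have gr: "?r (?g c) = c" if "c \<in> box n \<delta>" for c
      using that by (auto simp: fun_eq_iff lookup_expo_of box_def PiE_iff extensional_def)
    have "?g c \<in> deg_expos (n + 1) e" if "c \<in> box n \<delta>" for c
    proof -
      have "(\<Sum>i=1..n. c i) \<le> (\<Sum>i=1..n. \<delta> i)"
        by (rule sum_mono) (use that in \<open>force simp: box_def PiE_iff intro: less_imp_le\<close>)
      moreover have "(\<Sum>i=1..n. (c(n + 1 := e - (\<Sum>i=1..n. c i))) i) = (\<Sum>i=1..n. c i)"
        by (rule sum.cong) auto
      ultimately show ?thesis
        using assms by (simp add: deg_expos_def expo_deg_expo_of del: fun_upd_apply) simp
    qed
    then show "?g \<in> C \<inter> box n \<delta> \<rightarrow> ?M" using gr by auto
    show "?r (?g c) = c" if "c \<in> C \<inter> box n \<delta>" for c using gr that by auto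
    show "?g (?r m) = m" if m: "m \<in> ?M" for m
    proof (rule expo_eqI[of _ "n + 1"])
      show "m \<in> expos (n + 1)" using m by (auto simp: deg_expos_def)
      then have "e = (\<Sum>i=1..n. Poly_Mapping.lookup m i) + Poly_Mapping.lookup m (n + 1)"
        using m by (auto simp: deg_expos_def expo_deg_expos)
      then show "Poly_Mapping.lookup (?g (?r m)) i = Poly_Mapping.lookup m i" if "i \<in> {1..n + 1}" for i
        using that by (auto simp: lookup_expo_of)
    qed simp
  qed
qed

text \<open>
  If the degree is large enough, the last exponent of \<open>m\<close> is at least \<open>d\<close> and divisibility is decided by the
  first \<open>n\<close> coordinates.
\<close>

lemma grid_expo_divides:
  assumes m: "m \<in> deg_expos (n + 1) e" "restrict (Poly_Mapping.lookup m) {1..n} \<in> box n \<delta>"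
    and a: "a \<in> expos (n + 1)" "expo_deg a \<le> d" and e: "(\<Sum>i=1..n. \<delta> i) + d \<le> e"
  shows "expo_le a m \<longleftrightarrow> (\<forall>i\<in>{1..n}. Poly_Mapping.lookup a i \<le> Poly_Mapping.lookup m i)"
proof
  assume *: "\<forall>i\<in>{1..n}. Poly_Mapping.lookup a i \<le> Poly_Mapping.lookup m i"
  have "(\<Sum>i=1..n. Poly_Mapping.lookup m i) \<le> (\<Sum>i=1..n. \<delta> i)"
    by (rule sum_mono) (use m(2) in \<open>force simp: box_def PiE_iff intro: less_imp_le\<close>)
  moreover have "(\<Sum>i=1..n. Poly_Mapping.lookup m i) + Poly_Mapping.lookup m (n + 1) = e"
    using m(1) by (auto simp: deg_expos_def expo_deg_expos)
  moreover have "Poly_Mapping.lookup a (n + 1) \<le> d"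
    using a by (simp add: expo_deg_expos)
  ultimately have "Poly_Mapping.lookup a (n + 1) \<le> Poly_Mapping.lookup m (n + 1)" using e by linarith
  then show "expo_le a m"
    unfolding expo_le_def
    using * lookup_outside[OF a(1)] by (metis atLeastAtMost_iff le_Suc_eq Suc_eq_plus1 le0)
qed (simp add: expo_le_def)

text \<open>
  The representatives of the points with last entry \<open>1\<close>, so that \<open>t\<^sub>s\<close> can be used to adjust degrees
  without changing values.
\<close>

definition grid_points :: "nat \<Rightarrow> (nat \<Rightarrow> 'k::field set) \<Rightarrow> (nat \<Rightarrow> 'k) set" where
  "grid_points n A = (\<Pi>\<^sub>E i\<in>{1..n + 1}. if i \<le> n then A i else {1})"

definition lin_form :: "nat \<Rightarrow> nat \<Rightarrow> 'k \<Rightarrow> ('k::field) mpoly" where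
  "lin_form n i c = Poly_Mapping.single (var_expo i) 1 - Poly_Mapping.single (var_expo (n + 1)) c"

lemma grid_points_last: "x \<in> grid_points n A \<Longrightarrow> x (n + 1) = 1"
  unfolding grid_points_def by (drule PiE_mem[of _ _ _ "n + 1"]) auto

lemma grid_points_mem: "x \<in> grid_points n A \<Longrightarrow> i \<in> {1..n} \<Longrightarrow> x i \<in> A i"
  unfolding grid_points_def by (drule PiE_mem[of _ _ _ i]) auto

lemma finite_grid_points [simp]: "finite (grid_points n (A :: nat \<Rightarrow> 'k::{field,finite} set))"
  unfolding grid_points_def by (intro finite_PiE) auto

lemma card_grid_points:
  "card (grid_points n (A :: nat \<Rightarrow> 'k::{field,finite} set)) = (\<Prod>i=1..n. card (A i))"
proof -
  have "(\<Prod>i=1..n. card (if i \<le> n then A i else {1})) = (\<Prod>i=1..n. card (A i))"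
    by (rule prod.cong) auto
  then show ?thesis by (simp add: grid_points_def card_PiE)
qed

lemma grid_points_eqI:
  assumes "x \<in> grid_points n A" "y \<in> grid_points n A" "\<And>i. i \<in> {1..n} \<Longrightarrow> x i = y i"
  shows "x = y"
proof (rule PiE_ext[OF assms(1,2)[unfolded grid_points_def]])
  fix i assume "i \<in> {1..n + 1}"
  then show "x i = y i"
    using assms(3)[of i] grid_points_last[OF assms(1)] grid_points_last[OF assms(2)]
    by (cases "i = n + 1") auto
qed

lemma var_expo_expos [simp]: "i \<in> {1..s} \<Longrightarrow> var_expo i \<in> expos s"
  by (auto simp: var_expo_def expos_def)

lemma lin_form_homog: "i \<in> {1..n + 1} \<Longrightarrow> lin_form n i c \<in> homog_part (n + 1) 1"
  unfolding lin_form_def by (intro homog_diff homog_single) (auto simp: var_expo_def expos_def)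

lemma poly_eval_lin_form [simp]: "poly_eval (lin_form n i c) x = x i - c * x (n + 1)"
  by (simp add: lin_form_def poly_eval_diff var_expo_def)

definition grid_form :: "nat \<Rightarrow> nat \<Rightarrow> 'k set \<Rightarrow> ('k::field) mpoly" where
  "grid_form n i B = (\<Prod>c\<in>B. lin_form n i c)"

lemma grid_form_homog: "i \<in> {1..n + 1} \<Longrightarrow> grid_form n i B \<in> homog_part (n + 1) (card B)"
proof -
  assume i: "i \<in> {1..n + 1}"
  have "(\<Prod>c\<in>B. lin_form n i c) \<in> homog_part (n + 1) (\<Sum>c\<in>B. 1)"
    by (rule homog_prod) (rule lin_form_homog[OF i])
  then show ?thesis by (simp add: grid_form_def)
qed

lemma poly_eval_grid_form:
  "poly_eval (grid_form n i B) x = (\<Prod>c\<in>B. x i - c * x (n + 1))"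
  by (simp add: grid_form_def poly_eval_prod)

text \<open>
  Lagrange interpolation: a product of linear forms singles out a point, and a power of the last
  variable raises it to the prescribed degree.
\<close>

lemma interpolation:
  fixes A :: "nat \<Rightarrow> 'k::{field,finite} set"
  assumes e: "(\<Sum>i=1..n. card (A i)) \<le> e"
  shows "\<exists>f\<in>homog_part (n + 1) e. \<forall>x\<in>grid_points n A. poly_eval f x = v x"
proof -
  define k where "k p = (\<Sum>i=1..n. card (A i - {p i}))" for p :: "nat \<Rightarrow> 'k"
  define L where "L p = (\<Prod>i=1..n. grid_form n i (A i - {p i})) *
      Poly_Mapping.single (Poly_Mapping.single (n + 1) (e - k p)) 1" for p
  have k: "k p \<le> e" for p
  proof -
    have "k p \<le> (\<Sum>i=1..n. card (A i))"
      unfolding k_def by (intro sum_mono card_mono) auto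
    then show ?thesis using e by simp
  qed
  have L: "L p \<in> homog_part (n + 1) e" for p
  proof -
    have "(\<Prod>i=1..n. grid_form n i (A i - {p i})) \<in> homog_part (n + 1) (k p)"
      unfolding k_def
    proof (rule homog_prod)
      fix i assume "i \<in> {1..n}"
      then have "i \<in> {1..n + 1}" by auto
      then show "grid_form n i (A i - {p i}) \<in> homog_part (n + 1) (card (A i - {p i}))"
        by (rule grid_form_homog)
    qed
    moreover have "Poly_Mapping.single (Poly_Mapping.single (n + 1) (e - k p)) 1 \<in>
        homog_part (n + 1) (e - k p)"
      by (rule homog_single) (auto simp: expos_def)
    ultimately have "L p \<in> homog_part (n + 1) (k p + (e - k p))"
      unfolding L_def by (rule homog_mult)
    then show ?thesis using k[of p] by simp
  qed
  have eval: "poly_eval (L p) x = (\<Prod>i=1..n. \<Prod>c\<in>A i - {p i}. x i - c)"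
    if "x \<in> grid_points n A" for x p
    using grid_points_last[OF that]
    by (simp add: L_def poly_eval_mult poly_eval_prod poly_eval_grid_form)
  have self: "poly_eval (L p) p \<noteq> 0" if "p \<in> grid_points n A" for p
    using eval[OF that, of p] by auto
  have other: "poly_eval (L p) x = 0" if x: "x \<in> grid_points n A" "p \<in> grid_points n A" "x \<noteq> p" for x p
  proof -
    obtain i where i: "i \<in> {1..n}" "x i \<noteq> p i" using grid_points_eqI[OF x(1,2)] x(3) by blast
    then have "(\<Prod>c\<in>A i - {p i}. x i - c) = 0"
      using grid_points_mem[OF x(1) i(1)] by (intro prod_zero) auto
    then show ?thesis using i unfolding eval[OF x(1)] by (intro prod_zero) auto
  qed
  let ?f = "\<Sum>p\<in>grid_points n A. const_poly (v p / poly_eval (L p) p) * L p"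
  have "poly_eval ?f x = v x" if x: "x \<in> grid_points n A" for x
  proof -
    have "poly_eval ?f x = (\<Sum>p\<in>grid_points n A. if p = x then v x else 0)"
      unfolding poly_eval_sum poly_eval_mult
      by (rule sum.cong) (use x self other in auto)
    then show ?thesis using x by simp
  qed
  moreover have "?f \<in> homog_part (n + 1) e"
    by (intro homog_sum homog_const_mult L)
  ultimately show ?thesis by blast
qed

text \<open>
  Since the last variable is the smallest one, \<open>t\<^sub>i\<^bsup>|B|\<^esup>\<close> is the leading monomial of \<open>\<Prod>\<^bsub>c\<in>B\<^esub> (t\<^sub>i - c t\<^sub>s)\<close>.
\<close>

locale cartesian = mono_order "n + 1" lt for n lt +
  fixes A :: "nat \<Rightarrow> 'k::{field,finite} set" and \<delta> :: "nat \<Rightarrow> nat"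
  assumes last_least: "\<And>i. i \<in> {1..n} \<Longrightarrow> lt (var_expo (n + 1)) (var_expo i)"
    and card_A: "\<And>i. i \<in> {1..n} \<Longrightarrow> card (A i) = \<delta> i"
    and two_le: "\<And>i. i \<in> {1..n} \<Longrightarrow> 2 \<le> \<delta> i"
    and n_pos: "1 \<le> n"
begin

lemma lead_grid_form:
  assumes i: "i \<in> {1..n}"
  shows "lead_expo lt (grid_form n i B :: 'k mpoly) = Poly_Mapping.single i (card B)"
    and "grid_form n i B \<noteq> (0 :: 'k mpoly)"
proof -
  let ?v = "var_expo i" and ?w = "var_expo (n + 1)"
  have vw: "?v \<in> expos (n + 1)" "?w \<in> expos (n + 1)" using i by auto
  have fin: "finite B" by simp
  define m where "m = (\<lambda>B :: 'k set. Poly_Mapping.single i (card B))"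
  have mE: "m B \<in> expos (n + 1)" for B using i by (auto simp: m_def expos_def)
  have *: "Poly_Mapping.lookup (grid_form n i B) (m B) = 1 \<and>
      (\<forall>k\<in>Poly_Mapping.keys (grid_form n i B). k \<noteq> m B \<longrightarrow> lt k (m B))"
    using fin
  proof (induction B rule: finite_induct)
    case empty
    then show ?case by (simp add: grid_form_def m_def lookup_one)
  next
    case (insert b B)
    let ?F = "grid_form n i B"
    have FE: "Poly_Mapping.keys ?F \<subseteq> expos (n + 1)"
      using homog_carrier[OF grid_form_homog[of i n B]] i by (auto simp: carrier_poly_ring)
    have eq: "grid_form n i (insert b B) =
        Poly_Mapping.single ?v 1 * ?F - Poly_Mapping.single ?w b * ?F"
      using insert by (simp add: grid_form_def lin_form_def left_diff_distrib)
    have mm: "m (insert b B) = ?v + m B"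
      using insert by (simp add: m_def var_expo_def single_add[symmetric])
    have low: "lt k (?v + m B)" if k: "k \<in> Poly_Mapping.keys (Poly_Mapping.single ?w b * ?F)" for k
    proof -
      obtain j where j: "j \<in> Poly_Mapping.keys ?F" "k = ?w + j" using subsetD[OF keys_single_mult k(1)] by (elim imageE)
      have jE: "j \<in> expos (n + 1)" using FE j by auto
      have 1: "lt (?w + j) (?v + j)" using lt_add[OF vw(2,1) jE] last_least[OF i] by simp
      show ?thesis
      proof (cases "j = m B")
        case True
        then show ?thesis using 1 j by simp
      next
        case False
        then have "lt (j + ?v) (m B + ?v)" using insert.IH j lt_add[OF jE mE vw(1)] by auto
        then have 2: "lt (?v + j) (?v + m B)" by (simp add: add.commute)
        show ?thesis
          unfolding j(2) by (rule lt_trans[OF _ _ _ 1 2]) (intro expos_add vw jE mE)+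
      qed
    qed
    have hi: "lt k (?v + m B)" if k: "k \<in> Poly_Mapping.keys (Poly_Mapping.single ?v 1 * ?F)" "k \<noteq> ?v + m B" for k
    proof -
      obtain j where j: "j \<in> Poly_Mapping.keys ?F" "k = ?v + j" using subsetD[OF keys_single_mult k(1)] by (elim imageE)
      have jE: "j \<in> expos (n + 1)" using FE j by auto
      have "j \<noteq> m B" using k j by auto
      then show ?thesis using insert.IH j lt_add[OF jE mE vw(1)] by (auto simp: add.commute)
    qed
    have "?v + m B \<notin> Poly_Mapping.keys (Poly_Mapping.single ?w b * ?F)"
      using low lt_irrefl[of "?v + m B"] expos_add[OF vw(1) mE] by blast
    then have "Poly_Mapping.lookup (Poly_Mapping.single ?w b * ?F) (?v + m B) = 0"
      by (simp add: in_keys_iff)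
    then have "Poly_Mapping.lookup (grid_form n i (insert b B)) (?v + m B) = 1"
      unfolding eq using insert.IH lookup_single_mult_add[of ?v 1 ?F "m B"]
      by (simp add: lookup_minus)
    moreover have "lt k (?v + m B)"
      if k: "k \<in> Poly_Mapping.keys (grid_form n i (insert b B))" "k \<noteq> ?v + m B" for k
      using subsetD[OF keys_diff k(1)[unfolded eq]] low[of k] hi[OF _ k(2)] by blast
    ultimately show ?case unfolding mm by blast
  qed
  show ne: "grid_form n i B \<noteq> (0 :: 'k mpoly)" using * by auto
  show "lead_expo lt (grid_form n i B :: 'k mpoly) = Poly_Mapping.single i (card B)"
    using lead_expo_eqI[of "grid_form n i B" "m B"] * homog_carrier[OF grid_form_homog[of i n B]] i
    by (auto simp: m_def in_keys_iff)
qed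

lemma grid_forms_homog:
  assumes "g \<in> (\<lambda>i. grid_form n i (A i)) ` {1..n}"
  shows "g \<noteq> 0 \<and> (\<exists>e. g \<in> homog_part (n + 1) e)"
proof -
  obtain i where i: "i \<in> {1..n}" "g = grid_form n i (A i)" using assms by auto
  then have "i \<in> {1..n + 1}" by auto
  from lead_grid_form(2)[OF i(1)] grid_form_homog[OF this] show ?thesis unfolding i(2) by blast
qed

lemma grid_forms_vanish:
  assumes "g \<in> (\<lambda>i. grid_form n i (A i)) ` {1..n}" and x: "x \<in> grid_points n A"
  shows "poly_eval g x = 0"
proof -
  obtain i where i: "i \<in> {1..n}" "g = grid_form n i (A i)" using assms by auto
  have "x i \<in> A i" "x (n + 1) = 1"
    using x grid_points_mem[OF _ i(1)] grid_points_last by blast+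
  then show ?thesis unfolding i poly_eval_grid_form by (intro prod_zero) auto
qed

text \<open>
  The footprint bound for the forms of \<open>H\<close> together with the forms that cut out the grid, in a degree
  so large that interpolation works and divisibility is visible in the box. The surviving monomials
  are then the box elements outside the shadows of the leading exponents of \<open>H\<close>.
\<close>

lemma cartesian_footprint_bound:
  assumes H: "\<And>h. h \<in> H \<Longrightarrow> h \<noteq> 0 \<and> h \<in> homog_part (n + 1) d"
    and Z: "Z \<subseteq> grid_points n A" "\<And>h x. h \<in> H \<Longrightarrow> x \<in> Z \<Longrightarrow> poly_eval h x = 0"
  shows "card Z \<le> card (box n \<delta> - (\<Union>h\<in>H. upper_box n \<delta> (Poly_Mapping.lookup (lead_expo lt h))))"
proof -
  \<comment> \<open>\<open>\<Sum>\<^sub>i \<delta>\<^sub>i\<close> suffices for interpolation; the summand \<open>d\<close> makes room for the last exponent of \<open>lead_expo lt h\<close>\<close>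
  let ?e = "(\<Sum>i=1..n. \<delta> i) + d"
  let ?G = "H \<union> (\<lambda>i. grid_form n i (A i)) ` {1..n}"
  let ?C = "- (\<Union>h\<in>H. upper_box n \<delta> (Poly_Mapping.lookup (lead_expo lt h)))"
  have sumA: "(\<Sum>i=1..n. card (A i)) = (\<Sum>i=1..n. \<delta> i)" by (rule sum.cong) (auto simp: card_A)
  have finZ: "finite Z" by (rule finite_subset[OF Z(1)]) simp
  have "card Z \<le> card {m \<in> deg_expos (n + 1) ?e. \<forall>g\<in>?G. \<not> expo_le (lead_expo lt g) m}"
  proof (rule footprint_bound)
    show "g \<noteq> 0 \<and> (\<exists>e'. g \<in> homog_part (n + 1) e')" if "g \<in> ?G" for g
      using that H grid_forms_homog by blast
    show "poly_eval g x = 0" if "g \<in> ?G" "x \<in> Z" for g x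
      using that Z grid_forms_vanish by blast
    show "\<exists>f\<in>homog_part (n + 1) ?e. \<forall>x\<in>Z. poly_eval f x = v x" for v
      using interpolation[of A n ?e v] sumA Z(1) by auto
  qed (rule finZ)
  also have "\<dots> \<le> card {m \<in> deg_expos (n + 1) ?e. restrict (Poly_Mapping.lookup m) {1..n} \<in> ?C \<inter> box n \<delta>}"
  proof (rule card_mono)
    show "{m \<in> deg_expos (n + 1) ?e. \<forall>g\<in>?G. \<not> expo_le (lead_expo lt g) m} \<subseteq>
      {m \<in> deg_expos (n + 1) ?e. restrict (Poly_Mapping.lookup m) {1..n} \<in> ?C \<inter> box n \<delta>}"
    proof safe
      fix m assume m: "m \<in> deg_expos (n + 1) ?e" "\<forall>g\<in>?G. \<not> expo_le (lead_expo lt g) m"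
      have "\<not> \<delta> i \<le> Poly_Mapping.lookup m i" if "i \<in> {1..n}" for i
      proof -
        have "grid_form n i (A i) \<in> ?G" using that by auto
        then have "\<not> expo_le (Poly_Mapping.single i (\<delta> i)) m"
          using m(2) lead_grid_form(1)[OF that] card_A[OF that] by metis
        then show ?thesis by (simp add: single_expo_le)
      qed
      then show box: "restrict (Poly_Mapping.lookup m) {1..n} \<in> box n \<delta>"
        by (auto simp: box_def not_le)
      fix h assume h: "h \<in> H"
        "restrict (Poly_Mapping.lookup m) {1..n} \<in> upper_box n \<delta> (Poly_Mapping.lookup (lead_expo lt h))"
      have hh: "h \<noteq> 0" "h \<in> homog_part (n + 1) d" using H h(1) by auto
      have "lead_expo lt h \<in> deg_expos (n + 1) d"
        using lead_expo_in[OF homog_carrier[OF hh(2)] hh(1)] hh(2) by (auto simp: homog_part_deg)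
      then have "expo_le (lead_expo lt h) m"
        using grid_expo_divides[OF m(1) box, of "lead_expo lt h" d] h(2)
        by (auto simp: deg_expos_def upper_box_def)
      then show False using m(2) h(1) by blast
    qed
  qed simp
  also have "\<dots> = card (?C \<inter> box n \<delta>)" by (rule card_grid_expos) simp
  finally show ?thesis by (simp add: Diff_eq Int_commute)
qed

lemma card_grid: "card (grid_points n A) = card (box n \<delta>)"
  unfolding card_grid_points card_box by (rule prod.cong) (simp_all add: card_A)

text \<open>
  If the leading exponent of \<open>f\<close> lay in the box, its shadow would be nonempty and the footprint bound
  would give fewer than \<open>|X|\<close> zeros.
\<close>

lemma vanishing_lead:
  assumes f: "f \<in> homog_part (n + 1) e" "f \<noteq> 0"
    and van: "\<And>x. x \<in> grid_points n A \<Longrightarrow> poly_eval f x = 0"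
  shows "\<exists>i\<in>{1..n}. \<delta> i \<le> Poly_Mapping.lookup (lead_expo lt f) i"
proof (rule ccontr)
  let ?l = "Poly_Mapping.lookup (lead_expo lt f)"
  assume "\<not> ?thesis"
  then have lt: "\<forall>i\<in>{1..n}. ?l i < \<delta> i" by (auto simp: not_le)
  have "card (box n \<delta>) \<le> card (box n \<delta> - upper_box n \<delta> ?l)"
    using cartesian_footprint_bound[of "{f}" e "grid_points n A"] f van card_grid by simp
  moreover have "restrict ?l {1..n} \<in> upper_box n \<delta> ?l"
    using lt by (auto simp: upper_box_def box_def)
  ultimately show False
    using psubset_card_mono[of "box n \<delta>" "box n \<delta> - upper_box n \<delta> ?l"] upper_box_subset[of n \<delta> ?l]
    by (metis Diff_subset Diff_iff finite_box not_le psubsetI subsetD)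
qed

end

section \<open>The second generalized Hamming weight\<close>

definition code_word :: "nat \<Rightarrow> (nat \<Rightarrow> 'k::field) set set \<Rightarrow> 'k mpoly \<Rightarrow> (nat \<Rightarrow> 'k) set \<Rightarrow> 'k" where
  "code_word s X f = (\<lambda>p. if p \<in> X then poly_eval f (std_rep s p) else 0)"

lemma eval_code_image: "eval_code s X d = code_word s X ` homog_part s d"
  by (simp add: eval_code_def code_word_def)

lemma code_word_add: "code_word s X (f + g) = code_word s X f + code_word s X g"
  by (auto simp: code_word_def fun_eq_iff poly_eval_add)

lemma code_word_diff: "code_word s X (f - g) = code_word s X f - code_word s X g"
  by (auto simp: code_word_def fun_eq_iff poly_eval_diff)

lemma code_word_0: "code_word s X 0 = 0"
  by (auto simp: code_word_def fun_eq_iff)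

lemma code_word_scale: "code_word s X (const_poly c * f) = word_scale c (code_word s X f)"
  by (auto simp: code_word_def fun_eq_iff word_scale_def poly_eval_mult)

lemma cartesian_points_image: "cartesian_points n A = proj_class (n + 1) ` grid_points n A"
  by (simp add: cartesian_points_def grid_points_def)

lemma std_rep_proj_class:
  assumes x: "x \<in> grid_points n A"
  shows "std_rep (n + 1) (proj_class (n + 1) x) = x"
proof -
  have x1: "x (n + 1) = 1" by (rule grid_points_last[OF x])
  have r: "restrict x {1..n + 1} = x"
    using x by (auto simp: grid_points_def PiE_def extensional_restrict)
  have mem: "y \<in> proj_class (n + 1) x \<longleftrightarrow> (\<exists>c. c \<noteq> 0 \<and> y = restrict (\<lambda>i. c * x i) {1..n + 1})" for y
    by (auto simp: proj_class_def)
  show ?thesis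
    unfolding std_rep_def
  proof (rule the_equality)
    show "x \<in> proj_class (n + 1) x \<and> x (n + 1) = 1"
      unfolding mem using r x1 by (auto intro!: exI[of _ 1])
    fix y assume y: "y \<in> proj_class (n + 1) x \<and> y (n + 1) = 1"
    then obtain c where c: "y = restrict (\<lambda>i. c * x i) {1..n + 1}" unfolding mem by blast
    then have "y (n + 1) = c * x (n + 1)" by simp
    then have "c = 1" using y x1 by simp
    then show "y = x" using c r by simp
  qed
qed

lemma inj_on_proj_class: "inj_on (proj_class (n + 1)) (grid_points n A)"
  by (rule inj_on_inverseI[of _ "std_rep (n + 1)"]) (rule std_rep_proj_class)

lemma code_word_proj_class:
  "x \<in> grid_points n A \<Longrightarrow>
    code_word (n + 1) (cartesian_points n A) f (proj_class (n + 1) x) = poly_eval f x"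
  by (simp add: code_word_def cartesian_points_image std_rep_proj_class[of x n A, simplified])

lemma code_word_outside: "p \<notin> X \<Longrightarrow> code_word s X f p = 0"
  by (simp add: code_word_def)

lemma subspace_eval_code: "module.subspace word_scale (eval_code s X d)"
proof -
  interpret W: vector_space "word_scale :: 'a \<Rightarrow> ((nat \<Rightarrow> 'a) set \<Rightarrow> 'a) \<Rightarrow> _"
    by (rule vector_space_word_scale)
  show ?thesis
    unfolding eval_code_image
  proof (rule W.subspaceI)
    show "0 \<in> code_word s X ` homog_part s d"
      by (rule image_eqI[of _ _ 0]) (auto simp: code_word_0)
    show "x + y \<in> code_word s X ` homog_part s d"
      if "x \<in> code_word s X ` homog_part s d" "y \<in> code_word s X ` homog_part s d" for x y
      using that by (auto simp flip: code_word_add intro: homog_add)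
    show "word_scale c x \<in> code_word s X ` homog_part s d"
      if "x \<in> code_word s X ` homog_part s d" for c x
      using that by (auto simp flip: code_word_scale intro: homog_const_mult)
  qed
qed

definition (in cartesian) std_expos :: "nat \<Rightarrow> expo set" where
  "std_expos d = {m \<in> deg_expos (n + 1) d. \<forall>i\<in>{1..n}. Poly_Mapping.lookup m i < \<delta> i}"

abbreviation (in cartesian) shadow :: "expo \<Rightarrow> (nat \<Rightarrow> nat) set" where
  "shadow a \<equiv> upper_box n \<delta> (Poly_Mapping.lookup a)"

context cartesian
begin

abbreviation "X \<equiv> cartesian_points n A"
abbreviation "word \<equiv> code_word (n + 1) X"

lemma finite_std_expos [simp]: "finite (std_expos d)"
  by (rule finite_subset[OF _ finite_deg_expos]) (auto simp: std_expos_def)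

lemma finite_X [simp]: "finite X" by (simp add: cartesian_points_image)

lemma card_X: "card X = card (box n \<delta>)"
  unfolding cartesian_points_image card_image[OF inj_on_proj_class] by (rule card_grid)

lemma word_support_subset: "D \<subseteq> eval_code (n + 1) X d \<Longrightarrow> word_support D \<subseteq> X"
  by (auto simp: word_support_def eval_code_image code_word_def split: if_splits)

text \<open>
  Division by the forms that vanish on the grid does not change the codeword.
\<close>

lemma reduced_representative:
  assumes v: "v \<in> eval_code (n + 1) X d"
  shows "\<exists>f\<in>homog_part (n + 1) d. Poly_Mapping.keys f \<subseteq> std_expos d \<and> word f = v"
proof -
  obtain f where f: "f \<in> homog_part (n + 1) d" "v = word f" using v by (auto simp: eval_code_image)
  let ?G = "(\<lambda>i. grid_form n i (A i)) ` {1..n}"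
  have "\<exists>r\<in>homog_part (n + 1) d. (\<forall>m\<in>Poly_Mapping.keys r. \<forall>g\<in>?G. \<not> expo_le (lead_expo lt g) m) \<and>
    (\<forall>x. (\<forall>g\<in>?G. poly_eval g x = 0) \<longrightarrow> poly_eval f x = poly_eval r x)"
    by (rule division[where G = ?G, OF grid_forms_homog f(1)])
  then obtain r where r: "r \<in> homog_part (n + 1) d"
    "\<forall>m\<in>Poly_Mapping.keys r. \<forall>g\<in>?G. \<not> expo_le (lead_expo lt g) m"
    "\<forall>x. (\<forall>g\<in>?G. poly_eval g x = 0) \<longrightarrow> poly_eval f x = poly_eval r x"
    by (elim bexE conjE) (rule that)
  have "Poly_Mapping.keys r \<subseteq> std_expos d"
  proof
    fix m assume m: "m \<in> Poly_Mapping.keys r"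
    have "Poly_Mapping.lookup m i < \<delta> i" if i: "i \<in> {1..n}" for i
    proof -
      have "\<not> expo_le (lead_expo lt (grid_form n i (A i))) m" using r(2) m i by blast
      then show ?thesis
        unfolding lead_grid_form(1)[OF i] single_expo_le card_A[OF i] by simp
    qed
    then show "m \<in> std_expos d" using m r(1) by (auto simp: std_expos_def homog_part_deg)
  qed
  moreover have "word r p = v p" for p
  proof (cases "p \<in> X")
    case True
    then obtain x where x: "x \<in> grid_points n A" "p = proj_class (n + 1) x"
      by (auto simp: cartesian_points_image)
    show ?thesis
      unfolding f(2) x(2) code_word_proj_class[OF x(1)] using r(3) grid_forms_vanish[OF _ x(1)] by metis
  qed (simp add: f code_word_outside)
  ultimately show ?thesis using r(1) by blast
qed

text \<open>
  Two independent words have reduced representatives \<open>f\<close> and \<open>g\<close>. If the leading exponents agree, a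
  multiple of \<open>f\<close> is subtracted from \<open>g\<close>; the difference is nonzero by independence. A point of \<open>X\<close>
  outside the support of \<open>D\<close> is a common zero of both forms, and the footprint bound counts these.
\<close>

lemma weight_lower_bound:
  assumes D: "D \<subseteq> eval_code (n + 1) X d" "module.subspace word_scale D"
    "vector_space.dim word_scale D = 2"
  shows "\<exists>a\<in>std_expos d. \<exists>b\<in>std_expos d. a \<noteq> b \<and> card (shadow a \<union> shadow b) \<le> card (word_support D)"
proof -
  interpret W: vector_space "word_scale :: 'k \<Rightarrow> ((nat \<Rightarrow> 'k) set \<Rightarrow> 'k) \<Rightarrow> _"
    by (rule vector_space_word_scale)
  obtain B where B: "B \<subseteq> D" "W.independent B" "card B = 2"
    using W.basis_exists[of D] D(3) by metis
  obtain v w where vw: "B = {v, w}" "v \<noteq> w" using B(3) by (auto simp: card_2_iff)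
  have ind: "W.independent {v, w}" using B vw by simp
  have v0: "v \<noteq> 0" using ind W.dependent_zero by auto
  have wv: "w \<noteq> word_scale c v" for c
  proof
    assume eq: "w = word_scale c v"
    have "w \<in> W.span {v}" unfolding eq by (intro W.span_scale W.span_base) simp
    moreover have "{v, w} - {w} = {v}" using vw(2) by auto
    ultimately have "W.dependent {v, w}" unfolding W.dependent_def by (intro bexI[of _ w]) auto
    then show False using ind by simp
  qed
  obtain f where f: "f \<in> homog_part (n + 1) d" "Poly_Mapping.keys f \<subseteq> std_expos d" "word f = v"
    using reduced_representative[of v d] D(1) B(1) vw(1) by blast
  obtain g where g: "g \<in> homog_part (n + 1) d" "Poly_Mapping.keys g \<subseteq> std_expos d" "word g = w"
    using reduced_representative[of w d] D(1) B(1) vw(1) by blast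
  have vD: "v \<in> D" "w \<in> D" using B vw by auto
  have f0: "f \<noteq> 0" using f(3) v0 by (auto simp: code_word_0)
  have g0: "g \<noteq> 0" using g(3) wv[of 0] by (auto simp: code_word_0)
  have "\<exists>h\<in>homog_part (n + 1) d. h \<noteq> 0 \<and> Poly_Mapping.keys h \<subseteq> std_expos d \<and> word h \<in> D \<and>
      lead_expo lt h \<noteq> lead_expo lt f"
  proof (cases "lead_expo lt g = lead_expo lt f")
    case False
    then show ?thesis using g vD(2) g0 by blast
  next
    case True
    obtain c where c: "\<And>k. k \<in> Poly_Mapping.keys (g - const_poly c * f) \<Longrightarrow> lt k (lead_expo lt g)"
      using division_step[OF g(1) g0 f(1) f0 True[symmetric]] by metis
    let ?h = "g - const_poly c * f"
    have wh: "word ?h = w - word_scale c v"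
      by (simp only: code_word_diff code_word_scale f(3) g(3))
    have h0: "?h \<noteq> 0"
    proof
      assume "?h = 0"
      then have "w - word_scale c v = 0" using wh code_word_0 by metis
      then show False using wv[of c] by simp
    qed
    have hh: "?h \<in> homog_part (n + 1) d" by (intro homog_diff homog_const_mult f g)
    have "word ?h \<in> D" unfolding wh by (intro W.subspace_diff W.subspace_scale D vD)
    moreover have "Poly_Mapping.keys ?h \<subseteq> std_expos d"
    proof
      fix k assume "k \<in> Poly_Mapping.keys ?h"
      then have "k \<in> Poly_Mapping.keys g \<or> k \<in> Poly_Mapping.keys f"
        by (auto simp: in_keys_iff lookup_minus)
      then show "k \<in> std_expos d" using f g by blast
    qed
    moreover have "lead_expo lt ?h \<noteq> lead_expo lt f"
      using c[OF lead_expo_in[OF homog_carrier[OF hh] h0]] True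
        lt_irrefl[OF lead_expo_expos[OF homog_carrier[OF f(1)] f0]] by metis
    ultimately show ?thesis using hh h0 by blast
  qed
  then obtain h where h: "h \<in> homog_part (n + 1) d" "h \<noteq> 0" "Poly_Mapping.keys h \<subseteq> std_expos d"
    "word h \<in> D" "lead_expo lt h \<noteq> lead_expo lt f" by blast
  let ?a = "lead_expo lt f" and ?b = "lead_expo lt h"
  let ?Z = "{x \<in> grid_points n A. poly_eval f x = 0 \<and> poly_eval h x = 0}"
  have ab: "?a \<in> std_expos d" "?b \<in> std_expos d"
    using lead_expo_in[OF homog_carrier[OF f(1)] f0] lead_expo_in[OF homog_carrier[OF h(1)] h(2)]
      f(2) h(3) by auto
  have "card ?Z \<le> card (box n \<delta> - (\<Union>h\<in>{f, h}. shadow (lead_expo lt h)))"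
    by (rule cartesian_footprint_bound[of _ d]) (use f f0 h in auto)
  then have Z: "card ?Z \<le> card (box n \<delta> - (shadow ?a \<union> shadow ?b))" by simp
  \<comment> \<open>outside the support every word of \<open>D\<close> vanishes, in particular those of \<open>f\<close> and \<open>h\<close>\<close>
  have "X - word_support D \<subseteq> proj_class (n + 1) ` ?Z"
  proof
    fix p assume p: "p \<in> X - word_support D"
    then obtain x where x: "x \<in> grid_points n A" "p = proj_class (n + 1) x"
      by (auto simp: cartesian_points_image)
    have "word f p = 0" "word h p = 0" using p f(3) vD h(4) by (auto simp: word_support_def)
    then show "p \<in> proj_class (n + 1) ` ?Z"
      unfolding x(2) code_word_proj_class[OF x(1)] using x(1) by blast
  qed
  then have "card (X - word_support D) \<le> card (proj_class (n + 1) ` ?Z)"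
    by (rule card_mono[rotated]) simp
  also have "\<dots> \<le> card ?Z" by (rule card_image_le) simp
  finally have "card X - card (word_support D) \<le> card (box n \<delta>) - card (shadow ?a \<union> shadow ?b)"
    using Z card_Diff_subset[of "word_support D" X] card_Diff_subset[of "shadow ?a \<union> shadow ?b" "box n \<delta>"]
      word_support_subset[OF D(1)] finite_subset[OF word_support_subset[OF D(1)]]
      upper_box_subset[of n \<delta>] by simp
  moreover have "card (word_support D) \<le> card X"
    by (intro card_mono word_support_subset[OF D(1)]) simp
  moreover have "card (shadow ?a \<union> shadow ?b) \<le> card (box n \<delta>)"
    using upper_box_subset[of n \<delta>] by (intro card_mono) auto
  ultimately have "card (shadow ?a \<union> shadow ?b) \<le> card (word_support D)"
    using card_X by linarith
  then show ?thesis using ab h(5) by metis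
qed

text \<open>
  The last exponent is determined by the others and the degree.
\<close>

lemma std_expos_differ:
  assumes "a \<in> std_expos d" "b \<in> std_expos d" "a \<noteq> b"
  shows "\<exists>i\<in>{1..n}. Poly_Mapping.lookup a i \<noteq> Poly_Mapping.lookup b i"
proof (rule ccontr)
  assume "\<not> ?thesis"
  then have eq: "\<And>i. i \<in> {1..n} \<Longrightarrow> Poly_Mapping.lookup a i = Poly_Mapping.lookup b i" by blast
  have E: "a \<in> expos (n + 1)" "b \<in> expos (n + 1)" "expo_deg a = d" "expo_deg b = d"
    using assms by (auto simp: std_expos_def deg_expos_def)
  have "(\<Sum>i=1..n. Poly_Mapping.lookup a i) = (\<Sum>i=1..n. Poly_Mapping.lookup b i)"
    by (rule sum.cong) (auto simp: eq)
  moreover have "(\<Sum>i=1..n. Poly_Mapping.lookup a i) + Poly_Mapping.lookup a (n + 1) = d"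
    "(\<Sum>i=1..n. Poly_Mapping.lookup b i) + Poly_Mapping.lookup b (n + 1) = d"
    using E by (simp_all add: expo_deg_expos)
  ultimately have "Poly_Mapping.lookup a (n + 1) = Poly_Mapping.lookup b (n + 1)" by linarith
  then have "a = b"
    using eq by (intro expo_eqI[OF E(1,2)]) (metis atLeastAtMost_iff le_Suc_eq Suc_eq_plus1)
  then show False using assms by simp
qed

definition enum :: "nat \<Rightarrow> nat \<Rightarrow> 'k" where
  "enum i = (SOME h. bij_betw h {..<\<delta> i} (A i))"

definition grid_point :: "(nat \<Rightarrow> nat) \<Rightarrow> nat \<Rightarrow> 'k" where
  "grid_point c = restrict (\<lambda>i. if i \<le> n then enum i (c i) else 1) {1..n + 1}"

text \<open>
  The form with leading exponent \<open>a\<close> whose zeros on the grid are the points outside the shadow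
  of \<open>a\<close>.
\<close>

definition staircase :: "expo \<Rightarrow> 'k mpoly" where
  "staircase a = (\<Prod>i=1..n. grid_form n i (enum i ` {..<Poly_Mapping.lookup a i})) *
     Poly_Mapping.single (Poly_Mapping.single (n + 1) (Poly_Mapping.lookup a (n + 1))) 1"

lemma bij_enum: "i \<in> {1..n} \<Longrightarrow> bij_betw (enum i) {..<\<delta> i} (A i)"
proof -
  assume "i \<in> {1..n}"
  then have "\<exists>h. bij_betw h {..<\<delta> i} (A i)"
    using ex_bij_betw_nat_finite[of "A i"] card_A[of i] by (auto simp: lessThan_atLeast0)
  then show ?thesis unfolding enum_def by (rule someI_ex)
qed

lemma enum_eq_iff: "i \<in> {1..n} \<Longrightarrow> j < \<delta> i \<Longrightarrow> k < \<delta> i \<Longrightarrow> enum i j = enum i k \<longleftrightarrow> j = k"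
  using bij_enum[of i] by (auto simp: bij_betw_def inj_on_def)

lemma bij_grid_point: "bij_betw grid_point (box n \<delta>) (grid_points n A)"
proof -
  have gi: "grid_point c i = enum i (c i)" if "i \<in> {1..n}" for c i
    using that by (simp add: grid_point_def)
  have "inj_on grid_point (box n \<delta>)"
  proof (rule inj_onI)
    fix c c' assume cc: "c \<in> box n \<delta>" "c' \<in> box n \<delta>" "grid_point c = grid_point c'"
    show "c = c'"
    proof (rule PiE_ext[OF cc(1,2)[unfolded box_def]])
      fix i assume i: "i \<in> {1..n}"
      have "c i < \<delta> i" "c' i < \<delta> i" using cc i by (auto simp: box_def PiE_iff)
      then show "c i = c' i" using cc(3) gi[OF i] enum_eq_iff[OF i] by metis
    qed
  qed
  moreover have "grid_point ` box n \<delta> = grid_points n A"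
  proof (rule card_subset_eq)
    show "grid_point ` box n \<delta> \<subseteq> grid_points n A"
    proof
      fix x assume "x \<in> grid_point ` box n \<delta>"
      then obtain c where c: "c \<in> box n \<delta>" "x = grid_point c" by auto
      have "enum i (c i) \<in> A i" if i: "i \<in> {1..n}" for i
        using bij_enum[OF i] c(1) i by (auto simp: box_def PiE_iff bij_betw_def)
      then show "x \<in> grid_points n A" by (auto simp: c(2) grid_points_def grid_point_def)
    qed
    show "card (grid_point ` box n \<delta>) = card (grid_points n A)"
      unfolding card_image[OF calculation] by (rule card_grid[symmetric])
  qed simp
  ultimately show ?thesis by (simp add: bij_betw_def)
qed

lemma staircase_homog:
  assumes a: "a \<in> std_expos d"
  shows "staircase a \<in> homog_part (n + 1) d"
proof -
  let ?a = "Poly_Mapping.lookup a"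
  have "(\<Prod>i=1..n. grid_form n i (enum i ` {..<?a i})) \<in> homog_part (n + 1) (\<Sum>i=1..n. ?a i)"
  proof (rule homog_prod)
    fix i assume i: "i \<in> {1..n}"
    then have i': "i \<in> {1..n + 1}" by auto
    have "?a i < \<delta> i" using a i by (auto simp: std_expos_def)
    then have "inj_on (enum i) {..<?a i}"
      using bij_enum[OF i] by (auto simp: bij_betw_def intro: inj_on_subset)
    then have "card (enum i ` {..<?a i}) = ?a i" by (simp add: card_image)
    then show "grid_form n i (enum i ` {..<?a i}) \<in> homog_part (n + 1) (?a i)"
      using grid_form_homog[OF i', of "enum i ` {..<?a i}"] by simp
  qed
  moreover have "Poly_Mapping.single (Poly_Mapping.single (n + 1) (?a (n + 1))) 1 \<in> homog_part (n + 1) (?a (n + 1))"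
    by (rule homog_single) (auto simp: expos_def)
  ultimately have "staircase a \<in> homog_part (n + 1) ((\<Sum>i=1..n. ?a i) + ?a (n + 1))"
    unfolding staircase_def by (rule homog_mult)
  moreover have "(\<Sum>i=1..n. ?a i) + ?a (n + 1) = d"
    using a by (auto simp: std_expos_def deg_expos_def expo_deg_expos)
  ultimately show ?thesis by simp
qed

lemma staircase_nonzero:
  assumes a: "a \<in> std_expos d" and c: "c \<in> box n \<delta>"
  shows "poly_eval (staircase a) (grid_point c) \<noteq> 0 \<longleftrightarrow> c \<in> shadow a"
proof -
  let ?a = "Poly_Mapping.lookup a"
  have last: "grid_point c (n + 1) = 1" by (simp add: grid_point_def)
  have "(\<Prod>z\<in>enum i ` {..<?a i}. grid_point c i - z) = 0 \<longleftrightarrow> c i < ?a i" if i: "i \<in> {1..n}" for i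
  proof -
    have ci: "c i < \<delta> i" "?a i < \<delta> i" using a c i by (auto simp: box_def PiE_iff std_expos_def)
    have "(\<Prod>z\<in>enum i ` {..<?a i}. grid_point c i - z) = 0 \<longleftrightarrow> (\<exists>j<?a i. enum i (c i) = enum i j)"
      using i by (auto simp: grid_point_def)
    also have "\<dots> \<longleftrightarrow> c i < ?a i" using enum_eq_iff[OF i] ci by (metis order_less_trans)
    finally show ?thesis .
  qed
  then have "poly_eval (staircase a) (grid_point c) \<noteq> 0 \<longleftrightarrow> (\<forall>i\<in>{1..n}. \<not> c i < ?a i)"
    using last by (simp add: staircase_def poly_eval_mult poly_eval_prod poly_eval_grid_form)
  then show ?thesis using c by (auto simp: upper_box_def not_less)
qed

text \<open>
  The box element \<open>(a\<^sub>1,\<dots>,a\<^sub>n)\<close> lies in the shadow of \<open>a\<close>, but not in that of \<open>b\<close> as \<open>a\<^sub>i < b\<^sub>i\<close>. At the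
  corresponding point the second word vanishes and the first does not, which yields independence. A
  coordinate vanishes on the whole span exactly if it vanishes on both generators.
\<close>

lemma weight_attained_of_less:
  assumes a: "a \<in> std_expos d" and b: "b \<in> std_expos d"
    and i: "i \<in> {1..n}" "Poly_Mapping.lookup a i < Poly_Mapping.lookup b i"
  shows "\<exists>D \<subseteq> eval_code (n + 1) X d. module.subspace word_scale D \<and>
    vector_space.dim word_scale D = 2 \<and> card (word_support D) = card (shadow a \<union> shadow b)"
proof -
  interpret W: vector_space "word_scale :: 'k \<Rightarrow> ((nat \<Rightarrow> 'k) set \<Rightarrow> 'k) \<Rightarrow> _"
    by (rule vector_space_word_scale)
  let ?p = "\<lambda>c. proj_class (n + 1) (grid_point c)"
  let ?wa = "word (staircase a)" and ?wb = "word (staircase b)"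
  let ?D = "W.span {?wa, ?wb}"
  have gp: "grid_point c \<in> grid_points n A" if "c \<in> box n \<delta>" for c
    using bij_grid_point that by (auto simp: bij_betw_def)
  have val: "word (staircase m) (?p c) \<noteq> 0 \<longleftrightarrow> c \<in> shadow m"
    if "m \<in> std_expos d" "c \<in> box n \<delta>" for m c
    unfolding code_word_proj_class[OF gp[OF that(2)]] by (rule staircase_nonzero[OF that])
  define ca where "ca = restrict (Poly_Mapping.lookup a) {1..n}"
  define cb where "cb = restrict (Poly_Mapping.lookup b) {1..n}"
  have ca: "ca \<in> box n \<delta>" "ca \<in> shadow a"
    using a by (auto simp: ca_def upper_box_def box_def std_expos_def)
  have "ca i < Poly_Mapping.lookup b i" using i by (simp add: ca_def)
  then have cab: "ca \<notin> shadow b" using i(1) by (auto simp: upper_box_def not_le)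
  have cb: "cb \<in> box n \<delta>" "cb \<in> shadow b"
    using b by (auto simp: cb_def upper_box_def box_def std_expos_def)
  have wb0: "?wb \<noteq> 0" using val[OF b cb(1)] cb(2) by auto
  have "?wa \<noteq> word_scale k ?wb" for k
  proof
    assume "?wa = word_scale k ?wb"
    then have "?wa (?p ca) = k * ?wb (?p ca)" by (simp add: word_scale_def fun_eq_iff)
    then show False using val[OF a ca(1)] val[OF b ca(1)] ca cab by auto
  qed
  then have "?wa \<notin> W.span {?wb}" by (auto simp: W.span_singleton)
  moreover have "W.independent {?wb}" using wb0 by (simp add: W.dependent_single)
  ultimately have ind: "W.independent {?wa, ?wb}" and ne: "?wa \<noteq> ?wb"
    using W.span_base by (auto simp: W.independent_insert)
  have "?D \<subseteq> eval_code (n + 1) X d"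
    using imageI[OF staircase_homog[OF a], of word] imageI[OF staircase_homog[OF b], of word]
    by (intro W.span_minimal subspace_eval_code) (simp add: eval_code_image)
  moreover have "W.dim ?D = 2"
    using W.dim_span_eq_card_independent[OF ind] ne by simp
  moreover have "word_support ?D = ?p ` (shadow a \<union> shadow b)"
  proof
    show "?p ` (shadow a \<union> shadow b) \<subseteq> word_support ?D"
    proof
      fix p assume "p \<in> ?p ` (shadow a \<union> shadow b)"
      then obtain c where c: "c \<in> shadow a \<union> shadow b" "p = ?p c" by blast
      then have cb: "c \<in> box n \<delta>" using upper_box_subset by blast
      have "?wa p \<noteq> 0 \<or> ?wb p \<noteq> 0" using c val[OF a cb] val[OF b cb] by auto
      then show "p \<in> word_support ?D"
        unfolding word_support_def using W.span_base[of ?wa "{?wa, ?wb}"] W.span_base[of ?wb "{?wa, ?wb}"]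
        by blast
    qed
    show "word_support ?D \<subseteq> ?p ` (shadow a \<union> shadow b)"
    proof
      fix p assume p: "p \<in> word_support ?D"
      show "p \<in> ?p ` (shadow a \<union> shadow b)"
      proof (rule ccontr)
        assume np: "p \<notin> ?p ` (shadow a \<union> shadow b)"
        have "?wa p = 0 \<and> ?wb p = 0"
        proof (cases "p \<in> X")
          case True
          then obtain x where x: "x \<in> grid_points n A" "p = proj_class (n + 1) x"
            by (auto simp: cartesian_points_image)
          then obtain c where c: "c \<in> box n \<delta>" "x = grid_point c"
            using bij_grid_point by (auto simp: bij_betw_def)
          then have "c \<notin> shadow a \<union> shadow b" using np x by blast
          then show ?thesis using val[OF a c(1)] val[OF b c(1)] x c by auto
        qed (simp add: code_word_outside)
        moreover have "W.subspace {w. w p = 0}"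
          by (rule W.subspaceI) (auto simp: word_scale_def)
        ultimately have "?D \<subseteq> {w. w p = 0}" by (intro W.span_minimal) auto
        then show False using p by (auto simp: word_support_def)
      qed
    qed
  qed
  moreover have "inj_on ?p (shadow a \<union> shadow b)"
  proof (rule inj_onI)
    fix c c' assume c: "c \<in> shadow a \<union> shadow b" "c' \<in> shadow a \<union> shadow b" "?p c = ?p c'"
    then have cb: "c \<in> box n \<delta>" "c' \<in> box n \<delta>" using upper_box_subset by blast+
    then have "grid_point c = grid_point c'"
      using inj_onD[OF inj_on_proj_class[of n A], of "grid_point c" "grid_point c'"] c(3) gp
      by simp
    then show "c = c'" using bij_grid_point cb by (auto simp: bij_betw_def inj_on_def)
  qed
  ultimately show ?thesis
    by (intro exI[of _ ?D]) (auto simp: card_image)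
qed

lemma weight_attained:
  assumes ab: "a \<in> std_expos d" "b \<in> std_expos d" "a \<noteq> b"
  shows "\<exists>D \<subseteq> eval_code (n + 1) X d. module.subspace word_scale D \<and>
    vector_space.dim word_scale D = 2 \<and> card (word_support D) = card (shadow a \<union> shadow b)"
proof -
  obtain i where i: "i \<in> {1..n}" "Poly_Mapping.lookup a i \<noteq> Poly_Mapping.lookup b i"
    using std_expos_differ[OF ab] by blast
  then consider "Poly_Mapping.lookup a i < Poly_Mapping.lookup b i"
    | "Poly_Mapping.lookup b i < Poly_Mapping.lookup a i" by linarith
  then show ?thesis
  proof cases
    case 1
    show ?thesis by (rule weight_attained_of_less[OF ab(1,2) i(1) 1])
  next
    case 2
    show ?thesis using weight_attained_of_less[OF ab(2,1) i(1) 2] by (simp only: Un_commute)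
  qed
qed

definition pair_sizes :: "nat \<Rightarrow> nat set" where
  "pair_sizes d = {card (shadow a \<union> shadow b) | a b. a \<in> std_expos d \<and> b \<in> std_expos d \<and> a \<noteq> b}"

lemma finite_pair_sizes [simp]: "finite (pair_sizes d)"
proof -
  have "pair_sizes d \<subseteq> (\<lambda>(a, b). card (shadow a \<union> shadow b)) ` (std_expos d \<times> std_expos d)"
    by (auto simp: pair_sizes_def)
  then show ?thesis by (rule finite_subset) auto
qed

text \<open>
  Witnesses that the minimum over pairs is meaningful: in every positive degree there is a pair
  of different standard monomials.
\<close>

lemma two_std_expos:
  assumes "1 \<le> d"
  shows "Poly_Mapping.single (n + 1) d \<in> std_expos d"
    "i \<in> {1..n} \<Longrightarrow> Poly_Mapping.single i 1 + Poly_Mapping.single (n + 1) (d - 1) \<in> std_expos d"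
proof -
  have last: "Poly_Mapping.single (n + 1) k \<in> expos (n + 1)" for k by (auto simp: expos_def)
  show "Poly_Mapping.single (n + 1) d \<in> std_expos d"
    using two_le last by (fastforce simp: std_expos_def deg_expos_def lookup_single)
  assume i: "i \<in> {1..n}"
  have "Poly_Mapping.single i 1 \<in> expos (n + 1)" using i by (auto simp: expos_def)
  then show "Poly_Mapping.single i 1 + Poly_Mapping.single (n + 1) (d - 1) \<in> std_expos d"
    using two_le last assms
    by (fastforce simp: std_expos_def deg_expos_def lookup_single lookup_add expo_deg_add when_def
        intro: expos_add)
qed

lemma gen_hamming_weight_eq:
  assumes d: "1 \<le> d"
  shows "gen_hamming_weight (n + 1) X d 2 = Min (pair_sizes d)" "pair_sizes d \<noteq> {}"
proof -
  let ?S = "{card (word_support D) | D. D \<subseteq> eval_code (n + 1) X d \<and>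
       module.subspace word_scale D \<and> vector_space.dim word_scale D = 2}"
  have fin: "finite ?S"
  proof (rule finite_subset)
    show "?S \<subseteq> {..card X}"
      using word_support_subset[of _ d] card_mono[OF finite_X] by auto
  qed simp
  have "1 \<in> {1..n}" using n_pos by simp
  note st = two_std_expos(1)[OF d] two_std_expos(2)[OF d this]
  have mem: "card (shadow a \<union> shadow b) \<in> pair_sizes d"
    if "a \<in> std_expos d" "b \<in> std_expos d" "a \<noteq> b" for a b
    unfolding pair_sizes_def using that by blast
  have "Poly_Mapping.single (n + 1) d \<noteq> Poly_Mapping.single 1 1 + Poly_Mapping.single (n + 1) (d - 1)"
  proof
    assume "Poly_Mapping.single (n + 1) d = Poly_Mapping.single 1 1 + Poly_Mapping.single (n + 1) (d - 1)"
    then have "Poly_Mapping.lookup (Poly_Mapping.single (n + 1) d) 1 =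
      Poly_Mapping.lookup (Poly_Mapping.single 1 1 + Poly_Mapping.single (n + 1) (d - 1)) 1" by simp
    then show False using n_pos by (simp add: lookup_add lookup_single when_def)
  qed
  then show ne: "pair_sizes d \<noteq> {}" using mem[OF st] by auto
  have sub: "pair_sizes d \<subseteq> ?S"
  proof
    fix k assume "k \<in> pair_sizes d"
    then obtain a b where ab: "a \<in> std_expos d" "b \<in> std_expos d" "a \<noteq> b"
      "k = card (shadow a \<union> shadow b)" by (auto simp: pair_sizes_def)
    obtain D where "D \<subseteq> eval_code (n + 1) X d" "module.subspace word_scale D"
      "vector_space.dim word_scale D = 2" "card (word_support D) = k"
      using weight_attained[OF ab(1-3)] unfolding ab(4)[symmetric] by (elim exE conjE) (rule that)
    then show "k \<in> ?S" by blast
  qed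
  have low: "Min (pair_sizes d) \<le> k" if "k \<in> ?S" for k
  proof -
    from that obtain D where D: "D \<subseteq> eval_code (n + 1) X d" "module.subspace word_scale D"
      "vector_space.dim word_scale D = 2" "k = card (word_support D)" by blast
    then obtain a b where ab: "a \<in> std_expos d" "b \<in> std_expos d" "a \<noteq> b"
      "card (shadow a \<union> shadow b) \<le> k" using weight_lower_bound[OF D(1-3)] by blast
    then have "Min (pair_sizes d) \<le> card (shadow a \<union> shadow b)"
      by (intro Min_le mem) simp_all
    then show ?thesis using ab(4) by simp
  qed
  show "gen_hamming_weight (n + 1) X d 2 = Min (pair_sizes d)"
    unfolding gen_hamming_weight_def
  proof (rule Min_eqI[OF fin])
    show "Min (pair_sizes d) \<in> ?S" using sub Min_in[OF finite_pair_sizes ne] by blast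
  qed (rule low)
qed

end

section \<open>Ideals of the polynomial ring\<close>

lemma poly_ring_cring [simp]: "cring (poly_ring s :: ('k::comm_ring_1) mpoly ring)"
  by (rule cring_poly_ring)

lemma poly_ring_ring [simp]: "ring (poly_ring s :: ('k::comm_ring_1) mpoly ring)"
  using cring_poly_ring by (rule cring.axioms)

lemma carrier_closed:
  assumes "f \<in> carrier (poly_ring s)" "g \<in> carrier (poly_ring s)"
  shows carrier_add: "f + g \<in> carrier (poly_ring s)"
    and carrier_mult: "f * g \<in> carrier (poly_ring s)"
    and carrier_uminus: "- f \<in> carrier (poly_ring s)"
    and carrier_diff: "f - g \<in> carrier (poly_ring s)"
proof -
  interpret S: cring "poly_ring s :: 'a mpoly ring" by simp
  show "f + g \<in> carrier (poly_ring s)" using S.a_closed[OF assms] by simp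
  show "f * g \<in> carrier (poly_ring s)" using S.m_closed[OF assms] by simp
  have m: "- f \<in> carrier (poly_ring s)" if "f \<in> carrier (poly_ring s)" for f :: "'a mpoly"
    using that by (simp add: carrier_poly_ring)
  show "- f \<in> carrier (poly_ring s)" by (rule m[OF assms(1)])
  show "f - g \<in> carrier (poly_ring s)" using S.a_closed[OF assms(1) m[OF assms(2)]] by simp
qed

lemma carrier_0 [simp]: "0 \<in> carrier (poly_ring s)" by (simp add: carrier_poly_ring)
lemma carrier_1 [simp]: "1 \<in> carrier (poly_ring s)"
  using cring.cring_simprules(6)[OF cring_poly_ring[of s]] by simp

lemma carrier_single: "a \<in> expos s \<Longrightarrow> Poly_Mapping.single a c \<in> carrier (poly_ring s)"
  by (cases "c = 0") (auto simp: carrier_poly_ring)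

lemma carrier_const [simp]: "const_poly c \<in> carrier (poly_ring s)"
  unfolding const_poly_def by (rule carrier_single) simp

lemma poly_ring_a_inv:
  assumes "f \<in> carrier (poly_ring s)"
  shows "\<ominus>\<^bsub>poly_ring s\<^esub> f = - f"
proof -
  interpret S: cring "poly_ring s :: 'a mpoly ring" by simp
  show ?thesis using S.minus_equality[of "- f" f] assms carrier_uminus[OF assms assms] by simp
qed

lemma poly_ring_minus:
  "f \<in> carrier (poly_ring s) \<Longrightarrow> g \<in> carrier (poly_ring s) \<Longrightarrow> f \<ominus>\<^bsub>poly_ring s\<^esub> g = f - g"
  by (simp add: a_minus_def poly_ring_a_inv)

text \<open>
  Introduction and elimination rules that state ideal membership with the ring operations of the type
  instead of those of the record.
\<close>

lemma poly_idealI: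
  assumes "J \<subseteq> carrier (poly_ring s)" "0 \<in> J"
    and "\<And>f g. f \<in> J \<Longrightarrow> g \<in> J \<Longrightarrow> f + g \<in> J"
    and "\<And>f g. f \<in> J \<Longrightarrow> g \<in> carrier (poly_ring s) \<Longrightarrow> g * f \<in> J"
  shows "ideal J (poly_ring s :: ('k::comm_ring_1) mpoly ring)"
proof -
  interpret S: cring "poly_ring s :: 'k mpoly ring" by simp
  have um: "- f \<in> J" if "f \<in> J" for f
    using assms(4)[OF that, of "- 1"] carrier_uminus[of 1 s 1] by simp
  show ?thesis
  proof (rule idealI)
    show "subgroup J (add_monoid (poly_ring s))"
    proof (rule S.add.subgroupI)
      show "J \<noteq> {}" using assms(2) by auto
      show "\<ominus>\<^bsub>poly_ring s\<^esub> f \<in> J" if "f \<in> J" for f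
        using um[OF that] that assms(1) by (simp add: poly_ring_a_inv subset_iff)
    qed (use assms in auto)
    show "f \<otimes>\<^bsub>poly_ring s\<^esub> g \<in> J" if "f \<in> J" "g \<in> carrier (poly_ring s)" for f g
      using assms(4)[OF that] by (simp add: mult.commute)
  qed (use assms in auto)
qed

lemma poly_idealD:
  assumes J: "ideal J (poly_ring s :: ('k::comm_ring_1) mpoly ring)"
  shows poly_ideal_carrier: "f \<in> J \<Longrightarrow> f \<in> carrier (poly_ring s)"
    and poly_ideal_0: "0 \<in> J"
    and poly_ideal_add: "f \<in> J \<Longrightarrow> g \<in> J \<Longrightarrow> f + g \<in> J"
    and poly_ideal_mult: "f \<in> J \<Longrightarrow> g \<in> carrier (poly_ring s) \<Longrightarrow> g * f \<in> J"
    and poly_ideal_diff: "f \<in> J \<Longrightarrow> g \<in> J \<Longrightarrow> f - g \<in> J"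
proof -
  interpret J: ideal J "poly_ring s :: 'k mpoly ring" by fact
  show "f \<in> J \<Longrightarrow> f \<in> carrier (poly_ring s)" for f by (rule J.Icarr)
  show "0 \<in> J" using additive_subgroup.zero_closed[OF ideal.axioms(1)[OF J]] by simp
  show add: "f \<in> J \<Longrightarrow> g \<in> J \<Longrightarrow> f + g \<in> J" for f g 
    using additive_subgroup.a_closed[OF ideal.axioms(1)[OF J], of f g] by simp
  show mult: "f \<in> J \<Longrightarrow> g \<in> carrier (poly_ring s) \<Longrightarrow> g * f \<in> J" for f g
    using J.I_l_closed[of f g] by simp
  have m1: "- 1 \<in> carrier (poly_ring s :: 'k mpoly ring)" by (rule carrier_uminus[OF carrier_1 carrier_1])
  show "f \<in> J \<Longrightarrow> g \<in> J \<Longrightarrow> f - g \<in> J"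
    using add[of f "- 1 * g"] mult[OF _ m1, of g] by simp
qed

lemma poly_ideal_sum:
  assumes "ideal J (poly_ring s :: ('k::comm_ring_1) mpoly ring)" "\<And>b. b \<in> B \<Longrightarrow> f b \<in> J"
  shows "sum f B \<in> J"
  using assms(2)
  by (induction B rule: infinite_finite_induct) (auto intro: poly_ideal_0 poly_ideal_add assms(1))

lemma hom_kernel_prime:
  fixes \<chi> :: "('k::comm_ring_1) mpoly \<Rightarrow> 'b::idom"
  assumes "\<And>f g. \<chi> (f + g) = \<chi> f + \<chi> g" "\<And>f g. \<chi> (f * g) = \<chi> f * \<chi> g" "\<chi> 1 = 1"
  shows "primeideal {f \<in> carrier (poly_ring s). \<chi> f = 0} (poly_ring s)"
proof (rule primeidealI)
  have "\<chi> 0 = 0"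
    using assms(1)[of 0 0] by (metis add.right_neutral add_left_cancel)
  then show "ideal {f \<in> carrier (poly_ring s). \<chi> f = 0} (poly_ring s)"
    by (intro poly_idealI) (auto simp: assms intro: carrier_add carrier_mult)
  have "1 \<notin> {f \<in> carrier (poly_ring s). \<chi> f = 0}" using assms(3) by simp
  then show "carrier (poly_ring s) \<noteq> {f \<in> carrier (poly_ring s). \<chi> f = 0}"
    using carrier_1 by metis
qed (auto simp: assms)

section \<open>Krull dimension one\<close>

text \<open>
  Chains of primes in \<open>R/J\<close> correspond to chains of primes of \<open>R\<close> above \<open>J\<close>, by inverse and direct
  images under the canonical projection.
\<close>

lemma krull_dim_quotient:
  assumes "cring R" "ideal J R"
  shows "krull_dim (R Quot J) = Sup {k. \<exists>P. (\<forall>i\<le>k. primeideal (P i) R \<and> J \<subseteq> P i) \<and>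
    (\<forall>i<k. P i \<subset> P (Suc i))}"
proof -
  have zero: "\<zero>\<^bsub>R Quot J\<^esub> = J" by (simp add: FactRing_def)
  have surj: "\<exists>r\<in>carrier R. c = J +>\<^bsub>R\<^esub> r" if "c \<in> carrier (R Quot J)" for c
    using that unfolding FactRing_def A_RCOSETS_def'[of R J] by auto
  interpret R: cring R by fact
  interpret J: ideal J R by fact
  interpret h: ring_hom_ring R "R Quot J" "(+>\<^bsub>R\<^esub>) J" by (rule J.rcos_ring_hom_ring)
  interpret Q: cring "R Quot J" by (rule J.quotient_is_cring[OF assms(1)])
  let ?up = "\<lambda>P. {r \<in> carrier R. J +>\<^bsub>R\<^esub> r \<in> P}"
  have up: "primeideal (?up P) R" "J \<subseteq> ?up P" if P: "primeideal P (R Quot J)" for P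
  proof -
    interpret P: primeideal P "R Quot J" by fact
    show "primeideal (?up P) R"
    proof (rule primeidealI)
      show "ideal (?up P) R" by (rule h.ideal_vimage[OF P.is_ideal])
      obtain c where "c \<in> carrier (R Quot J)" "c \<notin> P"
        using P.I_notcarr P.a_subset by (metis subsetI subset_antisym)
      then obtain r where "r \<in> carrier R" "J +>\<^bsub>R\<^esub> r \<notin> P" using surj by metis
      then show "carrier R \<noteq> ?up P" by auto
      fix a b assume "a \<in> carrier R" "b \<in> carrier R" "a \<otimes>\<^bsub>R\<^esub> b \<in> ?up P"
      then show "a \<in> ?up P \<or> b \<in> ?up P"
        using P.I_prime[of "J +>\<^bsub>R\<^esub> a" "J +>\<^bsub>R\<^esub> b"] h.hom_closed h.hom_mult by auto
    qed (rule assms(1))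
    show "J \<subseteq> ?up P"
      using P.zero_closed J.Icarr R.a_rcos_zero[OF assms(2)] by (auto simp: zero)
  qed
  let ?down = "\<lambda>P. (+>\<^bsub>R\<^esub>) J ` P"
  have down_iff: "J +>\<^bsub>R\<^esub> r \<in> ?down P \<longleftrightarrow> r \<in> P"
    if P: "ideal P R" "J \<subseteq> P" and r: "r \<in> carrier R" for P r
  proof
    assume "J +>\<^bsub>R\<^esub> r \<in> ?down P"
    then obtain p where p: "p \<in> P" "J +>\<^bsub>R\<^esub> r = J +>\<^bsub>R\<^esub> p" by blast
    interpret P: ideal P R by fact
    have "r \<ominus>\<^bsub>R\<^esub> p \<in> J"
      using R.quotient_eq_iff_same_a_r_cos[OF assms(2) r P.Icarr[OF p(1)]] p(2) by simp
    then have "(r \<ominus>\<^bsub>R\<^esub> p) \<oplus>\<^bsub>R\<^esub> p \<in> P" using P(2) p(1) P.a_closed by blast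
    moreover have "(r \<ominus>\<^bsub>R\<^esub> p) \<oplus>\<^bsub>R\<^esub> p = r"
      using r P.Icarr[OF p(1)] by (simp add: a_minus_def R.add.m_assoc R.l_neg)
    ultimately show "r \<in> P" by simp
  qed blast
  have down: "primeideal (?down P) (R Quot J)" if P: "primeideal P R" "J \<subseteq> P" for P
  proof -
    interpret P: primeideal P R by fact
    note iff = down_iff[OF P.is_ideal P(2)]
    show ?thesis
    proof (rule primeidealI)
      show "ideal (?down P) (R Quot J)"
        by (rule R.ring_ideal_imp_quot_ideal[OF assms(2) P.is_ideal])
      obtain r where "r \<in> carrier R" "r \<notin> P"
        using P.I_notcarr P.a_subset by (metis subsetI subset_antisym)
      then show "carrier (R Quot J) \<noteq> ?down P" using iff h.hom_closed by metis
      fix a b assume ab: "a \<in> carrier (R Quot J)" "b \<in> carrier (R Quot J)"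
        "a \<otimes>\<^bsub>R Quot J\<^esub> b \<in> ?down P"
      obtain x y where xy: "x \<in> carrier R" "a = J +>\<^bsub>R\<^esub> x" "y \<in> carrier R" "b = J +>\<^bsub>R\<^esub> y"
        using surj ab by metis
      have "x \<otimes>\<^bsub>R\<^esub> y \<in> P"
        using ab(3) iff[of "x \<otimes>\<^bsub>R\<^esub> y"] h.hom_mult[OF xy(1,3)] xy by simp
      then show "a \<in> ?down P \<or> b \<in> ?down P"
        using P.I_prime[OF xy(1,3)] xy(2,4) by blast
    qed (rule Q.is_cring)
  qed
  have "(\<exists>P. (\<forall>i\<le>k. primeideal (P i) (R Quot J)) \<and> (\<forall>i<k. P i \<subset> P (Suc i))) \<longleftrightarrow>
    (\<exists>P. (\<forall>i\<le>k. primeideal (P i) R \<and> J \<subseteq> P i) \<and> (\<forall>i<k. P i \<subset> P (Suc i)))"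
    (is "?l \<longleftrightarrow> ?r") for k
  proof
    assume ?l
    then obtain P where P: "\<And>i. i \<le> k \<Longrightarrow> primeideal (P i) (R Quot J)"
      "\<And>i. i < k \<Longrightarrow> P i \<subset> P (Suc i)" by blast
    have "?up (P i) \<subset> ?up (P (Suc i))" if i: "i < k" for i
    proof -
      obtain c where c: "c \<in> P (Suc i)" "c \<notin> P i" using P(2)[OF i] by blast
      have "primeideal (P (Suc i)) (R Quot J)" using P(1) i by simp
      then have "c \<in> carrier (R Quot J)"
        using c(1) ideal.Icarr primeideal.axioms(1) by metis
      then obtain r where "r \<in> carrier R" "c = J +>\<^bsub>R\<^esub> r" using surj by blast
      then have "r \<in> ?up (P (Suc i))" "r \<notin> ?up (P i)" using c by auto
      moreover have "?up (P i) \<subseteq> ?up (P (Suc i))" using P(2)[OF i] by blast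
      ultimately show ?thesis by blast
    qed
    then show ?r using up P(1) by (intro exI[of _ "\<lambda>i. ?up (P i)"]) simp
  next
    assume ?r
    then obtain P where P: "\<And>i. i \<le> k \<Longrightarrow> primeideal (P i) R" "\<And>i. i \<le> k \<Longrightarrow> J \<subseteq> P i"
      "\<And>i. i < k \<Longrightarrow> P i \<subset> P (Suc i)" by blast
    have "?down (P i) \<subset> ?down (P (Suc i))" if i: "i < k" for i
    proof -
      obtain r where r: "r \<in> P (Suc i)" "r \<notin> P i" using P(3)[OF i] by blast
      have id: "ideal (P (Suc i)) R" "ideal (P i) R"
        using P(1)[of "Suc i"] P(1)[of i] i by (simp_all add: primeideal.axioms(1))
      have "r \<in> carrier R" using ideal.Icarr[OF id(1) r(1)] .
      then have "J +>\<^bsub>R\<^esub> r \<notin> ?down (P i)"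
        using down_iff[OF id(2) P(2)] i r(2) by simp
      then have "?down (P i) \<noteq> ?down (P (Suc i))" using r(1) by blast
      moreover have "?down (P i) \<subseteq> ?down (P (Suc i))" using P(3)[OF i] by blast
      ultimately show ?thesis by blast
    qed
    then show ?l using down P(1,2) by (intro exI[of _ "\<lambda>i. ?down (P i)"]) simp
  qed
  then show ?thesis by (simp add: krull_dim_def)
qed

abbreviation last_var :: "nat \<Rightarrow> ('k::field) mpoly" where
  "last_var n \<equiv> Poly_Mapping.single (var_expo (n + 1)) 1"

lemma last_var_carrier: "last_var n \<in> carrier (poly_ring (n + 1))"
  by (rule carrier_single) simp

lemma single_eq_const_mult:
  "Poly_Mapping.single m c = const_poly c * Poly_Mapping.single m (1 :: 'k::field)"
  by (simp add: const_poly_def mult_single)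

lemma line_eval_surj:
  fixes \<alpha> :: "nat \<Rightarrow> 'k::field"
  assumes "\<alpha> (n + 1) = 1"
  shows "\<exists>f\<in>carrier (poly_ring (n + 1)). line_eval \<alpha> f = p"
proof -
  let ?f = "\<Sum>k\<le>degree p. Poly_Mapping.single (Poly_Mapping.single (n + 1) k) (coeff p k)"
  have "Poly_Mapping.single (Poly_Mapping.single (n + 1) k) (coeff p k) \<in> carrier (poly_ring (n + 1))" for k
    by (rule carrier_single) (auto simp: expos_def)
  then have "sum (\<lambda>k. Poly_Mapping.single (Poly_Mapping.single (n + 1) k) (coeff p k)) B
      \<in> carrier (poly_ring (n + 1))" for B
    by (induction B rule: infinite_finite_induct) (auto intro: carrier_add)
  moreover have "line_eval \<alpha> ?f = p"
    using assms by (simp add: line_eval_sum poly_as_sum_of_monoms)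
  ultimately show ?thesis by blast
qed

text \<open>
  Modulo the forms \<open>t\<^sub>i - \<alpha>\<^sub>i t\<^sub>s\<close> each variable can be replaced by a multiple of \<open>t\<^sub>s\<close>.
\<close>

lemma monomial_congruence:
  fixes \<alpha> :: "nat \<Rightarrow> 'k::field"
  assumes J: "ideal J (poly_ring (n + 1))" and \<alpha>: "\<alpha> (n + 1) = 1"
    and lin: "\<And>i. i \<in> {1..n} \<Longrightarrow> lin_form n i (\<alpha> i) \<in> J"
    and m: "m \<in> expos (n + 1)"
  shows "Poly_Mapping.single m 1 - const_poly (mon_val \<alpha> m) * last_var n ^ expo_deg m \<in> J"
  using m
proof (induction "expo_deg m" arbitrary: m)
  case 0
  have "m = 0"
  proof (rule expo_eqI[OF 0(2) zero_in_expos])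
    fix i assume "i \<in> {1..n + 1}"
    then show "Poly_Mapping.lookup m i = Poly_Mapping.lookup 0 i"
      using 0(1) expo_deg_expos[OF 0(2)] by (cases "i = n + 1") auto
  qed
  then show ?case using poly_ideal_0[OF J] by (simp add: const_poly_def)
next
  case (Suc k)
  have "m \<noteq> 0" using Suc(2) by auto
  then obtain i where i: "i \<in> Poly_Mapping.keys m" by (metis all_not_in_conv keys_eq_empty)
  then have iE: "i \<in> {1..n + 1}" using Suc.prems by (auto simp: expos_def)
  define m' where "m' = m - var_expo i"
  have "expo_le (var_expo i) m"
    using i by (auto simp: expo_le_def var_expo_def lookup_single when_def in_keys_iff)
  then have m_eq: "m = var_expo i + m'" by (simp add: m'_def expo_le_add_diff)
  have m': "m' \<in> expos (n + 1)" using Suc.prems by (simp add: m'_def expos_diff)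
  have deg: "expo_deg m = Suc (expo_deg m')" by (simp add: m_eq expo_deg_add var_expo_def)
  have val: "mon_val \<alpha> m = \<alpha> i * mon_val \<alpha> m'" by (simp add: m_eq mon_val_add var_expo_def)
  let ?X = "Poly_Mapping.single (var_expo i) (1 :: 'k)" and ?T = "last_var n :: 'k mpoly"
  let ?M = "Poly_Mapping.single m' (1 :: 'k)"
  let ?V = "const_poly (mon_val \<alpha> m') * ?T ^ expo_deg m'"
  have Tpow: "?T ^ j \<in> carrier (poly_ring (n + 1))" for j
    by (induction j) (simp_all add: carrier_mult[OF last_var_carrier, simplified])
  have XT: "?X - const_poly (\<alpha> i) * ?T \<in> J"
  proof (cases "i = n + 1")
    case True
    then show ?thesis using \<alpha> poly_ideal_0[OF J] by (simp add: const_poly_def)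
  next
    case False
    then have "lin_form n i (\<alpha> i) \<in> J" using lin iE by auto
    then show ?thesis
      unfolding lin_form_def by (subst (asm) (2) single_eq_const_mult)
  qed
  have "?M - ?V \<in> J" using Suc.hyps(1)[of m'] Suc.hyps(2) deg m' by simp
  then have 1: "?X * (?M - ?V) \<in> J"
    using iE by (intro poly_ideal_mult[OF J] carrier_single) auto
  have 2: "?V * (?X - const_poly (\<alpha> i) * ?T) \<in> J"
    by (intro poly_ideal_mult[OF J XT] carrier_mult Tpow) simp
  have "const_poly (mon_val \<alpha> m) = const_poly (\<alpha> i) * const_poly (mon_val \<alpha> m')"
    by (simp add: val const_poly_def mult_single)
  moreover have "Poly_Mapping.single m (1 :: 'k) = ?X * ?M" by (simp add: m_eq mult_single)
  ultimately have "Poly_Mapping.single m 1 - const_poly (mon_val \<alpha> m) * ?T ^ expo_deg m =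
      ?X * (?M - ?V) + ?V * (?X - const_poly (\<alpha> i) * ?T)"
    by (simp add: deg algebra_simps)
  then show ?case using poly_ideal_add[OF J 1 2] by simp
qed

text \<open>
  The forms \<open>t\<^sub>i - \<alpha>\<^sub>i t\<^sub>s\<close> generate the ideal of the line through \<open>\<alpha>\<close>: modulo them \<open>f\<close> is congruent to
  \<open>f(\<alpha> t\<^sub>s)\<close>.
\<close>

lemma line_kernel_subset:
  fixes \<alpha> :: "nat \<Rightarrow> 'k::field"
  assumes J: "ideal J (poly_ring (n + 1))" and \<alpha>: "\<alpha> (n + 1) = 1"
    and lin: "\<And>i. i \<in> {1..n} \<Longrightarrow> lin_form n i (\<alpha> i) \<in> J"
    and f: "f \<in> carrier (poly_ring (n + 1))" "line_eval \<alpha> f = 0"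
  shows "f \<in> J"
proof -
  define \<psi> where "\<psi> p = poly (map_poly const_poly p) (last_var n :: 'k mpoly)" for p
  have const0: "const_poly (0 :: 'k) = 0" by (simp add: const_poly_def)
  have const_add: "const_poly (a + b :: 'k) = const_poly a + const_poly b" for a b
    by (simp add: const_poly_def single_add)
  have \<psi>_add: "\<psi> (p + q) = \<psi> p + \<psi> q" for p q
  proof -
    have "map_poly const_poly (p + q) = map_poly const_poly p + map_poly const_poly q"
      by (rule poly_eqI) (simp add: coeff_map_poly const0 const_add)
    then show ?thesis by (simp add: \<psi>_def)
  qed
  have \<psi>_0: "\<psi> 0 = 0" by (simp add: \<psi>_def)
  have \<psi>_monom: "\<psi> (monom c k) = const_poly c * last_var n ^ k" for c k
    by (simp add: \<psi>_def map_poly_monom const0 poly_monom)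
  have \<psi>_sum: "\<psi> (sum p B) = (\<Sum>b\<in>B. \<psi> (p b))" for p and B :: "expo set"
    by (induction B rule: infinite_finite_induct) (auto simp: \<psi>_0 \<psi>_add)
  let ?K = "Poly_Mapping.keys f"
  let ?t = "\<lambda>m. const_poly (Poly_Mapping.lookup f m) *
    (Poly_Mapping.single m 1 - const_poly (mon_val \<alpha> m) * last_var n ^ expo_deg m)"
  have "sum ?t ?K \<in> J"
  proof (rule poly_ideal_sum[OF J])
    fix m assume "m \<in> ?K"
    then have "m \<in> expos (n + 1)" using f(1) by (auto simp: carrier_poly_ring)
    then show "?t m \<in> J"
      by (intro poly_ideal_mult[OF J] monomial_congruence[OF J \<alpha> lin]) simp_all
  qed
  moreover have "sum ?t ?K = f - \<psi> (line_eval \<alpha> f)"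
  proof -
    have "?t m = Poly_Mapping.single m (Poly_Mapping.lookup f m) -
        \<psi> (monom (Poly_Mapping.lookup f m * mon_val \<alpha> m) (expo_deg m))" for m
      unfolding \<psi>_monom
      by (simp add: right_diff_distrib const_poly_def mult_single mult.assoc[symmetric])
    then have "sum ?t ?K = (\<Sum>m\<in>?K. Poly_Mapping.single m (Poly_Mapping.lookup f m)) -
        \<psi> (line_eval \<alpha> f)"
      by (simp add: line_eval_def \<psi>_sum sum_subtractf)
    then show ?thesis by (simp add: sum_single_keys)
  qed
  ultimately show ?thesis using f(2) \<psi>_0 by simp
qed

text \<open>
  All three primes contain the kernel of the surjection \<^term>\<open>line_eval \<alpha>\<close> onto \<open>K[T]\<close>, so the claim
  is that \<open>K[T]\<close> has dimension at most one. The images of \<open>P1\<close> and \<open>P2\<close> are principal, generated by elements of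
  least degree. A nonzero prime generator is irreducible, so a generator of the larger image is
  associated to it, against strictness, or a unit, against properness.
\<close>

lemma no_long_prime_chain:
  fixes \<alpha> :: "nat \<Rightarrow> 'k::field"
  assumes P: "primeideal P0 (poly_ring (n + 1))" "primeideal P1 (poly_ring (n + 1))"
      "primeideal P2 (poly_ring (n + 1))"
    and sub: "P0 \<subset> P1" "P1 \<subset> P2"
    and \<alpha>: "\<alpha> (n + 1) = 1" and lin: "\<And>i. i \<in> {1..n} \<Longrightarrow> lin_form n i (\<alpha> i) \<in> P0"
  shows False
proof -
  let ?S = "poly_ring (n + 1) :: 'k mpoly ring" and ?\<phi> = "line_eval \<alpha>"
  note id = P[THEN primeideal.axioms(1)]
  note surj = line_eval_surj[where \<alpha> = \<alpha> and n = n, OF \<alpha>]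
  have member: "f \<in> J" if J: "ideal J ?S" "P0 \<subseteq> J" and f: "f \<in> carrier ?S" and g: "g \<in> J"
    and eq: "?\<phi> f = ?\<phi> g" for J f g
  proof -
    have "f - g \<in> J"
    proof (rule line_kernel_subset[where \<alpha> = \<alpha>, OF J(1) \<alpha>])
      show "f - g \<in> carrier ?S" by (rule carrier_diff[OF f poly_ideal_carrier[OF J(1) g]])
    qed (use lin J(2) eq in \<open>auto simp: line_eval_diff\<close>)
    then show ?thesis using poly_ideal_add[OF J(1) _ g, of "f - g"] by simp
  qed
  \<comment> \<open>the image of an ideal is principal, by division with remainder in \<open>K[T]\<close>\<close>
  have gen: "\<exists>h\<in>J. \<forall>f\<in>J. ?\<phi> h dvd ?\<phi> f" if J: "ideal J ?S" for J
  proof (cases "\<forall>f\<in>J. ?\<phi> f = 0")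
    case True
    then show ?thesis using poly_ideal_0[OF J] by auto
  next
    case False
    then obtain h where h: "h \<in> J" "?\<phi> h \<noteq> 0"
      "\<And>f. f \<in> J \<and> ?\<phi> f \<noteq> 0 \<Longrightarrow> degree (?\<phi> h) \<le> degree (?\<phi> f)"
      using ex_has_least_nat[of "\<lambda>f. f \<in> J \<and> ?\<phi> f \<noteq> 0" _ "\<lambda>f. degree (?\<phi> f)"] by blast
    have "?\<phi> h dvd ?\<phi> f" if f: "f \<in> J" for f
    proof -
      obtain q where q: "q \<in> carrier ?S" "?\<phi> q = ?\<phi> f div ?\<phi> h" using surj by blast
      have "f - q * h \<in> J" by (intro poly_ideal_diff[OF J] poly_ideal_mult[OF J] f h q)
      moreover have eq: "?\<phi> (f - q * h) = ?\<phi> f mod ?\<phi> h"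
        by (simp add: line_eval_diff line_eval_mult q(2) minus_div_mult_eq_mod)
      ultimately have "?\<phi> f mod ?\<phi> h = 0"
        using h(3)[of "f - q * h"] degree_mod_less[OF h(2), of "?\<phi> f"] by (metis not_le)
      then show ?thesis by (simp add: mod_eq_0_iff_dvd)
    qed
    then show ?thesis using h(1) by blast
  qed
  obtain h1 where h1: "h1 \<in> P1" "\<forall>f\<in>P1. ?\<phi> h1 dvd ?\<phi> f" using gen[OF id(2)] by blast
  obtain h2 where h2: "h2 \<in> P2" "\<forall>f\<in>P2. ?\<phi> h2 dvd ?\<phi> f" using gen[OF id(3)] by blast
  have "?\<phi> h1 \<noteq> 0"
  proof
    assume 0: "?\<phi> h1 = 0"
    obtain f where f: "f \<in> P1" "f \<notin> P0" using sub by blast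
    then have "?\<phi> f = ?\<phi> 0" using h1(2) 0 by auto
    then have "f \<in> P0"
      using member[OF id(1) _ poly_ideal_carrier[OF id(2) f(1)] poly_ideal_0[OF id(1)]] by simp
    then show False using f by simp
  qed
  moreover obtain k where k: "?\<phi> h1 = ?\<phi> h2 * k" using h1(1) h2(2) sub(2) by (meson dvdE psubsetD)
  obtain K where K: "K \<in> carrier ?S" "?\<phi> K = k" using surj by blast
  have h2c: "h2 \<in> carrier ?S" by (rule poly_ideal_carrier[OF id(3) h2(1)])
  have sub': "P0 \<subseteq> P1" "P0 \<subseteq> P2" using sub by auto
  \<comment> \<open>the generator of \<open>P1\<close> factors, up to the kernel, as \<open>h2 * K\<close>\<close>
  have "h2 * K \<in> P1"
    by (rule member[OF id(2) sub'(1) carrier_mult[OF h2c K(1)] h1(1)])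
       (simp add: line_eval_mult K k)
  then have "h2 \<in> P1 \<or> K \<in> P1"
    using primeideal.I_prime[OF P(2) h2c K(1)] by simp
  then show False
  proof
    assume h2P: "h2 \<in> P1"
    have "f \<in> P1" if f: "f \<in> P2" for f
    proof -
      obtain w where w: "?\<phi> f = ?\<phi> h2 * w" using h2(2) f by (meson dvdE)
      obtain W where W: "W \<in> carrier ?S" "?\<phi> W = w" using surj by blast
      show ?thesis
        by (rule member[OF id(2) sub'(1) poly_ideal_carrier[OF id(3) f] poly_ideal_mult[OF id(2) h2P W(1)]])
           (simp add: line_eval_mult w W)
    qed
    then show False using sub(2) by blast
  next
    assume "K \<in> P1"
    then obtain u where u: "k = ?\<phi> h1 * u" using h1(2) K(2) by (metis dvdE)
    then have "?\<phi> h2 * u * k = 1 * k" by (metis k mult.assoc mult.commute mult_1)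
    moreover have "k \<noteq> 0" using k calculation(1) \<open>?\<phi> h1 \<noteq> 0\<close> by auto
    ultimately have unit: "u * ?\<phi> h2 = 1" by (simp add: mult.commute)
    obtain U where U: "U \<in> carrier ?S" "?\<phi> U = u" using surj by blast
    have "1 \<in> P2"
      by (rule member[OF id(3) sub'(2) carrier_1 poly_ideal_mult[OF id(3) h2(1) U(1)]])
         (simp add: line_eval_mult U unit)
    then have "P2 = carrier ?S" using ideal.one_imp_carrier[OF id(3)] by simp
    then show False using primeideal.I_notcarr[OF P(3)] by simp
  qed
qed

text \<open>
  A prime above \<open>J\<close> is assumed to contain the ideal of some line, which bounds chains by the preceding
  lemma. A chain of length one is given by the ideal of a line on which \<open>J\<close> vanishes and the ideal of
  the origin.
\<close>

lemma krull_dim_one: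
  fixes \<alpha> :: "nat \<Rightarrow> 'k::field"
  assumes J: "ideal J (poly_ring (n + 1) :: 'k mpoly ring)"
    and lin: "\<And>P. primeideal P (poly_ring (n + 1)) \<Longrightarrow> J \<subseteq> P \<Longrightarrow>
      \<exists>\<alpha>. \<alpha> (n + 1) = 1 \<and> (\<forall>i\<in>{1..n}. lin_form n i (\<alpha> i) \<in> P)"
    and \<alpha>: "\<alpha> (n + 1) = 1" "\<And>f. f \<in> J \<Longrightarrow> line_eval \<alpha> f = 0"
  shows "krull_dim (poly_ring (n + 1) Quot J) = 1"
  unfolding krull_dim_quotient[OF cring_poly_ring J]
proof (rule cSup_eq_maximum)
  let ?S = "poly_ring (n + 1) :: 'k mpoly ring"
  let ?C = "\<lambda>k (P :: nat \<Rightarrow> 'k mpoly set). (\<forall>i\<le>k. primeideal (P i) ?S \<and> J \<subseteq> P i) \<and> (\<forall>i<k. P i \<subset> P (Suc i))"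
  define P0 where "P0 = {f \<in> carrier ?S. line_eval \<alpha> f = 0}"
  define P1 where "P1 = {f \<in> carrier ?S. coeff (line_eval \<alpha> f) 0 = 0}"
  have "primeideal P0 ?S"
    unfolding P0_def by (rule hom_kernel_prime) (auto simp: line_eval_add line_eval_mult)
  moreover have "primeideal P1 ?S"
    unfolding P1_def by (rule hom_kernel_prime) (auto simp: line_eval_add line_eval_mult coeff_mult)
  moreover have "J \<subseteq> P0" using \<alpha>(2) poly_ideal_carrier[OF J] by (auto simp: P0_def)
  moreover have ss: "P0 \<subset> P1"
  proof -
    have "last_var n \<in> P1" "last_var n \<notin> P0"
      using last_var_carrier[of n] \<alpha>(1) by (auto simp: var_expo_def P0_def P1_def)
    moreover have "P0 \<subseteq> P1" by (auto simp: P0_def P1_def)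
    ultimately show ?thesis by blast
  qed
  moreover have "J \<subseteq> P1" using calculation(3) ss by blast
  ultimately have "?C 1 (\<lambda>i. if i = 0 then P0 else P1)" by simp
  then show "1 \<in> {k. \<exists>P. ?C k P}" unfolding mem_Collect_eq by (rule exI[where P = "?C 1"])
  fix k assume "k \<in> {k. \<exists>P. ?C k P}"
  then obtain P where P: "?C k P" by blast
  show "k \<le> 1"
  proof (rule ccontr)
    assume "\<not> k \<le> 1"
    then have k: "0 \<le> k" "1 \<le> k" "2 \<le> k" "0 < k" "1 < k" by auto
    have pr: "primeideal (P 0) ?S" "J \<subseteq> P 0" "primeideal (P 1) ?S" "primeideal (P 2) ?S"
      using P k by blast+
    have "P 0 \<subset> P (Suc 0)" "P 1 \<subset> P (Suc 1)" using P k by blast+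
    then have ss: "P 0 \<subset> P 1" "P 1 \<subset> P 2" by (simp_all add: numeral_2_eq_2)
    obtain \<beta> where "\<beta> (n + 1) = 1" "\<forall>i\<in>{1..n}. lin_form n i (\<beta> i) \<in> P 0"
      using lin[OF pr(1,2)] by blast
    then show False using no_long_prime_chain[OF pr(1,3,4) ss, of \<beta>] by blast
  qed
qed

section \<open>Dimensions of graded pieces\<close>

lemma subfield_const:
  "subfield (range (const_poly :: 'k::field \<Rightarrow> 'k mpoly)) (poly_ring s)"
proof -
  interpret S: cring "poly_ring s :: 'k mpoly ring" by simp
  have mul: "const_poly a * const_poly b = const_poly (a * b :: 'k)" for a b
    by (simp add: const_poly_def mult_single)
  have add: "const_poly a + const_poly b = const_poly (a + b :: 'k)" for a b
    by (simp add: const_poly_def single_add)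
  have one: "const_poly (1 :: 'k) = 1" by (simp add: const_poly_def)
  have sub: "subcring (range (const_poly :: 'k \<Rightarrow> _)) (poly_ring s)"
  proof (rule S.subcringI')
    show "subring (range (const_poly :: 'k \<Rightarrow> _)) (poly_ring s)"
    proof (rule S.subringI)
      show "\<one>\<^bsub>poly_ring s\<^esub> \<in> range (const_poly :: 'k \<Rightarrow> _)" using one by (metis poly_ring_ops(2) rangeI)
      show "\<ominus>\<^bsub>poly_ring s\<^esub> h \<in> range const_poly" if "h \<in> range (const_poly :: 'k \<Rightarrow> _)" for h
      proof -
        from that obtain c where "h = const_poly c" by blast
        then have "\<ominus>\<^bsub>poly_ring s\<^esub> h = const_poly (- c)"
          using poly_ring_a_inv[OF carrier_const[of c s]] by (simp add: const_poly_def single_uminus)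
        then show ?thesis by simp
      qed
    qed (auto simp: mul add)
  qed
  show ?thesis
  proof (rule S.subfieldI[OF sub])
    have "const_poly c \<in> Units (poly_ring s \<lparr>carrier := range const_poly\<rparr>)" if "c \<noteq> (0 :: 'k)" for c
    proof -
      have "const_poly (inverse c) * const_poly c = 1" "const_poly c * const_poly (inverse c) = 1"
        using that by (simp_all add: mul one)
      then show ?thesis unfolding Units_def by auto
    qed
    moreover have "const_poly (0 :: 'k) \<notin> Units (poly_ring s \<lparr>carrier := range const_poly\<rparr>)"
      by (auto simp: Units_def const_poly_def)
    moreover have "Units (poly_ring s \<lparr>carrier := range const_poly\<rparr>) \<subseteq> range (const_poly :: 'k \<Rightarrow> _)"
      by (auto simp: Units_def)
    moreover have "const_poly c = 0 \<longleftrightarrow> c = (0 :: 'k)" for c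
      by (metis const_poly_def lookup_single_eq lookup_zero single_zero)
    moreover have "const_poly 0 = (0 :: 'k mpoly)" by (simp add: const_poly_def)
    ultimately show "Units (poly_ring s \<lparr>carrier := range const_poly\<rparr>) =
        range (const_poly :: 'k \<Rightarrow> _) - {\<zero>\<^bsub>poly_ring s\<^esub>}"
      by auto
  qed
qed

text \<open>
  The functions \<open>\<phi>(\<cdot>,t)\<close> for \<open>t \<in> T\<close> are coordinates on the image of \<open>E\<close> in \<open>S/J\<close>. Two choices are
  used: values at the points of \<open>X\<close>, and coefficients of the monomials outside a monomial ideal. The
  dimension is built up by one for each coordinate that is allowed to be nonzero.
\<close>

lemma quot_dim_eq_card:
  fixes \<phi> :: "'k::field mpoly \<Rightarrow> 't \<Rightarrow> 'k"
  assumes J: "ideal J (poly_ring s)" "1 \<notin> J" and T: "finite T"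
    and E: "E \<subseteq> carrier (poly_ring s)" "\<And>f g. f \<in> E \<Longrightarrow> g \<in> E \<Longrightarrow> f + g \<in> E"
      "\<And>f c. f \<in> E \<Longrightarrow> const_poly c * f \<in> E"
    and \<phi>: "\<And>f g t. \<phi> (f + g) t = \<phi> f t + \<phi> g t" "\<And>c f t. \<phi> (const_poly c * f) t = c * \<phi> f t"
    and surj: "\<And>v. \<exists>f\<in>E. \<forall>t\<in>T. \<phi> f t = v t"
    and ker: "\<And>f. f \<in> E \<Longrightarrow> f \<in> J \<longleftrightarrow> (\<forall>t\<in>T. \<phi> f t = 0)"
  shows "quot_dim s J E = card T"
proof -
  let ?S = "poly_ring s :: 'k mpoly ring"
  let ?Q = "?S Quot J" and ?h = "(+>\<^bsub>?S\<^esub>) J"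
  have zero: "\<zero>\<^bsub>?Q\<^esub> = J" by (simp add: FactRing_def)
  interpret S: cring ?S by simp
  interpret J: ideal J ?S by fact
  interpret h: ring_hom_ring ?S ?Q ?h by (rule J.rcos_ring_hom_ring)
  have Qr: "ring ?Q" by (rule J.quotient_is_ring)
  have h_eq: "?h f = ?h g \<longleftrightarrow> f - g \<in> J" if "f \<in> carrier ?S" "g \<in> carrier ?S" for f g
    using S.quotient_eq_iff_same_a_r_cos[OF J(1) that] poly_ring_minus[OF that] by simp
  have h_add: "?h (f + g) = ?h f \<oplus>\<^bsub>?Q\<^esub> ?h g" if "f \<in> carrier ?S" "g \<in> carrier ?S" for f g
    using h.hom_add[OF that] by simp
  have h_mult: "?h (f * g) = ?h f \<otimes>\<^bsub>?Q\<^esub> ?h g" if "f \<in> carrier ?S" "g \<in> carrier ?S" for f g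
    using h.hom_mult[OF that] by simp
  have "?h 1 \<noteq> ?h 0" using h_eq[of 1 0] J(2) by simp
  moreover have "\<one>\<^bsub>?Q\<^esub> = ?h 1" "\<zero>\<^bsub>?Q\<^esub> = ?h 0"
    using h.hom_one h.hom_zero by simp_all
  ultimately have one_zero: "\<one>\<^bsub>?Q\<^esub> \<noteq> \<zero>\<^bsub>?Q\<^esub>" by simp
  define K where "K = range (\<lambda>c. ?h (const_poly c))"
  have K: "subfield K ?Q"
    using h.img_is_subfield(2)[OF subfield_const one_zero] by (simp add: K_def image_image)
  \<comment> \<open>the elements whose coordinates outside \<open>U\<close> vanish; \<open>U\<close> grows from the empty set to \<open>T\<close>\<close>
  define V where "V U = {f \<in> E. \<forall>t\<in>T - U. \<phi> f t = 0}" for U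
  have E0: "0 \<in> E"
  proof -
    obtain f where "f \<in> E" using surj by blast
    then show ?thesis using E(3)[of f 0] by (simp add: const_poly_def)
  qed
  have \<phi>0: "\<phi> 0 t = 0" for t using \<phi>(2)[of 0 0 t] by simp
  have \<phi>diff: "\<phi> (f - const_poly c * g) t = \<phi> f t - c * \<phi> g t" for f g c t
  proof -
    have "f - const_poly c * g = f + const_poly (- c) * g"
      by (simp add: const_poly_def single_uminus)
    then show ?thesis by (simp only: \<phi>) simp
  qed
  have Ediff: "f - const_poly c * g \<in> E" if "f \<in> E" "g \<in> E" for f g c
  proof -
    have "f - const_poly c * g = f + const_poly (- c) * g"
      by (simp add: const_poly_def single_uminus)
    then show ?thesis by (simp only: E(2)[OF that(1) E(3)[OF that(2)]])
  qed
  have Ec: "f \<in> carrier ?S" if "f \<in> E" for f using E(1) that by blast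
  have "ring.dimension ?Q (card U) K (?h ` V U)" if "U \<subseteq> T" for U
    using finite_subset[OF that T] that
  proof (induction U rule: finite_induct)
    case empty
    have "?h ` V {} = {\<zero>\<^bsub>?Q\<^esub>}"
    proof
      show "?h ` V {} \<subseteq> {\<zero>\<^bsub>?Q\<^esub>}"
        using ker S.a_rcos_zero[OF J(1)] by (auto simp: V_def zero)
      have "0 \<in> V {}" using E0 \<phi>0 by (simp add: V_def)
      then show "{\<zero>\<^bsub>?Q\<^esub>} \<subseteq> ?h ` V {}" using \<open>\<zero>\<^bsub>?Q\<^esub> = ?h 0\<close> by auto
    qed
    then show ?case using ring.dimension.zero_dim[OF Qr, of K] by simp
  next
    case (insert t U)
    obtain e where e: "e \<in> E" "\<forall>u\<in>T. \<phi> e u = (if u = t then 1 else 0)"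
      using surj[of "\<lambda>u. if u = t then 1 else 0"] by blast
    have t: "t \<in> T" "t \<in> T - U" using insert by auto
    have "?h e \<notin> ?h ` V U"
    proof
      assume "?h e \<in> ?h ` V U"
      then obtain f where f: "f \<in> V U" "?h e = ?h f" by blast
      then have fE: "f \<in> E" and ft: "\<phi> f t = 0" using t by (auto simp: V_def)
      have "e - const_poly 1 * f \<in> J" using h_eq[OF Ec[OF e(1)] Ec[OF fE]] f(2) by (simp add: const_poly_def)
      then have "\<phi> (e - const_poly 1 * f) t = 0" using ker[OF Ediff[OF e(1) fE]] t by blast
      then show False using ft e(2) t \<phi>diff[of e 1 f t] by simp
    qed
    moreover have "ring.line_extension ?Q K (?h e) (?h ` V U) = ?h ` V (insert t U)"
    proof
      show "ring.line_extension ?Q K (?h e) (?h ` V U) \<subseteq> ?h ` V (insert t U)"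
      proof
        fix w assume "w \<in> ring.line_extension ?Q K (?h e) (?h ` V U)"
        then obtain c f where f: "f \<in> V U" "w = ?h (const_poly c) \<otimes>\<^bsub>?Q\<^esub> ?h e \<oplus>\<^bsub>?Q\<^esub> ?h f"
          unfolding ring.line_extension_mem_iff[OF Qr] K_def by blast
        then have fE: "f \<in> E" by (simp add: V_def)
        have "w = ?h (const_poly c * e + f)"
          using f(2) h_add[OF carrier_mult[OF carrier_const Ec[OF e(1)]] Ec[OF fE]]
            h_mult[OF carrier_const Ec[OF e(1)]] by simp
        moreover have "const_poly c * e + f \<in> V (insert t U)"
          using f(1) e E(2,3) \<phi> by (auto simp: V_def)
        ultimately show "w \<in> ?h ` V (insert t U)" by blast
      qed
      show "?h ` V (insert t U) \<subseteq> ring.line_extension ?Q K (?h e) (?h ` V U)"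
      proof
        fix w assume "w \<in> ?h ` V (insert t U)"
        then obtain f where f: "f \<in> V (insert t U)" "w = ?h f" by blast
        then have fE: "f \<in> E" by (simp add: V_def)
        let ?c = "\<phi> f t"
        let ?g = "f - const_poly ?c * e"
        have g: "?g \<in> V U" using f(1) e Ediff[OF fE e(1)] \<phi>diff by (auto simp: V_def)
        have "?h f = ?h (const_poly ?c * e + ?g)" by simp
        also have "\<dots> = ?h (const_poly ?c * e) \<oplus>\<^bsub>?Q\<^esub> ?h ?g"
          by (rule h_add[OF carrier_mult[OF carrier_const Ec[OF e(1)]] Ec[OF Ediff[OF fE e(1)]]])
        also have "?h (const_poly ?c * e) = ?h (const_poly ?c) \<otimes>\<^bsub>?Q\<^esub> ?h e"
          by (rule h_mult[OF carrier_const Ec[OF e(1)]])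
        finally show "w \<in> ring.line_extension ?Q K (?h e) (?h ` V U)"
          unfolding ring.line_extension_mem_iff[OF Qr] f(2) K_def using g by blast
      qed
    qed
    ultimately show ?case
      using ring.dimension.Suc_dim[OF Qr, of "?h e" "?h ` V U" "card U" K] insert h.hom_closed[OF Ec[OF e(1)]]
      by simp
  qed
  from this[of T] have "ring.dimension ?Q (card T) K (?h ` E)" by (simp add: V_def)
  from ring.dimI[OF Qr K this] show ?thesis
    unfolding quot_dim_def over_def K_def by simp
qed

text \<open>
  In dimension one the degree is the eventual value of the Hilbert function.
\<close>

lemma quot_degree_eq:
  assumes "krull_dim (poly_ring s Quot J) = 1" "\<And>e. e \<ge> e0 \<Longrightarrow> quot_dim s J (homog_part s e) = N"
  shows "quot_degree s J = real N"
proof -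
  have "(\<lambda>e. real (quot_dim s J (homog_part s e)) / real e ^ (1 - 1)) \<longlonglongrightarrow> real N"
    by (rule tendsto_eventually) (use assms(2) in \<open>auto simp: eventually_at_top_linorder\<close>)
  then show ?thesis
    using assms(1) by (simp add: quot_degree_def limI)
qed

section \<open>Monomial ideals\<close>

definition monomial_ideal :: "nat \<Rightarrow> expo set \<Rightarrow> ('k::comm_ring_1) mpoly set" where
  "monomial_ideal s B =
     {f \<in> carrier (poly_ring s). \<forall>a\<in>Poly_Mapping.keys f. \<exists>b\<in>B. expo_le b a}"

lemma ideal_monomial_ideal: "ideal (monomial_ideal s B) (poly_ring s :: ('k::comm_ring_1) mpoly ring)"
proof (rule poly_idealI)
  fix f g :: "'k mpoly"
  assume f: "f \<in> monomial_ideal s B"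
  {
    assume g: "g \<in> monomial_ideal s B"
    have "\<exists>b\<in>B. expo_le b a" if a: "a \<in> Poly_Mapping.keys (f + g)" for a
    proof -
      have "a \<in> Poly_Mapping.keys f \<or> a \<in> Poly_Mapping.keys g"
        using subsetD[OF Poly_Mapping.keys_add a] by simp
      then show ?thesis using f g by (auto simp: monomial_ideal_def)
    qed
    then show "f + g \<in> monomial_ideal s B"
      using f g carrier_add[of f s g] by (simp add: monomial_ideal_def)
  }
  {
    assume g: "g \<in> carrier (poly_ring s)"
    have "\<exists>b\<in>B. expo_le b a" if a: "a \<in> Poly_Mapping.keys (g * f)" for a
    proof -
      obtain x y where xy: "a = x + y" "y \<in> Poly_Mapping.keys f"
        using subsetD[OF Poly_Mapping.keys_mult a] by auto
      then obtain b where b: "b \<in> B" "expo_le b y" using f by (auto simp: monomial_ideal_def)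
      have "expo_le b (y + x)" by (rule expo_le_trans[OF b(2)]) simp
      then show ?thesis using b(1) xy(1) by (auto simp: add.commute)
    qed
    then show "g * f \<in> monomial_ideal s B"
      using f carrier_mult[OF g] by (simp add: monomial_ideal_def)
  }
qed (auto simp: monomial_ideal_def)

lemma mono_poly_mem_monomial_ideal:
  "(mono_poly a :: ('k::comm_ring_1) mpoly) \<in> monomial_ideal s B \<longleftrightarrow>
    a \<in> expos s \<and> (\<exists>b\<in>B. expo_le b a)"
  by (simp add: monomial_ideal_def mono_poly_def carrier_poly_ring)

text \<open>
  The set \<open>G\<close> may contain more than the monomials of \<open>B\<close>: the lemma is applied to leading monomials of
  an entire ideal and to the union of a monomial ideal with two monomials.
\<close>

lemma genideal_eq_monomial_ideal:
  fixes G :: "('k::comm_ring_1) mpoly set"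
  assumes B: "mono_poly ` B \<subseteq> G" and G: "G \<subseteq> monomial_ideal s B"
  shows "genideal (poly_ring s) G = monomial_ideal s B"
proof
  interpret S: cring "poly_ring s :: 'k mpoly ring" by simp
  show "genideal (poly_ring s) G \<subseteq> monomial_ideal s B"
    by (rule S.genideal_minimal[OF ideal_monomial_ideal G])
  have GC: "G \<subseteq> carrier (poly_ring s)" using G by (auto simp: monomial_ideal_def)
  have I: "ideal (genideal (poly_ring s) G) (poly_ring s)" by (rule S.genideal_ideal[OF GC])
  have BI: "mono_poly b \<in> genideal (poly_ring s) G" if "b \<in> B" for b
    using S.genideal_self[OF GC] B that by blast
  show "monomial_ideal s B \<subseteq> genideal (poly_ring s) G"
  proof
    fix f :: "'k mpoly" assume f: "f \<in> monomial_ideal s B"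
    have "(\<Sum>a\<in>Poly_Mapping.keys f. Poly_Mapping.single a (Poly_Mapping.lookup f a))
        \<in> genideal (poly_ring s) G"
    proof (rule poly_ideal_sum[OF I])
      fix a assume a: "a \<in> Poly_Mapping.keys f"
      then obtain b where b: "b \<in> B" "expo_le b a" using f by (auto simp: monomial_ideal_def)
      have aE: "a \<in> expos s" using f a by (auto simp: monomial_ideal_def carrier_poly_ring)
      have "Poly_Mapping.single a (Poly_Mapping.lookup f a) =
          Poly_Mapping.single (a - b) (Poly_Mapping.lookup f a) * mono_poly b"
        using expo_le_add_diff[OF b(2)] by (simp add: mono_poly_def mult_single add.commute)
      then show "Poly_Mapping.single a (Poly_Mapping.lookup f a) \<in> genideal (poly_ring s) G"
        using poly_ideal_mult[OF I BI[OF b(1)] carrier_single[OF expos_diff[OF aE]]] by simp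
    qed
    then show "f \<in> genideal (poly_ring s) G" by (simp add: sum_single_keys)
  qed
qed

lemma mono_poly_inject: "mono_poly a = (mono_poly b :: ('k::comm_ring_1) mpoly) \<longleftrightarrow> a = b"
proof
  assume "mono_poly a = (mono_poly b :: 'k mpoly)"
  then have "Poly_Mapping.keys (mono_poly a :: 'k mpoly) = Poly_Mapping.keys (mono_poly b :: 'k mpoly)"
    by simp
  then show "a = b" by (simp add: mono_poly_def)
qed simp

definition homog_component :: "nat \<Rightarrow> ('k::comm_ring_1) mpoly \<Rightarrow> 'k mpoly" where
  "homog_component e f = (\<Sum>a | a \<in> Poly_Mapping.keys f \<and> expo_deg a = e.
     Poly_Mapping.single a (Poly_Mapping.lookup f a))"

lemma lookup_homog_component:
  "Poly_Mapping.lookup (homog_component e f) a = (if expo_deg a = e then Poly_Mapping.lookup f a else 0)"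
  by (auto simp: homog_component_def lookup_sum lookup_single when_def in_keys_iff)

lemma keys_homog_component:
  "Poly_Mapping.keys (homog_component e f) = {a \<in> Poly_Mapping.keys f. expo_deg a = e}"
  by (auto simp: in_keys_iff lookup_homog_component split: if_splits)

lemma poly_eval_homog_component:
  "poly_eval (homog_component e f) x = coeff (line_eval x f) e"
proof -
  have "coeff (line_eval x f) e = (\<Sum>a\<in>Poly_Mapping.keys f.
      if expo_deg a = e then Poly_Mapping.lookup f a * mon_val x a else 0)"
    by (simp add: line_eval_def coeff_sum coeff_monom)
  also have "\<dots> = (\<Sum>a | a \<in> Poly_Mapping.keys f \<and> expo_deg a = e. Poly_Mapping.lookup f a * mon_val x a)"
    by (subst sum.inter_filter) auto
  finally show ?thesis by (simp add: homog_component_def poly_eval_sum)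
qed

lemma prime_prod:
  assumes P: "primeideal P (poly_ring s :: ('k::comm_ring_1) mpoly ring)"
    and B: "finite B" "\<And>b. b \<in> B \<Longrightarrow> f b \<in> carrier (poly_ring s)" "prod f B \<in> P"
  shows "\<exists>b\<in>B. f b \<in> P"
  using B
proof (induction B rule: finite_induct)
  case empty
  then have "P = carrier (poly_ring s)"
    using ideal.one_imp_carrier[OF primeideal.axioms(1)[OF P]] by simp
  then show ?case using primeideal.I_notcarr[OF P] by simp
next
  case (insert b B)
  have "prod f B \<in> carrier (poly_ring s)"
    using insert(1,4) by (induction B rule: finite_induct) (auto intro: carrier_mult)
  moreover have "f b * prod f B \<in> P" using insert by simp
  ultimately have "f b \<in> P \<or> prod f B \<in> P"
    using primeideal.I_prime[OF P, of "f b" "prod f B"] insert(4) by simp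
  then show ?case using insert by auto
qed

section \<open>The vanishing ideal and its initial ideal\<close>

context cartesian
begin

abbreviation "VI \<equiv> vanishing_ideal (n + 1) X"

definition powers :: "expo set" where
  "powers = (\<lambda>i. Poly_Mapping.single i (\<delta> i)) ` {1..n}"

lemma powers_le: "(\<exists>b\<in>powers. expo_le b m) \<longleftrightarrow> (\<exists>i\<in>{1..n}. \<delta> i \<le> Poly_Mapping.lookup m i)"
  by (auto simp: powers_def single_expo_le)

lemma proj_class_self: "x \<in> grid_points n A \<Longrightarrow> x \<in> proj_class (n + 1) x"
  unfolding proj_class_def
  by (auto simp: grid_points_def PiE_def extensional_restrict intro!: exI[of _ 1])

lemma vanishing_idealI:
  assumes f: "f \<in> homog_part (n + 1) e" "\<And>x. x \<in> grid_points n A \<Longrightarrow> poly_eval f x = 0"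
  shows "f \<in> VI"
proof -
  interpret S: cring "poly_ring (n + 1) :: 'k mpoly ring" by simp
  let ?G = "{f :: 'k mpoly. (\<exists>e. f \<in> homog_part (n + 1) e) \<and> (\<forall>p\<in>X. \<forall>x\<in>p. poly_eval f x = 0)}"
  have "poly_eval f y = 0" if x: "x \<in> grid_points n A" and y: "y \<in> proj_class (n + 1) x" for x y
  proof -
    obtain c where c: "y = restrict (\<lambda>i. c * x i) {1..n + 1}" using y by (auto simp: proj_class_def)
    have "poly_eval f y = poly_eval f (\<lambda>i. c * x i)"
      by (rule poly_eval_cong[of _ "n + 1"])
         (use homog_carrier[OF f(1)] c in \<open>auto simp: carrier_poly_ring\<close>)
    also have "\<dots> = 0"
      unfolding poly_eval_scale line_eval_homog[OF f(1)] by (simp add: f(2)[OF x])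
    finally show ?thesis .
  qed
  then have "f \<in> ?G" using f(1) by (auto simp: cartesian_points_image)
  moreover have "?G \<subseteq> carrier (poly_ring (n + 1))" using homog_carrier by blast
  ultimately show ?thesis unfolding vanishing_ideal_def using S.genideal_self by blast
qed

text \<open>
  Elements of the vanishing ideal need not be homogeneous. The vanishing of \<^const>\<open>line_eval\<close> expresses
  that each homogeneous component vanishes on \<open>X\<close>.
\<close>

lemma vanishing_idealD:
  assumes f: "f \<in> VI"
  shows "f \<in> carrier (poly_ring (n + 1))" "x \<in> grid_points n A \<Longrightarrow> line_eval x f = 0"
proof -
  interpret S: cring "poly_ring (n + 1) :: 'k mpoly ring" by simp
  let ?J = "{f \<in> carrier (poly_ring (n + 1)). \<forall>x\<in>grid_points n A. line_eval x f = 0}"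
  have "ideal ?J (poly_ring (n + 1))"
    by (rule poly_idealI) (auto simp: line_eval_add line_eval_mult intro: carrier_add carrier_mult)
  moreover have "{f :: 'k mpoly. (\<exists>e. f \<in> homog_part (n + 1) e) \<and> (\<forall>p\<in>X. \<forall>x\<in>p. poly_eval f x = 0)} \<subseteq> ?J"
  proof
    fix f :: "'k mpoly"
    assume "f \<in> {f. (\<exists>e. f \<in> homog_part (n + 1) e) \<and> (\<forall>p\<in>X. \<forall>x\<in>p. poly_eval f x = 0)}"
    then obtain e where e: "f \<in> homog_part (n + 1) e" "\<forall>p\<in>X. \<forall>x\<in>p. poly_eval f x = 0" by blast
    have "line_eval x f = 0" if x: "x \<in> grid_points n A" for x
    proof -
      have "proj_class (n + 1) x \<in> X" using x by (auto simp: cartesian_points_image)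
      then have "poly_eval f x = 0" using e(2) proj_class_self[OF x] by blast
      then show ?thesis using line_eval_homog[OF e(1)] by simp
    qed
    then show "f \<in> ?J" using homog_carrier[OF e(1)] by blast
  qed
  ultimately have "VI \<subseteq> ?J" unfolding vanishing_ideal_def by (rule S.genideal_minimal)
  then show "f \<in> carrier (poly_ring (n + 1))" "x \<in> grid_points n A \<Longrightarrow> line_eval x f = 0"
    using f by auto
qed

lemma ideal_VI: "ideal VI (poly_ring (n + 1))"
proof -
  interpret S: cring "poly_ring (n + 1) :: 'k mpoly ring" by simp
  show ?thesis
    unfolding vanishing_ideal_def by (rule S.genideal_ideal) (use homog_carrier in blast)
qed

lemma grid_form_VI:
  assumes i: "i \<in> {1..n}"
  shows "grid_form n i (A i) \<in> VI"
proof (rule vanishing_idealI)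
  show "grid_form n i (A i) \<in> homog_part (n + 1) (card (A i))"
    by (rule grid_form_homog) (use i in auto)
  show "poly_eval (grid_form n i (A i)) x = 0" if "x \<in> grid_points n A" for x
    by (rule grid_forms_vanish[OF _ that]) (use i in blast)
qed

text \<open>
  The powers are leading monomials of the forms that cut out the grid. Conversely the leading monomial
  of \<open>f \<in> I\<close> is that of a homogeneous component of \<open>f\<close>, which vanishes on \<open>X\<close> and thus has a leading
  monomial outside the box.
\<close>

lemma initial_ideal_VI: "initial_ideal (n + 1) lt VI = (monomial_ideal (n + 1) powers :: 'k mpoly set)"
  unfolding initial_ideal_def
proof (rule genideal_eq_monomial_ideal)
  let ?G = "{mono_poly (lead_expo lt f) :: 'k mpoly | f. f \<in> VI \<and> f \<noteq> 0}"
  show "mono_poly ` powers \<subseteq> ?G"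
  proof
    fix g :: "'k mpoly" assume "g \<in> mono_poly ` powers"
    then obtain i where i: "i \<in> {1..n}" "g = mono_poly (Poly_Mapping.single i (\<delta> i))"
      by (auto simp: powers_def)
    have "g = mono_poly (lead_expo lt (grid_form n i (A i)))"
      using i lead_grid_form(1)[OF i(1), of "A i"] card_A[OF i(1)] by simp
    then show "g \<in> ?G" using grid_form_VI[OF i(1)] lead_grid_form(2)[OF i(1)] by blast
  qed
  show "?G \<subseteq> monomial_ideal (n + 1) powers"
  proof
    fix g assume "g \<in> ?G"
    then obtain f where f: "f \<in> VI" "f \<noteq> 0" "g = mono_poly (lead_expo lt f)" by blast
    note fc = vanishing_idealD(1)[OF f(1)]
    let ?m = "lead_expo lt f"
    let ?h = "homog_component (expo_deg ?m) f"
    have mh: "?m \<in> Poly_Mapping.keys ?h"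
      using lead_expo_in[OF fc f(2)] by (simp add: keys_homog_component)
    have hh: "?h \<in> homog_part (n + 1) (expo_deg ?m)"
      using fc by (auto simp: homog_part_iff keys_homog_component carrier_poly_ring)
    have h0: "?h \<noteq> 0" using mh by auto
    have lead: "lead_expo lt ?h = ?m"
      by (rule lead_expo_eqI[OF homog_carrier[OF hh] mh])
         (auto simp: keys_homog_component intro: lead_expo_greatest[OF fc f(2)])
    have "\<exists>i\<in>{1..n}. \<delta> i \<le> Poly_Mapping.lookup (lead_expo lt ?h) i"
      by (rule vanishing_lead[OF hh h0])
         (simp add: poly_eval_homog_component vanishing_idealD(2)[OF f(1)])
    then show "g \<in> monomial_ideal (n + 1) powers"
      unfolding f(3) mono_poly_mem_monomial_ideal powers_le
      using lead lead_expo_expos[OF fc f(2)] by simp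
  qed
qed

section \<open>Degrees\<close>

lemma grid_points_nonempty: "\<exists>x. x \<in> grid_points n A"
proof -
  have "card (grid_points n A) = (\<Prod>i=1..n. \<delta> i)" by (simp only: card_grid card_box)
  also have "\<dots> \<noteq> 0" using two_le by fastforce
  finally show ?thesis by (metis card.empty all_not_in_conv)
qed

text \<open>
  A prime above \<open>I\<close> contains \<open>\<Prod>\<^bsub>c\<in>A i\<^esub> (t\<^sub>i - c t\<^sub>s)\<close> for every \<open>i\<close> and hence the ideal of a line through a
  point. The forms of large degree modulo \<open>I\<close> are the functions on the grid.
\<close>

lemma quot_degree_VI: "quot_degree (n + 1) VI = real (card (box n \<delta>))"
proof -
  obtain x0 where x0: "x0 \<in> grid_points n A" using grid_points_nonempty by blast
  have krull: "krull_dim (poly_ring (n + 1) Quot VI) = 1"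
  proof (rule krull_dim_one[where \<alpha> = x0])
    show "ideal VI (poly_ring (n + 1))" by (rule ideal_VI)
    show "x0 (n + 1) = 1" by (rule grid_points_last[OF x0])
    show "line_eval x0 f = 0" if "f \<in> VI" for f by (rule vanishing_idealD(2)[OF that x0])
    fix P assume P: "primeideal P (poly_ring (n + 1) :: 'k mpoly ring)" "VI \<subseteq> P"
    have "\<exists>c. lin_form n i c \<in> P" if i: "i \<in> {1..n}" for i
    proof -
      have i': "i \<in> {1..n + 1}" using i by auto
      have "(\<Prod>c\<in>A i. lin_form n i c) \<in> P" using grid_form_VI[OF i] P(2) by (auto simp: grid_form_def)
      then show ?thesis
        using prime_prod[OF P(1), of "A i" "lin_form n i"] homog_carrier[OF lin_form_homog[OF i']] by auto
    qed
    then obtain c where "\<forall>i\<in>{1..n}. lin_form n i (c i) \<in> P" by metis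
    then show "\<exists>\<alpha>. \<alpha> (n + 1) = 1 \<and> (\<forall>i\<in>{1..n}. lin_form n i (\<alpha> i) \<in> P)"
      by (intro exI[of _ "c(n + 1 := 1)"]) auto
  qed
  have sumA: "(\<Sum>i=1..n. card (A i)) = (\<Sum>i=1..n. \<delta> i)" by (rule sum.cong) (auto simp: card_A)
  have "quot_dim (n + 1) VI (homog_part (n + 1) e) = card (grid_points n A)"
    if e: "(\<Sum>i=1..n. \<delta> i) \<le> e" for e
  proof (rule quot_dim_eq_card[where \<phi> = poly_eval])
    show "ideal VI (poly_ring (n + 1))" by (rule ideal_VI)
    show "1 \<notin> VI" using vanishing_idealD(2)[OF _ x0, of 1] by auto
    show "homog_part (n + 1) e \<subseteq> (carrier (poly_ring (n + 1)) :: 'k mpoly set)"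
      using homog_carrier by blast
    show "\<exists>f\<in>homog_part (n + 1) e. \<forall>t\<in>grid_points n A. poly_eval f t = v t" for v
      by (rule interpolation) (use e sumA in simp)
    fix f :: "'k mpoly" assume f: "f \<in> homog_part (n + 1) e"
    show "f \<in> VI \<longleftrightarrow> (\<forall>t\<in>grid_points n A. poly_eval f t = 0)"
      using vanishing_idealI[OF f] vanishing_idealD(2)[of f] by (auto simp: poly_eval_line)
  qed (auto simp: poly_eval_add poly_eval_mult intro: homog_add homog_const_mult)
  then show ?thesis
    using quot_degree_eq[OF krull] card_grid by auto
qed

text \<open>
  The monomial is not a power of the last variable.
\<close>

definition impure :: "expo \<Rightarrow> bool" where
  "impure a \<longleftrightarrow> (\<exists>i\<in>{1..n}. Poly_Mapping.lookup a i \<noteq> 0)"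

text \<open>
  Primes above this ideal contain \<open>t\<^sub>1,\<dots>,t\<^sub>n\<close>, the ideal of the line through \<open>(0,\<dots>,0,1)\<close>. The ideal
  itself vanishes on that line because \<open>a\<close> and \<open>b\<close> are impure; with a power of \<open>t\<^sub>s\<close> among the
  generators the dimension would drop to zero.
\<close>

lemma quot_degree_monomials:
  assumes a: "a \<in> std_expos d" "impure a" and b: "b \<in> std_expos d" "impure b"
  shows "quot_degree (n + 1) (monomial_ideal (n + 1) (powers \<union> {a, b}) :: 'k mpoly set) =
    real (card (box n \<delta> - (shadow a \<union> shadow b)))"
proof -
  let ?B = "powers \<union> {a, b}"
  let ?J = "monomial_ideal (n + 1) ?B :: 'k mpoly set"
  let ?\<alpha> = "\<lambda>i. if i = n + 1 then 1 else (0 :: 'k)"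
  have ab: "a \<in> expos (n + 1)" "expo_deg a \<le> d" "b \<in> expos (n + 1)" "expo_deg b \<le> d"
    using a b by (auto simp: std_expos_def deg_expos_def)
  have B_pos: "\<exists>i\<in>{1..n}. Poly_Mapping.lookup m i \<noteq> 0" if "c \<in> ?B" "expo_le c m" for c m
  proof -
    have "\<exists>i\<in>{1..n}. Poly_Mapping.lookup c i \<noteq> 0"
    proof (cases "c \<in> powers")
      case True
      then obtain i where i: "i \<in> {1..n}" "c = Poly_Mapping.single i (\<delta> i)"
        by (auto simp: powers_def)
      then show ?thesis using two_le[OF i(1)] by (intro bexI[OF _ i(1)]) simp
    next
      case False
      then show ?thesis using that(1) a(2) b(2) by (auto simp: impure_def)
    qed
    then show ?thesis using that(2) by (metis expo_le_def le_zero_eq)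
  qed
  have zero: "line_eval ?\<alpha> f = 0" if f: "f \<in> ?J" for f
  proof -
    have "mon_val ?\<alpha> m = 0" if m: "m \<in> Poly_Mapping.keys f" for m
    proof -
      have mE: "m \<in> expos (n + 1)" using f m by (auto simp: monomial_ideal_def carrier_poly_ring)
      obtain i where i: "i \<in> {1..n}" "Poly_Mapping.lookup m i \<noteq> 0"
      proof -
        have "\<exists>c\<in>?B. expo_le c m" using f m unfolding monomial_ideal_def mem_Collect_eq by blast
        then show ?thesis using B_pos that by blast
      qed
      show ?thesis
        unfolding mon_val_expos[OF mE] by (rule prod_zero) (use i in \<open>auto intro!: bexI[of _ i]\<close>)
    qed
    then show ?thesis by (simp add: line_eval_def)
  qed
  have J: "ideal ?J (poly_ring (n + 1))" by (rule ideal_monomial_ideal)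
  have krull: "krull_dim (poly_ring (n + 1) Quot ?J) = 1"
  proof (rule krull_dim_one[where \<alpha> = ?\<alpha>, OF J])
    show "line_eval ?\<alpha> f = 0" if "f \<in> ?J" for f by (rule zero[OF that])
    fix P assume P: "primeideal P (poly_ring (n + 1) :: 'k mpoly ring)" "?J \<subseteq> P"
    have "lin_form n i (?\<alpha> i) \<in> P" if i: "i \<in> {1..n}" for i
    proof -
      have "mono_poly (Poly_Mapping.single i (\<delta> i)) \<in> ?J"
        unfolding mono_poly_mem_monomial_ideal using i by (force simp: powers_def expos_def)
      moreover have "(\<Prod>j<k. Poly_Mapping.single (var_expo i) (1 :: 'k)) = mono_poly (Poly_Mapping.single i k)" for k
        by (induction k) (simp_all add: mono_poly_def mult_single var_expo_def single_add[symmetric])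
      ultimately have "(\<Prod>j<\<delta> i. Poly_Mapping.single (var_expo i) (1 :: 'k)) \<in> P" using P(2) by auto
      then have "Poly_Mapping.single (var_expo i) (1 :: 'k) \<in> P"
        using prime_prod[OF P(1), of "{..<\<delta> i}" "\<lambda>_. Poly_Mapping.single (var_expo i) 1"] i
          carrier_single[OF var_expo_expos, of i "n + 1"] by auto
      then show ?thesis using i by (simp add: lin_form_def)
    qed
    then show "\<exists>\<alpha>. \<alpha> (n + 1) = 1 \<and> (\<forall>i\<in>{1..n}. lin_form n i (\<alpha> i) \<in> P)"
      by (intro exI[of _ ?\<alpha>]) auto
  qed simp
  have "quot_dim (n + 1) ?J (homog_part (n + 1) e) = card (box n \<delta> - (shadow a \<union> shadow b))"
    if e: "(\<Sum>i=1..n. \<delta> i) + d \<le> e" for e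
  proof -
    let ?T = "{m \<in> deg_expos (n + 1) e. \<not> (\<exists>c\<in>?B. expo_le c m)}"
    have "quot_dim (n + 1) ?J (homog_part (n + 1) e) = card ?T"
    proof (rule quot_dim_eq_card[where \<phi> = Poly_Mapping.lookup, OF J])
      show "1 \<notin> ?J" using zero[of 1] by auto
      show "homog_part (n + 1) e \<subseteq> (carrier (poly_ring (n + 1)) :: 'k mpoly set)"
        using homog_carrier by blast
      show "\<exists>f\<in>homog_part (n + 1) e. \<forall>t\<in>?T. Poly_Mapping.lookup f t = v t" for v :: "expo \<Rightarrow> 'k"
      proof (intro bexI[of _ "\<Sum>m\<in>?T. Poly_Mapping.single m (v m)"] ballI)
        show "(\<Sum>m\<in>?T. Poly_Mapping.single m (v m)) \<in> homog_part (n + 1) e"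
          by (intro homog_sum homog_single) (auto simp: deg_expos_def)
        show "Poly_Mapping.lookup (\<Sum>m\<in>?T. Poly_Mapping.single m (v m)) t = v t" if "t \<in> ?T" for t
          using that by (simp add: lookup_sum lookup_single when_def)
      qed
      fix f :: "'k mpoly" assume f: "f \<in> homog_part (n + 1) e"
      show "f \<in> ?J \<longleftrightarrow> (\<forall>t\<in>?T. Poly_Mapping.lookup f t = 0)"
        unfolding monomial_ideal_def using f homog_carrier[OF f] by (auto simp: homog_part_deg in_keys_iff subset_iff)
    qed (auto simp: lookup_add intro: homog_add homog_const_mult)
    also have "?T = {m \<in> deg_expos (n + 1) e. restrict (Poly_Mapping.lookup m) {1..n} \<in>
        - (shadow a \<union> shadow b) \<inter> box n \<delta>}"
    proof -
      have "\<not> (\<exists>c\<in>?B. expo_le c m) \<longleftrightarrow> restrict (Poly_Mapping.lookup m) {1..n} \<in>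
        - (shadow a \<union> shadow b) \<inter> box n \<delta>" if m: "m \<in> deg_expos (n + 1) e" for m
      proof -
        let ?r = "restrict (Poly_Mapping.lookup m) {1..n}"
        have box: "?r \<in> box n \<delta> \<longleftrightarrow> \<not> (\<exists>c\<in>powers. expo_le c m)"
          unfolding powers_le by (auto simp: box_def not_le)
        have sh: "?r \<in> shadow c \<longleftrightarrow> expo_le c m" if r: "?r \<in> box n \<delta>" and c: "c \<in> {a, b}" for c
          using grid_expo_divides[OF m r, of c d] c ab e r by (auto simp: upper_box_def)
        show ?thesis
        proof (cases "?r \<in> box n \<delta>")
          case True
          then show ?thesis using box sh[OF True, of a] sh[OF True, of b] by blast
        next
          case False
          then show ?thesis using box by blast
        qed
      qed
      then show ?thesis by blast
    qed
    also have "card \<dots> = card (- (shadow a \<union> shadow b) \<inter> box n \<delta>)"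
      by (rule card_grid_expos) (use e in simp)
    also have "- (shadow a \<union> shadow b) \<inter> box n \<delta> = box n \<delta> - (shadow a \<union> shadow b)" by blast
    finally show ?thesis .
  qed
  then show ?thesis using quot_degree_eq[OF krull] by blast
qed

section \<open>The footprint\<close>

lemma std_monomials_VI: "std_monomials (n + 1) lt VI d = (mono_poly ` std_expos d :: 'k mpoly set)"
proof -
  have "(mono_poly a :: 'k mpoly) \<notin> monomial_ideal (n + 1) powers \<longleftrightarrow>
      (\<forall>i\<in>{1..n}. Poly_Mapping.lookup a i < \<delta> i)" if "a \<in> expos (n + 1)" for a
    unfolding mono_poly_mem_monomial_ideal powers_le using that by (auto simp: not_le)
  then show ?thesis
    unfolding std_monomials_def initial_ideal_VI std_expos_def deg_expos_def by blast
qed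

text \<open>
  The last variable is regular modulo the initial ideal, so a pure monomial leaves nothing new in the
  colon ideal. If both monomials are impure, then \<open>t\<^sub>1\<^bsup>\<delta>\<^sub>1-1\<^esup>\<cdots>t\<^sub>n\<^bsup>\<delta>\<^sub>n-1\<^esup>\<close> is multiplied by each of
  them into the initial ideal.
\<close>

lemma colon_iff:
  assumes a: "a \<in> std_expos d" and b: "b \<in> std_expos d"
  shows "colon_ideal (n + 1) (monomial_ideal (n + 1) powers) {mono_poly a, mono_poly b :: 'k mpoly}
    \<noteq> monomial_ideal (n + 1) powers \<longleftrightarrow> impure a \<and> impure b"
proof -
  let ?J = "monomial_ideal (n + 1) powers :: 'k mpoly set"
  let ?C = "colon_ideal (n + 1) ?J {mono_poly a, mono_poly b}"
  have J: "ideal ?J (poly_ring (n + 1))" by (rule ideal_monomial_ideal)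
  have monoC: "mono_poly c \<in> carrier (poly_ring (n + 1))" if "c \<in> std_expos d" for c
    unfolding mono_poly_def by (rule carrier_single) (use that in \<open>auto simp: std_expos_def deg_expos_def\<close>)
  have JC: "?J \<subseteq> ?C"
  proof
    fix f assume f: "f \<in> ?J"
    have "f * mono_poly c \<in> ?J" if "c \<in> std_expos d" for c
      using poly_ideal_mult[OF J f monoC[OF that]] by (simp add: mult.commute)
    then show "f \<in> ?C" using poly_ideal_carrier[OF J f] a b by (simp add: colon_ideal_def)
  qed
  have pure: "g \<in> ?J" if c: "\<not> impure c" and g: "g \<in> carrier (poly_ring (n + 1))" "g * mono_poly c \<in> ?J" for c g
  proof -
    have "\<exists>b\<in>powers. expo_le b m" if m: "m \<in> Poly_Mapping.keys g" for m
    proof -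
      have "c + m \<in> Poly_Mapping.keys (mono_poly c * g)"
        using m by (simp add: mono_poly_def in_keys_iff lookup_single_mult_add)
      then have "\<exists>b\<in>powers. expo_le b (c + m)"
        using g(2) by (simp add: monomial_ideal_def mult.commute)
      then show ?thesis
        using c unfolding powers_le by (auto simp: impure_def lookup_add)
    qed
    then show ?thesis using g(1) by (simp add: monomial_ideal_def)
  qed
  show ?thesis
  proof
    assume ne: "?C \<noteq> ?J"
    show "impure a \<and> impure b"
    proof (rule ccontr)
      assume "\<not> (impure a \<and> impure b)"
      then have "?C \<subseteq> ?J" using pure by (auto simp: colon_ideal_def)
      then show False using ne JC by blast
    qed
  next
    assume imp: "impure a \<and> impure b"
    \<comment> \<open>the socle element: the largest exponent of the box\<close>
    define w where "w = expo_of (n + 1) (\<lambda>i. if i \<le> n then \<delta> i - 1 else 0)"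
    have wE: "w \<in> expos (n + 1)" by (simp add: w_def)
    have wi: "Poly_Mapping.lookup w i = \<delta> i - 1" if "i \<in> {1..n}" for i
      using that by (simp add: w_def lookup_expo_of)
    have "(mono_poly w :: 'k mpoly) * mono_poly c \<in> ?J" if c: "c \<in> std_expos d" "impure c" for c
    proof -
      obtain i where i: "i \<in> {1..n}" "Poly_Mapping.lookup c i \<noteq> 0" using c(2) by (auto simp: impure_def)
      have "\<delta> i \<le> Poly_Mapping.lookup (w + c) i" using i wi[OF i(1)] by (simp add: lookup_add)
      moreover have "w + c \<in> expos (n + 1)"
        using c wE by (auto simp: std_expos_def deg_expos_def intro: expos_add)
      ultimately have "(mono_poly (w + c) :: 'k mpoly) \<in> ?J"
        unfolding mono_poly_mem_monomial_ideal powers_le using i(1) by blast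
      then show ?thesis by (simp add: mono_poly_def mult_single)
    qed
    then have "mono_poly w \<in> ?C"
      using a b imp carrier_single[OF wE] by (auto simp: colon_ideal_def mono_poly_def)
    moreover have "mono_poly w \<notin> ?J"
      unfolding mono_poly_mem_monomial_ideal powers_le using wi two_le by fastforce
    ultimately show "?C \<noteq> ?J" by blast
  qed
qed

definition impure_pairs :: "nat \<Rightarrow> (expo \<times> expo) set" where
  "impure_pairs d = {(a, b). a \<in> std_expos d \<and> b \<in> std_expos d \<and> a \<noteq> b \<and> impure a \<and> impure b}"

lemma footprint_sets_VI:
  "footprint_sets (n + 1) lt VI d 2 =
    ((\<lambda>(a, b). {mono_poly a, mono_poly b}) ` impure_pairs d :: 'k mpoly set set)"
proof
  show "footprint_sets (n + 1) lt VI d 2 \<subseteq>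
      ((\<lambda>(a, b). {mono_poly a, mono_poly b}) ` impure_pairs d :: 'k mpoly set set)"
  proof
    fix M :: "'k mpoly set" assume "M \<in> footprint_sets (n + 1) lt VI d 2"
    then have M: "M \<subseteq> mono_poly ` std_expos d" "card M = 2"
      "colon_ideal (n + 1) (monomial_ideal (n + 1) powers) M \<noteq> monomial_ideal (n + 1) powers"
      unfolding footprint_sets_def std_monomials_VI initial_ideal_VI by auto
    obtain f g where fg: "M = {f, g}" "f \<noteq> g" using M(2) by (auto simp: card_2_iff)
    obtain a where a: "a \<in> std_expos d" "f = mono_poly a" using M(1) fg by auto
    obtain b where b: "b \<in> std_expos d" "g = mono_poly b" using M(1) fg by auto
    have "impure a \<and> impure b" using M(3) colon_iff[OF a(1) b(1)] fg a b by simp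
    then have "(a, b) \<in> impure_pairs d" using a b fg by (auto simp: impure_pairs_def)
    then show "M \<in> (\<lambda>(a, b). {mono_poly a, mono_poly b}) ` impure_pairs d"
      using fg(1) a(2) b(2) by (intro image_eqI[of _ _ "(a, b)"]) auto
  qed
  show "((\<lambda>(a, b). {mono_poly a, mono_poly b}) ` impure_pairs d :: 'k mpoly set set) \<subseteq>
      footprint_sets (n + 1) lt VI d 2"
  proof
    fix M :: "'k mpoly set" assume "M \<in> (\<lambda>(a, b). {mono_poly a, mono_poly b}) ` impure_pairs d"
    then obtain a b where ab: "a \<in> std_expos d" "b \<in> std_expos d" "a \<noteq> b" "impure a" "impure b"
      "M = {mono_poly a, mono_poly b}" by (auto simp: impure_pairs_def)
    have "card M = 2" using ab(3,6) by (simp add: mono_poly_inject)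
    then show "M \<in> footprint_sets (n + 1) lt VI d 2"
      unfolding footprint_sets_def std_monomials_VI initial_ideal_VI mem_Collect_eq
      using ab colon_iff[OF ab(1,2)] by simp
  qed
qed

lemma quot_degree_footprint:
  assumes "(a, b) \<in> impure_pairs d"
  shows "quot_degree (n + 1) (genideal (poly_ring (n + 1))
      (initial_ideal (n + 1) lt VI \<union> {mono_poly a, mono_poly b :: 'k mpoly})) =
    real (card (box n \<delta>)) - real (card (shadow a \<union> shadow b))"
proof -
  have ab: "a \<in> std_expos d" "b \<in> std_expos d" "impure a" "impure b"
    using assms by (auto simp: impure_pairs_def)
  have abE: "a \<in> expos (n + 1)" "b \<in> expos (n + 1)" using ab by (auto simp: std_expos_def deg_expos_def)
  let ?B = "powers \<union> {a, b}"
  have powE: "powers \<subseteq> expos (n + 1)" by (auto simp: powers_def expos_def split: if_splits)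
  have "genideal (poly_ring (n + 1)) (monomial_ideal (n + 1) powers \<union> {mono_poly a, mono_poly b :: 'k mpoly}) =
      monomial_ideal (n + 1) ?B"
  proof (rule genideal_eq_monomial_ideal)
    have "(mono_poly c :: 'k mpoly) \<in> monomial_ideal (n + 1) powers" if "c \<in> powers" for c
      unfolding mono_poly_mem_monomial_ideal using that powE by (auto intro: bexI[of _ c])
    then show "mono_poly ` ?B \<subseteq> monomial_ideal (n + 1) powers \<union> {mono_poly a, mono_poly b :: 'k mpoly}"
      by auto
    have "(mono_poly c :: 'k mpoly) \<in> monomial_ideal (n + 1) ?B" if "c \<in> {a, b}" for c
      unfolding mono_poly_mem_monomial_ideal using that abE by (auto intro: bexI[of _ c])
    moreover have "monomial_ideal (n + 1) powers \<subseteq> (monomial_ideal (n + 1) ?B :: 'k mpoly set)"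
      unfolding monomial_ideal_def by blast
    ultimately show "monomial_ideal (n + 1) powers \<union> {mono_poly a, mono_poly b :: 'k mpoly} \<subseteq>
        monomial_ideal (n + 1) ?B" by blast
  qed
  then have "quot_degree (n + 1) (genideal (poly_ring (n + 1))
      (initial_ideal (n + 1) lt VI \<union> {mono_poly a, mono_poly b :: 'k mpoly})) =
    real (card (box n \<delta> - (shadow a \<union> shadow b)))"
    unfolding initial_ideal_VI using quot_degree_monomials[OF ab(1,3,2,4)] by simp
  also have "card (box n \<delta> - (shadow a \<union> shadow b)) = card (box n \<delta>) - card (shadow a \<union> shadow b)"
    by (rule card_Diff_subset) (use upper_box_subset[of n \<delta>] in auto)
  also have "real \<dots> = real (card (box n \<delta>)) - real (card (shadow a \<union> shadow b))"
    using upper_box_subset[of n \<delta>] by (intro of_nat_diff card_mono) auto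
  finally show ?thesis .
qed

definition impure_sizes :: "nat \<Rightarrow> nat set" where
  "impure_sizes d = (\<lambda>(a, b). card (shadow a \<union> shadow b)) ` impure_pairs d"

lemma finite_impure_pairs [simp]: "finite (impure_pairs d)"
  by (rule finite_subset[of _ "std_expos d \<times> std_expos d"]) (auto simp: impure_pairs_def)

lemma finite_impure_sizes [simp]: "finite (impure_sizes d)"
  by (simp add: impure_sizes_def)

text \<open>
  Maximising the degree after adding two monomials means minimising the union of their shadows.
\<close>

lemma gen_footprint_eq:
  "gen_footprint (n + 1) lt VI d 2 =
    (if impure_sizes d = {} then real (card (box n \<delta>)) else real (Min (impure_sizes d)))"
proof (cases "impure_pairs d = {}")
  case True
  then show ?thesis by (simp add: gen_footprint_def footprint_sets_VI[simplified] quot_degree_VI[simplified] impure_sizes_def)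
next
  case False
  let ?N = "real (card (box n \<delta>))"
  let ?deg = "\<lambda>M. quot_degree (n + 1) (genideal (poly_ring (n + 1)) (initial_ideal (n + 1) lt VI \<union> M))"
  have ne: "impure_sizes d \<noteq> {}" using False by (simp add: impure_sizes_def)
  have "?deg ` footprint_sets (n + 1) lt VI d 2 = (\<lambda>k. ?N - real k) ` impure_sizes d"
  proof -
    have "?deg (case p of (a, b) \<Rightarrow> {mono_poly a, mono_poly b}) =
        ?N - real (case p of (a, b) \<Rightarrow> card (shadow a \<union> shadow b))" if "p \<in> impure_pairs d" for p
      using quot_degree_footprint[of "fst p" "snd p" d] that by (simp add: case_prod_beta)
    then show ?thesis unfolding footprint_sets_VI impure_sizes_def image_image by (rule image_cong[OF refl])
  qed
  moreover have "Max ((\<lambda>k. ?N - real k) ` impure_sizes d) = ?N - real (Min (impure_sizes d))"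
    using ne by (intro Max_eqI) auto
  moreover have "footprint_sets (n + 1) lt VI d 2 \<noteq> {}"
    unfolding footprint_sets_VI using False by simp
  ultimately show ?thesis
    using ne unfolding gen_footprint_def quot_degree_VI by simp
qed

text \<open>
  The shadow of a pure exponent is the whole box. Hence pure exponents influence the minimum only if
  there is no impure pair.
\<close>

lemma Min_pair_sizes:
  assumes "1 \<le> d"
  shows "Min (pair_sizes d) = (if impure_sizes d = {} then card (box n \<delta>) else Min (impure_sizes d))"
proof -
  note ne = gen_hamming_weight_eq(2)[OF assms]
  have full: "card (shadow a \<union> shadow b) = card (box n \<delta>)" if "\<not> (impure a \<and> impure b)" for a b
  proof -
    have "shadow c = box n \<delta>" if "\<not> impure c" for c
      using that by (auto simp: upper_box_def impure_def)
    then have "shadow a \<union> shadow b = box n \<delta>" using that upper_box_subset[of n \<delta>] by blast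
    then show ?thesis by simp
  qed
  have le: "card (shadow a \<union> shadow b) \<le> card (box n \<delta>)" for a b
    using upper_box_subset[of n \<delta>] by (intro card_mono) auto
  have cases: "k = card (box n \<delta>) \<or> k \<in> impure_sizes d" if k: "k \<in> pair_sizes d" for k
  proof -
    from k obtain a b where ab: "a \<in> std_expos d" "b \<in> std_expos d" "a \<noteq> b"
      "k = card (shadow a \<union> shadow b)" by (auto simp: pair_sizes_def)
    show ?thesis
    proof (cases "impure a \<and> impure b")
      case True
      then have "(a, b) \<in> impure_pairs d" using ab by (simp add: impure_pairs_def)
      then show ?thesis using ab(4) by (auto simp: impure_sizes_def)
    qed (use full ab(4) in simp)
  qed
  have sub: "impure_sizes d \<subseteq> pair_sizes d"
    by (auto simp: impure_sizes_def impure_pairs_def pair_sizes_def)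
  show ?thesis
  proof (cases "impure_sizes d = {}")
    case True
    then have "Min (pair_sizes d) = card (box n \<delta>)" using cases Min_in[OF finite_pair_sizes ne] by auto
    then show ?thesis using True by simp
  next
    case False
    have "Min (pair_sizes d) = Min (impure_sizes d)"
    proof (rule Min_eqI)
      show "Min (impure_sizes d) \<in> pair_sizes d" using sub Min_in[OF finite_impure_sizes False] by blast
      fix k assume "k \<in> pair_sizes d"
      then consider "k = card (box n \<delta>)" | "k \<in> impure_sizes d" using cases by blast
      then show "Min (impure_sizes d) \<le> k"
      proof cases
        case 1
        have "Min (impure_sizes d) \<in> impure_sizes d" by (rule Min_in[OF finite_impure_sizes False])
        then show ?thesis using le 1 by (auto simp: impure_sizes_def)
      qed simp
    qed simp
    then show ?thesis using False by simp
  qed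
qed

lemma P_val_cong:
  assumes "\<And>i. i \<in> {1..n} \<Longrightarrow> a i = a' i" "\<And>i. i \<in> {1..n} \<Longrightarrow> b i = b' i"
  shows "P_val n \<delta> a b = P_val n \<delta> a' b'"
  unfolding P_val_def by (intro arg_cong2[of _ _ _ _ "(+)"] arg_cong2[of _ _ _ _ "(-)"] prod.cong) (auto simp: assms)

text \<open>
  Restriction of exponents to \<open>{1..n + 1}\<close> translates impure pairs of standard exponents into the
  index set of the combinatorial minimum.
\<close>

lemma P_val_pairs: "(\<lambda>(a, b). P_val n \<delta> a b) ` pairs_P n \<delta> d = int ` impure_sizes d"
proof -
  have size: "int (card (shadow a \<union> shadow b)) = P_val n \<delta> (Poly_Mapping.lookup a) (Poly_Mapping.lookup b)"
    if "a \<in> std_expos d" "b \<in> std_expos d" for a b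
    by (rule card_upper_box_Un) (use that in \<open>auto simp: std_expos_def less_imp_le\<close>)
  show ?thesis
  proof
    show "(\<lambda>(a, b). P_val n \<delta> a b) ` pairs_P n \<delta> d \<subseteq> int ` impure_sizes d"
    proof
      fix v assume "v \<in> (\<lambda>(a, b). P_val n \<delta> a b) ` pairs_P n \<delta> d"
      then obtain p where p: "p \<in> pairs_P n \<delta> d" "v = (\<lambda>(a, b). P_val n \<delta> a b) p" by blast
      obtain a b where pab: "p = (a, b)" by (cases p)
      have v: "v = P_val n \<delta> a b" using p(2) pab by simp
      from p(1) have ext: "a \<in> {1..n + 1} \<rightarrow>\<^sub>E UNIV" "b \<in> {1..n + 1} \<rightarrow>\<^sub>E UNIV" and ab: "a \<noteq> b" and
        deg: "d = (\<Sum>i=1..n + 1. a i)" "d = (\<Sum>i=1..n + 1. b i)" and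
        bound: "\<forall>i\<in>{1..n}. int (a i) \<le> int (\<delta> i) - 1 \<and> int (b i) \<le> int (\<delta> i) - 1" and
        imp: "\<exists>i\<in>{1..n}. a i \<noteq> 0" "\<exists>i\<in>{1..n}. b i \<noteq> 0"
        unfolding pab pairs_P_def mem_Collect_eq prod.case by blast+
      let ?e = "expo_of (n + 1)"
      have l: "Poly_Mapping.lookup (?e c) i = c i" if "i \<in> {1..n}" for c i
        using that by (simp add: lookup_expo_of)
      have std: "?e a \<in> std_expos d" "?e b \<in> std_expos d"
        unfolding std_expos_def deg_expos_def mem_Collect_eq expo_deg_expo_of deg[symmetric]
        using bound l by force+
      have "?e a \<noteq> ?e b"
      proof
        assume eq: "?e a = ?e b"
        have "a = b"
        proof (rule PiE_ext[OF ext])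
          fix i assume i: "i \<in> {1..n + 1}"
          have "Poly_Mapping.lookup (?e a) i = Poly_Mapping.lookup (?e b) i" by (simp only: eq)
          then show "a i = b i" using i by (simp add: lookup_expo_of)
        qed
        then show False using ab by simp
      qed
      moreover have "impure (?e a)" "impure (?e b)" using imp l by (auto simp: impure_def)
      ultimately have "(?e a, ?e b) \<in> impure_pairs d" using std by (simp add: impure_pairs_def)
      then have "card (shadow (?e a) \<union> shadow (?e b)) \<in> impure_sizes d"
        unfolding impure_sizes_def by (rule rev_image_eqI) simp
      moreover have "v = int (card (shadow (?e a) \<union> shadow (?e b)))"
        unfolding size[OF std] v by (rule P_val_cong) (simp_all only: l)
      ultimately show "v \<in> int ` impure_sizes d" by blast
    qed
    show "int ` impure_sizes d \<subseteq> (\<lambda>(a, b). P_val n \<delta> a b) ` pairs_P n \<delta> d"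
    proof
      fix v assume "v \<in> int ` impure_sizes d"
      then obtain a b where ab: "a \<in> std_expos d" "b \<in> std_expos d" "a \<noteq> b" "impure a" "impure b"
        and v: "v = int (card (shadow a \<union> shadow b))"
        by (auto simp: impure_sizes_def impure_pairs_def)
      let ?r = "\<lambda>m :: expo. restrict (Poly_Mapping.lookup m) {1..n + 1}"
      have E: "a \<in> expos (n + 1)" "b \<in> expos (n + 1)" "expo_deg a = d" "expo_deg b = d"
        using ab by (auto simp: std_expos_def deg_expos_def)
      have "?r a \<noteq> ?r b"
      proof
        assume eq: "?r a = ?r b"
        have "a = b"
        proof (rule expo_eqI[OF E(1,2)])
          fix i assume "i \<in> {1..n + 1}"
          then show "Poly_Mapping.lookup a i = Poly_Mapping.lookup b i" using fun_cong[OF eq, of i] by simp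
        qed
        then show False using ab(3) by simp
      qed
      moreover have "?r a \<in> {1..n + 1} \<rightarrow>\<^sub>E UNIV" "?r b \<in> {1..n + 1} \<rightarrow>\<^sub>E UNIV"
        by (simp_all add: restrict_PiE_iff)
      moreover have "d = (\<Sum>i=1..n + 1. ?r a i)" "d = (\<Sum>i=1..n + 1. ?r b i)"
        using expo_deg_expos[OF E(1)] expo_deg_expos[OF E(2)] E(3,4) by simp_all
      moreover have "\<forall>i\<in>{1..n}. int (?r a i) \<le> int (\<delta> i) - 1 \<and> int (?r b i) \<le> int (\<delta> i) - 1"
        using ab(1,2) by (auto simp: std_expos_def)
      moreover have "\<exists>i\<in>{1..n}. ?r a i \<noteq> 0" "\<exists>i\<in>{1..n}. ?r b i \<noteq> 0"
        using ab(4,5) by (auto simp: impure_def)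
      ultimately have mem: "(?r a, ?r b) \<in> pairs_P n \<delta> d"
        unfolding pairs_P_def mem_Collect_eq prod.case by (intro conjI)
      have "v = P_val n \<delta> (?r a) (?r b)"
        unfolding v size[OF ab(1,2)] by (rule P_val_cong) auto
      then show "v \<in> (\<lambda>(a, b). P_val n \<delta> a b) ` pairs_P n \<delta> d"
        by (intro image_eqI[OF _ mem]) (simp only: prod.case)
    qed
  qed
qed

end

theorem theorem9p5:
  fixes n d :: nat
    and A :: "nat \<Rightarrow> 'k::{field,finite} set"
    and \<delta> :: "nat \<Rightarrow> nat"
    and X :: "(nat \<Rightarrow> 'k) set set"
    and lt :: "expo \<Rightarrow> expo \<Rightarrow> bool"
  assumes "n \<ge> 1" and "d \<ge> 1"
    and "monomial_order (n + 1) lt"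
    and "\<forall>i\<in>{1..n}. lt (var_expo (n + 1)) (var_expo i)"
    and "\<forall>i\<in>{1..n}. \<delta> i = card (A i)"
    and "2 \<le> \<delta> 1" and "mono_on {1..n} \<delta>"
    and "X = cartesian_points n A"
    and "int d \<le> (\<Sum>i=1..n. int (\<delta> i) - 1)"
  shows "gen_footprint (n + 1) lt (vanishing_ideal (n + 1) X) d 2
           = real (gen_hamming_weight (n + 1) X d 2) \<and>
         (pairs_P n \<delta> d \<noteq> {} \<longrightarrow>
           int (gen_hamming_weight (n + 1) X d 2)
             = Min ((\<lambda>(a, b). P_val n \<delta> a b) ` pairs_P n \<delta> d))"
proof -
  have two: "2 \<le> \<delta> i" if "i \<in> {1..n}" for i
    using mono_onD[OF assms(7), of 1 i] that assms(1,6) by auto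
  interpret cartesian n lt A \<delta>
    by unfold_locales (use assms two in auto)
  have W: "gen_hamming_weight (n + 1) (cartesian_points n A) d 2 =
      (if impure_sizes d = {} then card (box n \<delta>) else Min (impure_sizes d))"
    unfolding gen_hamming_weight_eq(1)[OF assms(2)] by (rule Min_pair_sizes[OF assms(2)])
  have "int (Min (impure_sizes d)) = Min (int ` impure_sizes d)" if "impure_sizes d \<noteq> {}"
    by (rule mono_Min_commute) (use that in \<open>auto simp: mono_def\<close>)
  moreover have "pairs_P n \<delta> d \<noteq> {} \<longrightarrow> impure_sizes d \<noteq> {}"
    using P_val_pairs[of d] by auto
  ultimately show ?thesis
    unfolding assms(8) gen_footprint_eq W P_val_pairs by simp
qed

end
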